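(* Let $d\ge1$ be an integer and $a\in\mathbb{C}$ with $|a|>1$. Then the free critical points $c_\pm$ of $B_a$ do not lie in the immediate basins $\mathcal{A}^*(0)$ or $\mathcal{A}^*(\infty)$. Consequently: 1. $\mathcal{A}^*(0)$ and $\mathcal{A}^*(\infty)$ are simply connected. 2. The boundary $\partial\mathcal{A}^*(\infty)$ contains exactly $d$ fixed points of $B_a$ (and by symmetry, so does $\partial\mathcal{A}^*(0)$).
   Context: $B_a(z)=z^{d+1}\left(\frac{z-a}{1-\bar a z}\right)^d$ is a rational map of degree $2d+1$ on $\widehat{\mathbb{C}}$, commuting with $\mathcal{I}(z)=1/\bar z$, for which $0$ and $\infty$ are super-attracting fixed points; $\mathcal{A}^*(0)$ and $\mathcal{A}^*(\infty)$ are their immediate basins of attraction. The free critical points $c_\pm$ are the critical points other than $0,\infty,a,1/\bar a$, namely the roots of $h(z)=\bar a(d+1)z^2-(2d+1+|a|^2)z+a(d+1)$. *)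

theory Defs
  imports "HOL-Complex_Analysis.Complex_Analysis"
begin

text \<open>
  The Riemann sphere as a type of its own (the one-point compactification of the plane), so that
  \<open>connected_component_set\<close>, \<open>frontier\<close>, \<open>simply_connected\<close> and sequence limits apply to it.
\<close>

datatype riemann_sphere = Fin complex | Infty

instantiation riemann_sphere :: topological_space
begin

definition open_riemann_sphere :: "riemann_sphere set \<Rightarrow> bool" where
  "open S \<longleftrightarrow> open (Fin -` S) \<and> (Infty \<in> S \<longrightarrow> compact (- (Fin -` S)))"

instance
proof
  show "open (UNIV :: riemann_sphere set)"
    by (simp add: open_riemann_sphere_def)
next
  fix S T :: "riemann_sphere set"
  assume "open S" "open T"
  then show "open (S \<inter> T)"
    by (auto simp: open_riemann_sphere_def Compl_Int intro!: open_Int compact_Un)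
next
  fix K :: "riemann_sphere set set"
  assume K: "\<forall>S\<in>K. open S"
  have op: "open (Fin -` \<Union>K)"
    using K by (auto simp: open_riemann_sphere_def vimage_Union)
  moreover have "compact (- (Fin -` \<Union>K))" if inf: "Infty \<in> \<Union>K"
  proof -
    obtain S where S: "S \<in> K" "Infty \<in> S"
      using inf by blast
    then have "compact (- (Fin -` S) \<inter> - (Fin -` \<Union>K))"
      using K op by (intro compact_Int_closed) (auto simp: open_riemann_sphere_def)
    moreover have "- (Fin -` S) \<inter> - (Fin -` \<Union>K) = - (Fin -` \<Union>K)"
      using S by auto
    ultimately show ?thesis
      by simp
  qed
  ultimately show "open (\<Union>K)"
    by (simp add: open_riemann_sphere_def)
qed

end

lemma open_riemann_sphere_iff_Alexandroff:
  "open S \<longleftrightarrow>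
   openin (Alexandroff_compactification euclidean) (case_riemann_sphere Some None ` S)"
    (is "_ \<longleftrightarrow> openin _ (?c ` S)")
proof -
  have c_eq: "None = ?c x \<longleftrightarrow> x = Infty" "Some z = ?c x \<longleftrightarrow> x = Fin z" for x z
    by (cases x; auto)+
  have None_iff: "None \<in> ?c ` T \<longleftrightarrow> Infty \<in> T"
    and Some_iff: "Some z \<in> ?c ` T \<longleftrightarrow> Fin z \<in> T" for z T
    by (simp_all only: image_iff c_eq bex_triv_one_point1)
  have eq1: "?c ` S = Some ` U \<longleftrightarrow> Infty \<notin> S \<and> Fin -` S = U" for U
  proof -
    have "?c ` S = Some ` U \<longleftrightarrow>
        (\<forall>x. x \<in> ?c ` S \<longleftrightarrow> x \<in> Some ` U)"
      by (rule set_eq_iff)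
    also have "\<dots> \<longleftrightarrow> Infty \<notin> S \<and> (\<forall>z. Fin z \<in> S \<longleftrightarrow> z \<in> U)"
      by (simp only: split_option_all None_iff Some_iff) auto
    also have "(\<forall>z. Fin z \<in> S \<longleftrightarrow> z \<in> U) \<longleftrightarrow> Fin -` S = U"
      by blast
    finally show ?thesis .
  qed
  have eq2: "?c ` S = insert None (Some ` (UNIV - C)) \<longleftrightarrow> Infty \<in> S \<and> - (Fin -` S) = C" for C
  proof -
    have "?c ` S = insert None (Some ` (UNIV - C)) \<longleftrightarrow>
        (\<forall>x. x \<in> ?c ` S \<longleftrightarrow> x \<in> insert None (Some ` (UNIV - C)))"
      by (rule set_eq_iff)
    also have "\<dots> \<longleftrightarrow> Infty \<in> S \<and> (\<forall>z. Fin z \<in> S \<longleftrightarrow> z \<notin> C)"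
      by (simp only: split_option_all None_iff Some_iff) auto
    also have "(\<forall>z. Fin z \<in> S \<longleftrightarrow> z \<notin> C) \<longleftrightarrow> - (Fin -` S) = C"
      by blast
    finally show ?thesis .
  qed
  show ?thesis
    unfolding openin_Alexandroff_compactification open_riemann_sphere_def
    by (auto simp: eq1 eq2 compact_imp_closed open_closed)
qed

text \<open>
  The standard charts, centred at their first argument \<open>p\<close>: \<open>q - p\<close> at a finite point and \<open>1 / q\<close> at
  infinity. The value \<open>0\<close> at the one point outside the chart domain is a dummy, and so is harmless for
  derivatives at the centre of maps continuous there.
\<close>

fun sphere_coord :: "riemann_sphere \<Rightarrow> riemann_sphere \<Rightarrow> complex" where
  "sphere_coord (Fin z) (Fin w) = w - z"
| "sphere_coord (Fin z) Infty = 0"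
| "sphere_coord Infty (Fin w) = 1 / w"
| "sphere_coord Infty Infty = 0"

fun sphere_param :: "riemann_sphere \<Rightarrow> complex \<Rightarrow> riemann_sphere" where
  "sphere_param (Fin z) w = Fin (z + w)"
| "sphere_param Infty w = (if w = 0 then Infty else Fin (1 / w))"

definition critical_point :: "(riemann_sphere \<Rightarrow> riemann_sphere) \<Rightarrow> riemann_sphere \<Rightarrow> bool" where
  "critical_point f p \<longleftrightarrow>
     ((\<lambda>w. sphere_coord (f p) (f (sphere_param p w))) has_field_derivative 0) (at 0)"

definition basin :: "(riemann_sphere \<Rightarrow> riemann_sphere) \<Rightarrow> riemann_sphere \<Rightarrow> riemann_sphere set" where
  "basin f p = {q. (\<lambda>n. (f ^^ n) q) \<longlonglongrightarrow> p}"

definition immediate_basin ::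
    "(riemann_sphere \<Rightarrow> riemann_sphere) \<Rightarrow> riemann_sphere \<Rightarrow> riemann_sphere set" where
  "immediate_basin f p = connected_component_set (basin f p) p"

text \<open>
  The values at the pole \<open>1 / cnj a\<close> and at infinity are those of the continuous extension provided
  \<open>d \<ge> 1\<close> and \<open>cmod a \<noteq> 1\<close>.
\<close>

fun Bmap :: "nat \<Rightarrow> complex \<Rightarrow> riemann_sphere \<Rightarrow> riemann_sphere" where
  "Bmap d a (Fin z) =
     (if 1 - cnj a * z = 0 then Infty
      else Fin (z ^ (d + 1) * ((z - a) / (1 - cnj a * z)) ^ d))"
| "Bmap d a Infty = Infty"

definition free_critical_points :: "nat \<Rightarrow> complex \<Rightarrow> riemann_sphere set" where
  "free_critical_points d a =
     {c. critical_point (Bmap d a) c} - {Fin 0, Infty, Fin a, Fin (1 / cnj a)}"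

lemma Bmap_deriv:
  assumes "d \<ge> 1" and nz: "1 - cnj a * z \<noteq> 0"
  shows "((\<lambda>z. z ^ (d + 1) * ((z - a) / (1 - cnj a * z)) ^ d) has_field_derivative
     - (z ^ d * (z - a) ^ (d - 1) / (1 - cnj a * z) ^ (d + 1) *
        (cnj a * (of_nat d + 1) * z\<^sup>2 - (2 * of_nat d + 1 + a * cnj a) * z + a * (of_nat d + 1)))) (at z)"
proof -
  obtain e where e: "d = Suc e"
    using assms(1) by (cases d) auto
  have "((\<lambda>z. z ^ (d + 1) * ((z - a) / (1 - cnj a * z)) ^ d) has_field_derivative
     (of_nat (d + 1) * z ^ d * ((z - a) / (1 - cnj a * z)) ^ d
      + z ^ (d + 1) * (of_nat d * ((z - a) / (1 - cnj a * z)) ^ (d - 1)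
        * ((1 - cnj a * z) + cnj a * (z - a)) / (1 - cnj a * z)\<^sup>2))) (at z)"
  proof -
    define g where "g = (\<lambda>z. (z - a) / (1 - cnj a * z))"
    define D where "D = ((1 - cnj a * z) + cnj a * (z - a)) / (1 - cnj a * z)\<^sup>2"
    have "(g has_field_derivative D) (at z)"
      unfolding g_def D_def using nz
      by (auto intro!: derivative_eq_intros simp: power2_eq_square)
    then have "((\<lambda>z. g z ^ d) has_field_derivative of_nat d * (D * g z ^ (d - 1))) (at z)"
      using DERIV_power [of g D z UNIV d] by simp
    moreover have "((\<lambda>z. z ^ (d + 1)) has_field_derivative of_nat (d + 1) * z ^ d) (at z)"
      using DERIV_power [OF DERIV_ident [of "at z"], of "d + 1"] by simp
    ultimately have "((\<lambda>z. z ^ (d + 1) * g z ^ d) has_field_derivative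
        of_nat (d + 1) * z ^ d * g z ^ d + of_nat d * (D * g z ^ (d - 1)) * z ^ (d + 1)) (at z)"
      by (rule DERIV_mult [rotated])
    then show ?thesis
      by (simp add: g_def D_def mult_ac)
  qed
  also have "of_nat (d + 1) * z ^ d * ((z - a) / (1 - cnj a * z)) ^ d
      + z ^ (d + 1) * (of_nat d * ((z - a) / (1 - cnj a * z)) ^ (d - 1)
        * ((1 - cnj a * z) + cnj a * (z - a)) / (1 - cnj a * z)\<^sup>2) =
     - (z ^ d * (z - a) ^ (d - 1) / (1 - cnj a * z) ^ (d + 1) *
        (cnj a * (of_nat d + 1) * z\<^sup>2 - (2 * of_nat d + 1 + a * cnj a) * z + a * (of_nat d + 1)))"
  proof -
    define u where "u = 1 - cnj a * z"
    define v where "v = z - a"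
    have u0: "u \<noteq> 0"
      using nz by (simp add: u_def)
    have key: "(of_nat d + 1) * v * u + of_nat d * z * (u + cnj a * v) =
       - (cnj a * (of_nat d + 1) * z\<^sup>2 - (2 * of_nat d + 1 + a * cnj a) * z + a * (of_nat d + 1))"
      by (simp add: u_def v_def power2_eq_square algebra_simps)
    have "of_nat (d + 1) * z ^ d * (v / u) ^ d
        + z ^ (d + 1) * (of_nat d * (v / u) ^ (d - 1) * (u + cnj a * v) / u\<^sup>2) =
       z ^ d * v ^ (d - 1) / u ^ (d + 1) *
        ((of_nat d + 1) * v * u + of_nat d * z * (u + cnj a * v))"
    proof -
      define W where "W = z ^ d * v ^ (d - 1) / u ^ (d + 1)"
      define P where "P = z ^ d * (v / u) ^ d"
      define Q where "Q = z ^ (d + 1) * ((v / u) ^ (d - 1) / u\<^sup>2)"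
      have P: "P = W * (v * u)"
        using u0 by (simp add: P_def W_def e power_divide)
      have Q: "Q = W * z"
        by (simp add: Q_def W_def e power_divide power2_eq_square mult_ac)
      have "of_nat (d + 1) * z ^ d * (v / u) ^ d
          + z ^ (d + 1) * (of_nat d * (v / u) ^ (d - 1) * (u + cnj a * v) / u\<^sup>2) =
        (of_nat d + 1) * P + of_nat d * (u + cnj a * v) * Q"
        unfolding P_def Q_def by (simp add: mult_ac add_ac)
      also have "\<dots> = W * ((of_nat d + 1) * v * u + of_nat d * z * (u + cnj a * v))"
        unfolding P Q by (simp add: algebra_simps)
      finally show ?thesis
        unfolding W_def .
    qed
    then show ?thesis
      unfolding key mult_minus_right unfolding u_def v_def .
  qed
  finally show ?thesis .
qed

lemma critical_point_Bmap_Fin: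
  assumes "1 - cnj a * z \<noteq> 0"
  shows "critical_point (Bmap d a) (Fin z) \<longleftrightarrow>
    ((\<lambda>z. z ^ (d + 1) * ((z - a) / (1 - cnj a * z)) ^ d) has_field_derivative 0) (at z)"
proof -
  define F where "F = (\<lambda>z. z ^ (d + 1) * ((z - a) / (1 - cnj a * z)) ^ d)"
  have "eventually (\<lambda>w. 1 - cnj a * (z + w) \<noteq> 0) (nhds 0)"
  proof -
    have "isCont (\<lambda>w. 1 - cnj a * (z + w)) 0"
      by (intro continuous_intros)
    then have "((\<lambda>w. 1 - cnj a * (z + w)) \<longlongrightarrow> 1 - cnj a * z) (nhds 0)"
      by (simp add: continuous_at tendsto_nhds_iff)
    then show ?thesis
      using assms by (rule tendsto_imp_eventually_ne)
  qed
  then have ev: "eventually (\<lambda>w. sphere_coord (Bmap d a (Fin z)) (Bmap d a (sphere_param (Fin z) w))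
      = F (z + w) - F z) (nhds 0)"
    by eventually_elim (use assms in \<open>simp add: F_def\<close>)
  have "critical_point (Bmap d a) (Fin z) \<longleftrightarrow>
      ((\<lambda>w. F (z + w) - F z) has_field_derivative 0) (at 0)"
    unfolding critical_point_def by (rule DERIV_cong_ev [OF refl ev refl])
  also have "\<dots> \<longleftrightarrow> (F has_field_derivative 0) (at z)"
  proof
    assume "((\<lambda>w. F (z + w) - F z) has_field_derivative 0) (at 0)"
    then have "((\<lambda>w. (F (z + w) - F z) + F z) has_field_derivative 0 + 0) (at 0)"
      by (intro DERIV_add DERIV_const)
    then show "(F has_field_derivative 0) (at z)"
      using DERIV_shift [of F 0 0 z] by (simp add: add.commute)
  next
    assume "(F has_field_derivative 0) (at z)"
    then have "((\<lambda>w. F (z + w)) has_field_derivative 0) (at 0)"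
      using DERIV_shift [of F 0 0 z] by (simp add: add.commute)
    then have "((\<lambda>w. F (z + w) - F z) has_field_derivative 0 - 0) (at 0)"
      by (intro DERIV_diff DERIV_const)
    then show "((\<lambda>w. F (z + w) - F z) has_field_derivative 0) (at 0)"
      by simp
  qed
  finally show ?thesis
    by (simp add: F_def)
qed

lemma free_critical_points_eq_roots:
  assumes d: "d \<ge> 1" and a: "cmod a > 1"
  shows "free_critical_points d a =
    Fin ` {z. cnj a * (of_nat d + 1) * z\<^sup>2 - (2 * of_nat d + 1 + (of_real (cmod a))\<^sup>2) * z
              + a * (of_nat d + 1) = 0}"
proof -
  define h where "h = (\<lambda>z. cnj a * (of_nat d + 1) * z\<^sup>2 - (2 * of_nat d + 1 + a * cnj a) * z
              + a * (of_nat d + 1))"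
  have a0: "a \<noteq> 0"
    using a by auto
  have d0: "(of_nat d :: complex) \<noteq> 0" "(of_nat d + 1 :: complex) \<noteq> 0"
    using d of_nat_neq_0 [of d, where 'a = complex] by (simp_all add: add.commute)
  have n1: "a * cnj a \<noteq> 1"
  proof
    assume "a * cnj a = 1"
    then have "complex_of_real ((cmod a)\<^sup>2) = 1"
      by (simp only: complex_norm_square)
    then have "(cmod a)\<^sup>2 = 1"
      by (simp only: of_real_eq_1_iff)
    then show False
      using a by (simp add: power2_eq_1_iff)
  qed
  have h0: "h 0 \<noteq> 0"
    using a0 d0 by (simp add: h_def)
  have "h a = a * of_nat d * (a * cnj a - 1)"
    by (simp add: h_def power2_eq_square algebra_simps)
  then have ha: "h a \<noteq> 0"
    using a0 d0 n1 by simp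
  have "cnj a * h (1 / cnj a) = of_nat d * (a * cnj a - 1)"
    using a0 by (simp add: h_def power2_eq_square field_simps)
  then have hp: "h (1 / cnj a) \<noteq> 0"
    using d0 n1 by auto
  have pole: "1 - cnj a * z = 0 \<longleftrightarrow> z = 1 / cnj a" for z
    using a0 by (auto simp: field_simps)
  have key: "critical_point (Bmap d a) (Fin z) \<longleftrightarrow> h z = 0"
    if z: "z \<noteq> 0" "z \<noteq> a" "z \<noteq> 1 / cnj a" for z
  proof -
    have nz: "1 - cnj a * z \<noteq> 0"
      using z pole by blast
    define F where "F = (\<lambda>z. z ^ (d + 1) * ((z - a) / (1 - cnj a * z)) ^ d)"
    define D where "D = - (z ^ d * (z - a) ^ (d - 1) / (1 - cnj a * z) ^ (d + 1) * h z)"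
    have "(F has_field_derivative D) (at z)"
      using Bmap_deriv [OF d nz] by (simp only: F_def D_def h_def)
    then have "(F has_field_derivative 0) (at z) \<longleftrightarrow> D = 0"
      using DERIV_unique by blast
    moreover have "D = 0 \<longleftrightarrow> h z = 0"
      using z nz by (simp add: D_def)
    ultimately show ?thesis
      unfolding critical_point_Bmap_Fin [OF nz] F_def by blast
  qed
  have "c \<in> free_critical_points d a \<longleftrightarrow> c \<in> Fin ` {z. h z = 0}" for c
  proof (cases c)
    case (Fin z)
    have "z \<noteq> 0 \<and> z \<noteq> a \<and> z \<noteq> 1 / cnj a" if "h z = 0"
      using that h0 ha hp by metis
    then show ?thesis
      using key [of z] by (auto simp: Fin free_critical_points_def simp del: times_divide_eq_left)
  next
    case Infty
    then show ?thesis
      by (auto simp: free_critical_points_def)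
  qed
  then have "free_critical_points d a = Fin ` {z. h z = 0}"
    by blast
  moreover have "(complex_of_real (cmod a))\<^sup>2 = a * cnj a"
    using complex_norm_square [of a] by simp
  ultimately show ?thesis
    by (simp only: h_def)
qed

end

theory Submission
  imports Defs
begin

text \<open>
  Write \<open>f\<close> for the map in the plane and let \<open>A\<close> be the set of points of the open unit disc whose
  orbit stays in the disc and tends to \<open>0\<close>. It is exhausted by the sets \<open>U n\<close>, the successive preimages
  in the disc of a small disc around \<open>0\<close>. Since \<open>0\<close> is the only zero of \<open>f\<close> in the disc, every
  \<open>U n\<close> is connected, and \<open>A\<close> is the immediate basin of \<open>0\<close>.

  The complement of \<open>U n\<close> is connected by induction: since \<open>f\<close> is open, a bounded piece split off
  the complement of \<open>U (n + 1)\<close> must contain the pole \<open>1 / cnj a\<close>. If \<open>|a| \<le> 2d + 1\<close>, then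
  \<open>|f| \<ge> 1\<close> on the segment from the pole to \<open>a / |a|\<close>, which joins the pole to the circle. If
  \<open>|a| > 2d + 1\<close>, then the free critical points may be captured, but a splitting would make \<open>f\<close> a
  bijection of a ring around the unit circle onto a strictly larger ring, so that its inverse would
  contract the circle onto itself. Hence \<open>A\<close> is simply connected.

  The Riemann map of \<open>A\<close> conjugates \<open>f\<close> to a proper self-map of the disc with a single zero, of
  order \<open>d + 1\<close>, that is to \<open>w \<mapsto> w ^ (d + 1)\<close>; so \<open>0\<close> is the only critical point in \<open>A\<close>.

  Writing \<open>f z = z * g z ^ d\<close>, the fixed points other than \<open>0\<close> and \<open>\<infinity>\<close> are the solutions of
  \<open>g z = \<omega>\<close> with \<open>\<omega> ^ d = 1\<close>, two for each \<open>\<omega>\<close>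
  (with multiplicity). The \<open>d\<close> fixed rays of \<open>A\<close> accumulate at points
  with \<open>d\<close> different values of \<open>g\<close>. Conversely two points on the frontier with the same \<open>\<omega>\<close> would
  both lie on the unit circle, where one of them has a real multiplier smaller than \<open>1\<close>. Such a point
  is attracting, or \<open>f\<close> maps the disc near it to the outside, and so it is not on the frontier of \<open>A\<close>.
\<close>

subsection \<open>Holomorphic maps\<close>

lemma two_nth_roots:
  fixes w :: complex
  assumes "n > 1" "w \<noteq> 0"
  obtains u v where "u \<noteq> v" "u ^ n = w" "v ^ n = w"
proof -
  have "card {z. z ^ n = w} = n"
    using card_nth_roots [of w n] assms by simp
  then have "card {z. z ^ n = w} > 1"
    using assms by simp
  then obtain u v where "u \<in> {z. z ^ n = w}" "v \<in> {z. z ^ n = w}" "u \<noteq> v"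
    by (metis card_1_singletonE card_eq_0_iff card_le_Suc0_iff_eq card_ge_0_finite gr0I
        linorder_not_less not_one_less_zero One_nat_def)
  then show ?thesis
    using that by blast
qed

text \<open>Near \<open>z0\<close> the difference \<open>f - f z0\<close> is the \<open>n\<close>-th
  power, with \<open>n > 1\<close>, of a nonconstant map \<open>h\<close> vanishing at
  \<open>z0\<close>. A small nonzero value has at least two \<open>n\<close>-th roots, and
  \<open>h\<close> attains each of them.\<close>

lemma critical_value_two_preimages:
  assumes hol: "f holomorphic_on N" and N: "open N" "z0 \<in> N"
    and crit: "deriv f z0 = 0"
    and nonconst: "\<And>X. open X \<Longrightarrow> X \<subseteq> N \<Longrightarrow> X \<noteq> {} \<Longrightarrow> \<not> f constant_on X"
  obtains e where "e > 0"
    "\<And>w. w \<in> ball (f z0) e \<Longrightarrow> w \<noteq> f z0 \<Longrightarrow> \<exists>x\<in>N. \<exists>y\<in>N. x \<noteq> y \<and> f x = w \<and> f y = w"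
proof -
  obtain \<rho> where \<rho>: "\<rho> > 0" "ball z0 \<rho> \<subseteq> N"
    using N by (blast elim!: openE)
  have hol\<rho>: "f holomorphic_on ball z0 \<rho>"
    using hol \<rho> holomorphic_on_subset by blast
  have "\<exists>n>0. (deriv ^^ n) f z0 \<noteq> 0"
  proof (rule ccontr)
    assume neg: "\<not> (\<exists>n>0. (deriv ^^ n) f z0 \<noteq> 0)"
    then have der: "(deriv ^^ n) f z0 = 0" if "0 < n" for n
      using that by blast
    have "f w = f z0" if "w \<in> ball z0 \<rho>" for w
      by (rule holomorphic_fun_eq_const_on_connected [OF hol\<rho> _ _ der]) (use that \<rho> in auto)
    then have "f constant_on ball z0 \<rho>"
      by (auto simp: constant_on_def)
    then show False
      using nonconst [of "ball z0 \<rho>"] \<rho> by auto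
  qed
  then obtain n0 where n0: "n0 > 0 \<and> (deriv ^^ n0) f z0 \<noteq> 0"
    by blast
  define n where [abs_def]: "n = (LEAST n. n > 0 \<and> (deriv ^^ n) f z0 \<noteq> 0)"
  have n: "n > 0" "(deriv ^^ n) f z0 \<noteq> 0"
    using def_LeastI [OF n_def n0] by auto
  have n_min: "\<And>k. 0 < k \<Longrightarrow> k < n \<Longrightarrow> (deriv ^^ k) f z0 = 0"
    using def_Least_le [OF n_def] not_le by auto
  have "n \<noteq> 1"
    using n crit by auto
  then have n1: "n > 1"
    using n by simp
  obtain g \<delta> where \<delta>: "0 < \<delta>"
    and holg: "g holomorphic_on ball z0 \<delta>"
    and fd: "\<And>w. w \<in> ball z0 \<delta> \<Longrightarrow> f w - f z0 = ((w - z0) * g w) ^ n"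
    and gnz: "\<And>w. w \<in> ball z0 \<delta> \<Longrightarrow> g w \<noteq> 0"
    by (blast intro: n_min holomorphic_factor_order_of_zero_strong [OF hol \<open>open N\<close> \<open>z0 \<in> N\<close> n])
  define \<sigma> where "\<sigma> = min \<rho> \<delta>"
  define h where "h = (\<lambda>w. (w - z0) * g w)"
  have \<sigma>: "\<sigma> > 0" "ball z0 \<sigma> \<subseteq> N" "ball z0 \<sigma> \<subseteq> ball z0 \<delta>"
    using \<rho> \<delta> by (auto simp: \<sigma>_def)
  have "h holomorphic_on ball z0 \<sigma>"
    unfolding h_def using holomorphic_on_subset [OF holg \<sigma>(3)] by (intro holomorphic_intros)
  moreover have "\<not> h constant_on ball z0 \<sigma>"
  proof
    assume "h constant_on ball z0 \<sigma>"
    then have c: "h (z0 + \<sigma> / 2) = h z0"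
      using \<sigma>(1) unfolding constant_on_def by (auto simp: dist_norm)
    have "z0 + \<sigma> / 2 \<in> ball z0 \<delta>"
      using \<sigma> by (intro subsetD [OF \<sigma>(3)]) (simp add: dist_norm)
    then show False
      using c gnz \<sigma>(1) by (auto simp: h_def)
  qed
  ultimately have "open (h ` ball z0 \<sigma>)"
    by (intro open_mapping_thm [of h "ball z0 \<sigma>"]) auto
  moreover have "0 \<in> h ` ball z0 \<sigma>"
    using \<sigma> by (intro image_eqI [of _ _ z0]) (auto simp: h_def)
  ultimately obtain \<epsilon> where \<epsilon>: "\<epsilon> > 0" "ball 0 \<epsilon> \<subseteq> h ` ball z0 \<sigma>"
    by (blast elim!: openE)
  show ?thesis
  proof
    show "\<epsilon> ^ n > 0"
      using \<epsilon> by simp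
    fix w assume w: "w \<in> ball (f z0) (\<epsilon> ^ n)" "w \<noteq> f z0"
    then have "w - f z0 \<noteq> 0"
      by simp
    then obtain u v where uv: "u \<noteq> v" "u ^ n = w - f z0" "v ^ n = w - f z0"
      using two_nth_roots [OF n1] by blast
    have small: "t \<in> ball 0 \<epsilon>" if "t ^ n = w - f z0" for t
    proof -
      have "cmod t ^ n < \<epsilon> ^ n"
        using w(1) that by (simp add: norm_power [symmetric] dist_norm norm_minus_commute)
      then show ?thesis
        using \<epsilon> by (simp add: power_less_imp_less_base)
    qed
    have "u \<in> h ` ball z0 \<sigma>" "v \<in> h ` ball z0 \<sigma>"
      using small [OF uv(2)] small [OF uv(3)] \<epsilon>(2) by auto
    then obtain x y where xy: "x \<in> ball z0 \<sigma>" "u = h x" "y \<in> ball z0 \<sigma>" "v = h y"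
      by (elim imageE)
    have "f x = w" "f y = w"
      using fd [OF subsetD [OF \<sigma>(3) xy(1)]] fd [OF subsetD [OF \<sigma>(3) xy(3)]] uv xy(2,4)
      by (simp_all add: h_def)
    moreover have "x \<noteq> y" "x \<in> N" "y \<in> N"
      using uv(1) xy \<sigma>(2) by auto
    ultimately show "\<exists>x\<in>N. \<exists>y\<in>N. x \<noteq> y \<and> f x = w \<and> f y = w"
      by blast
  qed
qed

text \<open>A compact full preimage makes \<open>f\<close> proper over \<open>W\<close>, so the
  image is both open and closed in the connected set \<open>W\<close>.\<close>

lemma clopen_image_eq:
  fixes f :: "complex \<Rightarrow> complex"
  assumes cont: "continuous_on K f" and op: "open (f ` N)"
    and K: "compact K" "K \<noteq> {}" "K = N \<inter> f -` W" and W: "connected W"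
  shows "f ` K = W"
proof -
  have "f ` K = W \<inter> f ` N"
    unfolding K(3) by auto
  then have "openin (top_of_set W) (f ` K)"
    using openin_open_Int [OF op, of W] by simp
  moreover have "closedin (top_of_set W) (f ` K)"
    using compact_imp_closed [OF compact_continuous_image [OF cont K(1)]] K(3)
    by (auto intro!: closed_subset)
  ultimately show ?thesis
    using W K(2) unfolding connected_clopen by blast
qed

text \<open>
  The number of preimages in \<open>K\<close>, counted with multiplicity, is locally constant on \<open>W\<close>; in
  particular the set where it exceeds one is open and closed in \<open>W\<close>.
\<close>

lemma unique_preimage_imp_inj_on:
  assumes hol: "f holomorphic_on N" and N: "open N"
    and nonconst: "\<And>X. open X \<Longrightarrow> X \<subseteq> N \<Longrightarrow> X \<noteq> {} \<Longrightarrow> \<not> f constant_on X"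
    and K: "compact K" "K = N \<inter> f -` W" and W: "connected W"
    and x0: "x0 \<in> K" "deriv f x0 \<noteq> 0" "\<And>x. x \<in> K \<Longrightarrow> f x = f x0 \<Longrightarrow> x = x0"
  shows "inj_on f K"
proof -
  define T where "T = {w \<in> W. \<exists>x\<in>K. \<exists>y\<in>K. f x = w \<and> f y = w \<and> (x \<noteq> y \<or> deriv f x = 0)}"
  have open_im: "open (f ` X)" if "open X" "X \<subseteq> N" for X
    by (rule open_mapping_thm2 [OF hol N that]) (use nonconst in auto)
  have "openin (top_of_set W) T"
    unfolding openin_subopen [of _ T]
  proof (intro ballI)
    fix w assume "w \<in> T"
    then obtain x y where w: "w \<in> W" and xy: "x \<in> K" "y \<in> K" "f x = w" "f y = w"
      and alt: "x \<noteq> y \<or> deriv f x = 0"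
      unfolding T_def by blast
    have xyN: "x \<in> N" "y \<in> N"
      using xy K by auto
    have "\<exists>S. open S \<and> w \<in> S \<and> W \<inter> S \<subseteq> T"
    proof (cases "x = y")
      case False
      then obtain P Q where PQ: "open P" "open Q" "x \<in> P" "y \<in> Q" "P \<inter> Q = {}"
        using hausdorff [OF False] by metis
      have "open (f ` (P \<inter> N) \<inter> f ` (Q \<inter> N))"
        using PQ N by (intro open_Int open_im) auto
      moreover have "w \<in> f ` (P \<inter> N) \<inter> f ` (Q \<inter> N)"
        using imageI [of x "P \<inter> N" f] imageI [of y "Q \<inter> N" f] PQ(3,4) xy(3,4) xyN by simp
      moreover have "W \<inter> (f ` (P \<inter> N) \<inter> f ` (Q \<inter> N)) \<subseteq> T"
      proof
        fix v assume v: "v \<in> W \<inter> (f ` (P \<inter> N) \<inter> f ` (Q \<inter> N))"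
        then obtain x' y' where xy': "x' \<in> P \<inter> N" "y' \<in> Q \<inter> N" "v = f x'" "v = f y'"
          by blast
        then have "x' \<in> K" "y' \<in> K" "x' \<noteq> y'"
          using K(2) v PQ(5) by auto
        then show "v \<in> T"
          using v xy' unfolding T_def by auto
      qed
      ultimately show ?thesis
        by blast
    next
      case True
      then have crit: "deriv f x = 0"
        using alt by simp
      obtain e where e: "e > 0"
        "\<And>w. w \<in> ball (f x) e \<Longrightarrow> w \<noteq> f x \<Longrightarrow> \<exists>x\<in>N. \<exists>y\<in>N. x \<noteq> y \<and> f x = w \<and> f y = w"
        by (rule critical_value_two_preimages [OF hol N xyN(1) crit nonconst]) blast+
      have "W \<inter> ball w e \<subseteq> T"
      proof
        fix v assume v: "v \<in> W \<inter> ball w e"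
        show "v \<in> T"
        proof (cases "v = w")
          case False
          then obtain x' y' where xy': "x' \<in> N" "y' \<in> N" "x' \<noteq> y'" "f x' = v" "f y' = v"
            using e(2) [of v] v xy by auto
          then show ?thesis
            using v K(2) unfolding T_def by auto
        qed (use \<open>w \<in> T\<close> in simp)
      qed
      then show ?thesis
        using e(1) by (intro exI [of _ "ball w e"]) auto
    qed
    then obtain S where "open S" "w \<in> S" "W \<inter> S \<subseteq> T"
      by blast
    then show "\<exists>S. openin (top_of_set W) S \<and> w \<in> S \<and> S \<subseteq> T"
      using w by (intro exI [of _ "W \<inter> S"]) (auto intro: openin_open_Int)
  qed
  moreover have "closedin (top_of_set W) T"
  proof -
    have "w \<in> T" if w: "w \<in> W" "w \<in> closure T" for w
    proof -
      obtain t where t: "\<And>k. t k \<in> T" "t \<longlonglongrightarrow> w"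
        using w(2) unfolding closure_sequential by metis
      have "\<exists>x y. x \<in> K \<and> y \<in> K \<and> f x = t k \<and> f y = t k \<and> (x \<noteq> y \<or> deriv f x = 0)" for k
        using t(1) [of k] unfolding T_def by blast
      then obtain X Y where XY: "\<And>k. X k \<in> K" "\<And>k. Y k \<in> K" "\<And>k. f (X k) = t k"
          "\<And>k. f (Y k) = t k" "\<And>k. X k \<noteq> Y k \<or> deriv f (X k) = 0"
        by metis
      have sK: "seq_compact K" "seq_compact (K \<times> K)"
        using K(1) compact_Times compact_imp_seq_compact by blast+
      obtain l s where l: "l \<in> K \<times> K" "strict_mono (s :: nat \<Rightarrow> nat)" "((\<lambda>k. (X k, Y k)) \<circ> s) \<longlonglongrightarrow> l"
        by (rule seq_compactE [OF sK(2), of "\<lambda>k. (X k, Y k)"]) (use XY in auto)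
      obtain x y where lxy: "l = (x, y)"
        by (cases l)
      have x: "x \<in> K" "y \<in> K" "(\<lambda>k. X (s k)) \<longlonglongrightarrow> x" "(\<lambda>k. Y (s k)) \<longlonglongrightarrow> y"
        using l(1) tendsto_fst [OF l(3)] tendsto_snd [OF l(3)] by (simp_all add: lxy o_def)
      have xN: "x \<in> N" "y \<in> N"
        using x K(2) by auto
      have cont: "isCont f x" "isCont f y"
        using holomorphic_on_imp_continuous_on [OF hol] xN N by (simp_all add: continuous_on_eq_continuous_at)
      have ts: "(\<lambda>k. t (s k)) \<longlonglongrightarrow> w"
        using LIMSEQ_subseq_LIMSEQ [OF t(2) l(2)] by (simp add: o_def)
      have fx: "f x = w"
        using LIMSEQ_unique [OF isCont_tendsto_compose [OF cont(1) x(3)]] XY(3) ts by simp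
      have fy: "f y = w"
        using LIMSEQ_unique [OF isCont_tendsto_compose [OF cont(2) x(4)]] XY(4) ts by simp
      \<comment> \<open>If both limits were the same regular point, local injectivity would force
        \<open>X (s k) = Y (s k)\<close> eventually, so \<open>deriv f\<close> would vanish along
        the sequence and hence at the limit.\<close>
      have "x \<noteq> y \<or> deriv f x = 0"
      proof (rule ccontr)
        assume neg: "\<not> ?thesis"
        then obtain \<rho> where \<rho>: "\<rho> > 0" "ball x \<rho> \<subseteq> N" "inj_on f (ball x \<rho>)"
          using has_complex_derivative_locally_injective [OF hol xN(1) N] by metis
        have ev: "\<forall>\<^sub>F k in sequentially. X (s k) \<in> ball x \<rho>" "\<forall>\<^sub>F k in sequentially. Y (s k) \<in> ball x \<rho>"
          using topological_tendstoD [OF x(3), of "ball x \<rho>"] topological_tendstoD [OF x(4), of "ball x \<rho>"] neg \<rho>(1)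
          by simp_all
        then have "\<forall>\<^sub>F k in sequentially. deriv f (X (s k)) = 0"
        proof eventually_elim
          case (elim k)
          then have "X (s k) = Y (s k)"
            using inj_onD [OF \<rho>(3)] XY(3,4) by metis
          then show ?case
            using XY(5) by blast
        qed
        moreover have "(\<lambda>k. deriv f (X (s k))) \<longlonglongrightarrow> deriv f x"
        proof (rule isCont_tendsto_compose [OF _ x(3)])
          show "isCont (deriv f) x"
            using holomorphic_on_imp_continuous_on [OF holomorphic_deriv [OF hol N]] xN N
            by (simp add: continuous_on_eq_continuous_at)
        qed
        ultimately have "(\<lambda>k. 0) \<longlonglongrightarrow> deriv f x"
          by (rule Lim_transform_eventually [rotated])
        then have "deriv f x = 0"
          by (simp add: LIMSEQ_const_iff)
        then show False
          using neg by simp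
      qed
      then show ?thesis
        using x fx fy w(1) unfolding T_def by blast
    qed
    moreover have "T \<subseteq> W"
      by (auto simp: T_def)
    ultimately have "T = W \<inter> closure T"
      using closure_subset [of T] by blast
    then show ?thesis
      using closedin_closed by blast
  qed
  moreover have "f x0 \<notin> T"
    using x0(2,3) unfolding T_def by blast
  moreover have "f x0 \<in> W"
    using x0(1) K(2) by auto
  ultimately have "T = {}"
    using W unfolding connected_clopen by blast
  then show ?thesis
    using K(2) unfolding T_def inj_on_def by blast
qed

text \<open>Since \<open>\<phi>\<close> maps \<open>W\<close> into the compact set \<open>E\<close>,
  there is room to follow each step by a slight dilation about the orbit. The composites still map
  \<open>W\<close> into itself, so Cauchy's inequality bounds their derivatives independently of
  \<open>n\<close>.\<close>

lemma inverse_iterates_contract: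
  assumes hol: "\<phi> holomorphic_on W" and W: "open W" "bounded W"
    and E: "compact E" "E \<subseteq> W" "\<phi> ` W \<subseteq> E"
  obtains C q where "q > 1"
    "\<And>x n. x 0 \<in> E \<Longrightarrow> (\<And>k. x (Suc k) = \<phi> (x k)) \<Longrightarrow> (\<Prod>k<n. cmod (deriv \<phi> (x k))) * q ^ n \<le> C"
proof -
  obtain \<eta> where \<eta>: "\<eta> > 0" "(\<Union>x\<in>E. ball x \<eta>) \<subseteq> W"
    using compact_subset_open_imp_ball_epsilon_subset [OF E(1) W(1) E(2)] by blast
  obtain M where M: "M > 0" "\<And>x. x \<in> W \<Longrightarrow> cmod x \<le> M"
    using W(2) unfolding bounded_pos by blast
  \<comment> \<open>The dilation moves a point of \<open>E\<close> by at most
    \<open>\<delta> * (2 * M)\<close>, which this choice keeps below \<open>\<eta>\<close>.\<close>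
  define \<delta> where "\<delta> = \<eta> / (3 * M)"
  have \<delta>: "\<delta> > 0" "\<delta> * (2 * M) < \<eta>"
    using \<eta> M by (simp_all add: \<delta>_def field_simps)
  show ?thesis
  proof
    show "1 + \<delta> > 1"
      using \<delta> by simp
    fix x :: "nat \<Rightarrow> complex" and n :: nat
    assume x0: "x 0 \<in> E" and xS: "\<And>k. x (Suc k) = \<phi> (x k)"
    have xE: "x k \<in> E" for k
      by (induction k) (use x0 xS E in auto)
    have xW: "x k \<in> W" for k
      using xE E by blast
    \<comment> \<open>This is \<open>\<phi>\<close> followed by the dilation centred at
      \<open>x (Suc k)\<close>: the orbit is unchanged, and derivatives gain the factor
      \<open>1 + \<delta>\<close>.\<close>
    define h where "h = (\<lambda>k y. \<phi> y + \<delta> * (\<phi> y - x (Suc k)))"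
    have hW: "h k y \<in> W" if "y \<in> W" for k y
    proof -
      have "\<phi> y \<in> E"
        using that E by blast
      moreover have "cmod (\<phi> y - x (Suc k)) \<le> 2 * M"
        using norm_triangle_ineq4 [of "\<phi> y" "x (Suc k)"] M(2) [OF subsetD [OF E(2) \<open>\<phi> y \<in> E\<close>]]
          M(2) [OF xW, of "Suc k"] by linarith
      then have "\<delta> * cmod (\<phi> y - x (Suc k)) < \<eta>"
        using \<delta> mult_left_mono [of "cmod (\<phi> y - x (Suc k))" "2 * M" \<delta>] by linarith
      then have "h k y \<in> ball (\<phi> y) \<eta>"
        using \<delta>(1) by (simp add: h_def dist_norm norm_mult)
      ultimately show ?thesis
        using \<eta> by blast
    qed
    define H where "H = rec_nat (\<lambda>y. y) (\<lambda>k G y. h k (G y))"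
    have H0: "H 0 = (\<lambda>y. y)" and HS: "H (Suc k) = (\<lambda>y. h k (H k y))" for k
      by (simp_all add: H_def)
    have HW: "H k y \<in> W" if "y \<in> W" for k y
      by (induction k) (use that hW in \<open>auto simp: H0 HS\<close>)
    have Hx: "H k (x 0) = x k" for k
      by (induction k) (auto simp: H0 HS h_def xS)
    have d\<phi>: "(\<phi> has_field_derivative deriv \<phi> y) (at y)" if "y \<in> W" for y
      using holomorphic_derivI [OF hol W(1) that] .
    have dh: "(h k has_field_derivative (1 + \<delta>) * deriv \<phi> y) (at y)" if "y \<in> W" for k y
      unfolding h_def using d\<phi> [OF that] by (auto intro!: derivative_eq_intros simp: algebra_simps)
    have dH: "\<exists>D. (H k has_field_derivative D) (at y)" if "y \<in> W" for k y
    proof (induction k)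
      case (Suc k)
      then show ?case
        unfolding HS using DERIV_chain2 [where f = "h k" and g = "H k", OF dh [OF HW [OF that]]] by blast
    qed (auto simp: H0 intro: DERIV_ident)
    have dHx: "(H k has_field_derivative (\<Prod>j<k. (1 + \<delta>) * deriv \<phi> (x j))) (at (x 0))" for k
    proof (induction k)
      case (Suc k)
      have "(h k has_field_derivative (1 + \<delta>) * deriv \<phi> (x k)) (at (H k (x 0)))"
        using dh [OF xW] Hx by simp
      from DERIV_chain2 [where f = "h k" and g = "H k", OF this Suc] show ?case
        by (simp add: HS mult.commute)
    qed (simp add: H0)
    have "cmod ((deriv ^^ 1) (H n) (x 0)) \<le> fact 1 * M / (\<eta> / 2) ^ 1"
    proof (rule Cauchy_inequality)
      have sub: "cball (x 0) (\<eta> / 2) \<subseteq> W"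
      proof -
        have "cball (x 0) (\<eta> / 2) \<subseteq> ball (x 0) \<eta>"
          using \<eta>(1) by auto
        also have "\<dots> \<subseteq> (\<Union>x\<in>E. ball x \<eta>)"
          using x0 by (rule UN_upper)
        finally show ?thesis
          using \<eta>(2) by (rule subset_trans)
      qed
      have "H n holomorphic_on W"
        using dH W(1) by (simp add: holomorphic_on_open)
      then have "H n holomorphic_on cball (x 0) (\<eta> / 2)"
        using sub by (rule holomorphic_on_subset)
      then show "H n holomorphic_on ball (x 0) (\<eta> / 2)" "continuous_on (cball (x 0) (\<eta> / 2)) (H n)"
        using holomorphic_on_subset [OF _ ball_subset_cball] holomorphic_on_imp_continuous_on by auto
      show "cmod (H n y) \<le> M" if "cmod (x 0 - y) = \<eta> / 2" for y
        using that sub by (intro M HW) (auto simp: dist_norm)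
    qed (use \<eta> in auto)
    moreover have "cmod ((deriv ^^ 1) (H n) (x 0)) = (\<Prod>k<n. cmod (deriv \<phi> (x k))) * (1 + \<delta>) ^ n"
    proof -
      have "cmod (1 + complex_of_real \<delta>) = 1 + \<delta>"
        using \<delta>(1) by (metis norm_of_real of_real_1 of_real_add abs_of_pos add_pos_pos zero_less_one)
      then show ?thesis
        using DERIV_imp_deriv [OF dHx [of n]]
        by (simp add: prod_norm [symmetric] norm_mult norm_power prod.distrib mult.commute)
    qed
    ultimately show "(\<Prod>k<n. cmod (deriv \<phi> (x k))) * (1 + \<delta>) ^ n \<le> fact 1 * M / (\<eta> / 2) ^ 1"
      by simp
  qed
qed

text \<open>Injectivity makes \<open>0\<close> the only zero of \<open>f\<close>, and a simple one,
  so the quotient by \<open>z\<close> has no zero.\<close>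

lemma holomorphic_divide_out_zero:
  assumes "f holomorphic_on S" "open S" "0 \<in> S" "f 0 = 0" "inj_on f S"
  obtains E where "E holomorphic_on S" "\<And>z. z \<in> S \<Longrightarrow> f z = z * E z" "\<And>z. z \<in> S \<Longrightarrow> E z \<noteq> 0"
proof
  define E where "E = (\<lambda>z. if z = 0 then deriv f 0 else f z / z)"
  show "E holomorphic_on S"
    using pole_lemma_open [OF assms(1,2), of 0] unfolding E_def assms(4) diff_0_right .
  show "f z = z * E z" if "z \<in> S" for z
    using assms(4) by (simp add: E_def)
  show "E z \<noteq> 0" if "z \<in> S" for z
  proof (cases "z = 0")
    case True
    then show ?thesis
      using holomorphic_injective_imp_regular [OF assms(1,2,5,3)] by (simp add: E_def)
  next
    case False
    then have "f z \<noteq> f 0"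
      using inj_onD [OF assms(5), of z 0] that assms(3) by blast
    then show ?thesis
      using False assms(4) by (simp add: E_def)
  qed
qed

text \<open>The maximum principle applies to both \<open>k\<close> and \<open>1 / k\<close>, whose moduli tend to \<open>1\<close> at the circle.\<close>

lemma proper_disc_map_eq_monomial:
  assumes k: "k holomorphic_on ball 0 1" "\<And>w. w \<in> ball 0 1 \<Longrightarrow> k w \<noteq> 0"
    and G: "\<And>w. w \<in> ball 0 1 \<Longrightarrow> cmod (w ^ m * k w) < 1"
    and proper: "\<And>s. s < 1 \<Longrightarrow> \<exists>\<rho><1. \<forall>w\<in>ball 0 1. \<rho> < cmod w \<longrightarrow> s < cmod (w ^ m * k w)"
  obtains \<kappa> where "cmod \<kappa> = 1" "\<And>w. w \<in> ball 0 1 \<Longrightarrow> k w = \<kappa>"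
proof -
  have sub: "cball 0 \<rho> \<subseteq> ball (0::complex) 1" if "\<rho> < 1" for \<rho>
    using that by auto
  have cont: "continuous_on (cball 0 \<rho>) k" if "\<rho> < 1" for \<rho>
    using holomorphic_on_subset [OF k(1) sub [OF that]] by (rule holomorphic_on_imp_continuous_on)
  have hol: "k holomorphic_on interior (cball 0 \<rho>)" if "\<rho> < 1" for \<rho>
    using holomorphic_on_subset [OF k(1)] sub [OF that] interior_subset by blast
  have ge: "1 \<le> cmod (k w)" if w: "w \<in> ball 0 1" for w
  proof (rule dense_le_bounded [of 0 1])
    fix s :: real assume s: "0 < s" "s < 1"
    then obtain \<rho>0 where \<rho>0: "\<rho>0 < 1" "\<And>w. w \<in> ball 0 1 \<Longrightarrow> \<rho>0 < cmod w \<Longrightarrow> s < cmod (w ^ m * k w)"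
      using proper by blast
    \<comment> \<open>The circle of radius \<open>\<rho>\<close> on which the maximum principle is
      used must surround \<open>w\<close> and lie beyond \<open>\<rho>0\<close>, where the lower
      bound \<open>s\<close> holds.\<close>
    define b where "b = max \<rho>0 (cmod w)"
    have "b < 1"
      using \<rho>0(1) w by (simp add: b_def)
    then obtain \<rho> where \<rho>: "b < \<rho>" "\<rho> < 1"
      using dense by blast
    have \<rho>': "\<rho>0 < \<rho>" "cmod w < \<rho>" "0 < \<rho>"
      using \<rho> le_less_trans [of 0 "cmod w" \<rho>] by (simp_all add: b_def)
    have "cmod (inverse (k w)) \<le> inverse s"
    proof (rule maximum_modulus_frontier [of "\<lambda>w. inverse (k w)" "cball 0 \<rho>"])
      show "(\<lambda>w. inverse (k w)) holomorphic_on interior (cball 0 \<rho>)"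
        using hol [OF \<rho>(2)] k(2) sub [OF \<rho>(2)] interior_subset by (intro holomorphic_intros) blast+
      show "continuous_on (closure (cball 0 \<rho>)) (\<lambda>w. inverse (k w))"
        using cont [OF \<rho>(2)] k(2) sub [OF \<rho>(2)] by (auto intro!: continuous_intros)
      fix z :: complex assume "z \<in> frontier (cball 0 \<rho>)"
      then have z: "cmod z = \<rho>"
        by simp
      then have "s < cmod (z ^ m * k z)"
        using \<rho>0(2) [of z] \<rho>' \<rho> by simp
      also have "\<dots> \<le> 1 * cmod (k z)"
        unfolding norm_mult norm_power z using \<rho> \<rho>' by (intro mult_right_mono power_le_one) auto
      finally show "cmod (inverse (k z)) \<le> inverse s"
        using s by (simp add: norm_inverse le_imp_inverse_le)
    qed (use \<rho>' in auto)
    then show "s \<le> cmod (k w)"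
      using s k(2) [OF w] by (simp add: norm_inverse)
  qed simp
  have le: "cmod (k w) \<le> 1" if w: "w \<in> ball 0 1" for w
  proof -
    have bound: "cmod (k w) * \<rho> ^ m \<le> 1" if \<rho>: "cmod w < \<rho>" "\<rho> < 1" for \<rho>
    proof -
      have \<rho>0: "0 < \<rho>"
        using \<rho> norm_ge_zero le_less_trans by blast
      have "cmod (k w) \<le> inverse (\<rho> ^ m)"
      proof (rule maximum_modulus_frontier [of k "cball 0 \<rho>"])
        fix z :: complex assume "z \<in> frontier (cball 0 \<rho>)"
        then have z: "cmod z = \<rho>"
          by simp
        then have "\<rho> ^ m * cmod (k z) < 1"
          using G [of z] \<rho> by (simp add: norm_mult norm_power)
        then show "cmod (k z) \<le> inverse (\<rho> ^ m)"
          using \<rho>0 by (simp add: field_simps)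
      qed (use hol cont \<rho> in auto)
      then show ?thesis
        using \<rho>0 by (simp add: field_simps)
    qed
    \<comment> \<open>Letting the radius tend to \<open>1\<close> removes the factor
      \<open>\<rho> ^ m\<close>.\<close>
    have "((\<lambda>\<rho>. cmod (k w) * \<rho> ^ m) \<longlongrightarrow> cmod (k w) * 1 ^ m) (at_left 1)"
      by (intro tendsto_intros)
    moreover have "eventually (\<lambda>\<rho>. cmod (k w) * \<rho> ^ m \<le> 1) (at_left 1)"
      using bound w by (auto simp: eventually_at_left [of 0])
    ultimately show ?thesis
      using tendsto_upperbound by (force simp: trivial_limit_at_left_real)
  qed
  have "k constant_on ball 0 1"
  proof (rule maximum_modulus_principle [OF k(1), where U = "ball 0 1" and \<xi> = 0])
    show "cmod (k z) \<le> cmod (k 0)" if "z \<in> ball 0 1" for z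
      using le [OF that] ge [of 0] by simp
  qed auto
  then obtain \<kappa> where \<kappa>: "\<And>w. w \<in> ball 0 1 \<Longrightarrow> k w = \<kappa>"
    by (auto simp: constant_on_def)
  have "cmod \<kappa> = 1"
    using \<kappa> [of 0] le [of 0] ge [of 0] by simp
  then show ?thesis
    using that \<kappa> by blast
qed

text \<open>A Riemann map is followed by a disc automorphism taking the image of \<open>0\<close>
  back to \<open>0\<close>.\<close>

lemma Riemann_map_centred:
  assumes "open S" "simply_connected S" "S \<noteq> UNIV" "0 \<in> S"
  obtains f h where "f holomorphic_on S" "h holomorphic_on ball 0 1"
    "\<And>z. z \<in> S \<Longrightarrow> f z \<in> ball 0 1" "\<And>z. z \<in> S \<Longrightarrow> h (f z) = z"
    "\<And>w. w \<in> ball 0 1 \<Longrightarrow> h w \<in> S" "\<And>w. w \<in> ball 0 1 \<Longrightarrow> f (h w) = w" "h 0 = 0"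
proof -
  have "S \<noteq> {}"
    using assms(4) by blast
  then have "\<exists>f g. f holomorphic_on S \<and> g holomorphic_on ball 0 1 \<and>
      (\<forall>z\<in>S. f z \<in> ball 0 1 \<and> g (f z) = z) \<and> (\<forall>z\<in>ball 0 1. g z \<in> S \<and> f (g z) = z)"
    using Riemann_mapping_theorem [of S] assms(1-3) by blast
  then obtain f g where f: "f holomorphic_on S" "g holomorphic_on ball 0 1"
    "\<And>z. z \<in> S \<Longrightarrow> f z \<in> ball 0 1 \<and> g (f z) = z"
    "\<And>z. z \<in> ball 0 1 \<Longrightarrow> g z \<in> S \<and> f (g z) = z"
    by metis
  obtain p q where p: "p (f 0) = 0" "p holomorphic_on ball 0 1" "p ` ball 0 1 \<subseteq> ball 0 1"
    "q holomorphic_on ball 0 1" "q ` ball 0 1 \<subseteq> ball 0 1"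
    "\<And>z. z \<in> ball 0 1 \<Longrightarrow> p (q z) = z" "\<And>z. z \<in> ball 0 1 \<Longrightarrow> q (p z) = z"
    using ball_biholomorphism_exists [of "f 0"] f(3) [OF assms(4)] by metis
  have p': "p z \<in> ball 0 1" "q z \<in> ball 0 1" if "z \<in> ball 0 1" for z
    using p(3,5) that by blast+
  show ?thesis
  proof
    show "(p \<circ> f) holomorphic_on S"
      using f(1,3) p(2) by (intro holomorphic_on_compose holomorphic_on_subset [OF p(2)]) auto
    show "(g \<circ> q) holomorphic_on ball 0 1"
      using f(2) p(4) p' by (intro holomorphic_on_compose holomorphic_on_subset [OF f(2)]) blast+
    show "(g \<circ> q) 0 = 0"
      using p(1,7) f(3) [OF assms(4)] by (metis comp_apply)
  qed (use f p p' in auto)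
qed

text \<open>The product is the derivative of \<open>F ^^ n\<close> by the chain rule. As
  \<open>F ^^ n\<close> again grows by \<open>2 * pi\<close> over a period, the mean value theorem
  applies.\<close>

lemma mean_derivative_one:
  fixes F :: "real \<Rightarrow> real"
  assumes F: "\<And>t. (F has_real_derivative F' t) (at t)" "\<And>t. F (t + 2 * pi) = F t + 2 * pi"
  obtains t where "(\<Prod>k<n. F' ((F ^^ k) t)) = 1"
proof -
  have D: "((F ^^ n) has_real_derivative (\<Prod>k<n. F' ((F ^^ k) t))) (at t)" for n t
  proof (induction n)
    case (Suc n)
    have "((\<lambda>s. F ((F ^^ n) s)) has_real_derivative F' ((F ^^ n) t) * (\<Prod>k<n. F' ((F ^^ k) t))) (at t)"
      by (rule DERIV_chain2 [OF F(1) Suc])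
    then show ?case
      by (simp add: o_def mult.commute)
  qed (simp add: id_def)
  have P: "(F ^^ n) (t + 2 * pi) = (F ^^ n) t + 2 * pi" for t
    by (induction n) (simp_all add: F)
  obtain t where "(F ^^ n) (2 * pi) - (F ^^ n) 0 = (2 * pi - 0) * (\<Prod>k<n. F' ((F ^^ k) t))"
    using MVT2 [of 0 "2 * pi" "F ^^ n" "\<lambda>t. \<Prod>k<n. F' ((F ^^ k) t)"] D by auto
  then have "(\<Prod>k<n. F' ((F ^^ k) t)) = 1"
    using P [of 0] by simp
  then show ?thesis
    using that by blast
qed

subsection \<open>The Riemann sphere\<close>

lemma tendsto_continuous_on_UNIV:
  assumes "continuous_on UNIV f" "(x \<longlongrightarrow> l) F"
  shows "((\<lambda>n. f (x n)) \<longlongrightarrow> f l) F"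
proof (rule topological_tendstoI)
  fix S assume "open S" "f l \<in> S"
  then have "open (f -` S)" "l \<in> f -` S"
    using open_vimage [OF _ assms(1)] by auto
  from topological_tendstoD [OF assms(2) this] show "eventually (\<lambda>n. f (x n) \<in> S) F"
    by simp
qed

lemma open_Fin_image: "open S \<Longrightarrow> open (Fin ` S)"
  by (auto simp: open_riemann_sphere_def inj_vimage_image_eq inj_def)

lemma continuous_on_Fin: "continuous_on S Fin"
  by (rule continuous_on_subset [of UNIV])
    (auto simp: continuous_on_open_vimage open_riemann_sphere_def)

text \<open>A left inverse of \<open>Fin\<close>; the value at \<open>Infty\<close> is a
  dummy.\<close>

definition fin :: "riemann_sphere \<Rightarrow> complex" where
  "fin p = (case p of Fin z \<Rightarrow> z | Infty \<Rightarrow> 0)"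

lemma fin_Fin [simp]: "fin (Fin z) = z"
  by (simp add: fin_def)

lemma continuous_on_fin: "continuous_on (range Fin) fin"
proof -
  have "open (range Fin)"
    using open_Fin_image [OF open_UNIV] .
  moreover have "fin -` V \<inter> range Fin = Fin ` V" for V
    by auto
  ultimately show ?thesis
    using open_Fin_image by (simp add: continuous_on_open_vimage)
qed

text \<open>The complement contains \<open>Infty\<close>, so its openness asks for compactness of
  \<open>S\<close>.\<close>

lemma closed_Fin_image:
  assumes "compact S"
  shows "closed (Fin ` S)"
proof -
  have "Fin -` (- Fin ` S) = - S"
    by auto
  then show ?thesis
    using assms compact_imp_closed [OF assms] unfolding closed_def open_riemann_sphere_def by (simp add: closed_def)
qed

lemma closure_Fin_image:
  assumes "bounded S"
  shows "closure (Fin ` S) = Fin ` closure S"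
proof
  have "closed (Fin ` closure S)"
    using assms by (intro closed_Fin_image) simp
  then show "closure (Fin ` S) \<subseteq> Fin ` closure S"
    using closure_subset by (intro closure_minimal) auto
  show "Fin ` closure S \<subseteq> closure (Fin ` S)"
    using closure_subset [of "Fin ` S"] by (intro image_closure_subset continuous_on_Fin) auto
qed

lemma frontier_Fin_image:
  assumes "bounded S" "open S"
  shows "frontier (Fin ` S) = Fin ` frontier S"
  using assms open_Fin_image [OF assms(2)] closure_Fin_image [OF assms(1)]
  by (auto simp: frontier_def interior_open)

lemma simply_connected_Fin_image:
  assumes "simply_connected S"
  shows "simply_connected (Fin ` S)"
proof (rule homeomorphic_simply_connected [OF _ assms])
  have "homeomorphism S (Fin ` S) Fin fin"
    using continuous_on_Fin continuous_on_subset [OF continuous_on_fin, of "Fin ` S"]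
    by (auto simp: homeomorphism_def image_image)
  then show "S homeomorphic (Fin ` S)"
    by (auto simp: homeomorphic_def)
qed

section \<open>Basins and the inversion in the unit circle\<close>

lemma basin_forward: "q \<in> basin f p \<Longrightarrow> f q \<in> basin f p"
  unfolding basin_def mem_Collect_eq funpow_simps_right(2) [symmetric, THEN fun_cong, unfolded o_def]
  by (drule LIMSEQ_Suc) (simp add: funpow_swap1)

text \<open>The inversion in the unit circle. It commutes with \<open>Bmap\<close> and exchanges the
  two basins, which reduces every claim about infinity to one about \<open>0\<close>.\<close>

fun reflect :: "riemann_sphere \<Rightarrow> riemann_sphere" where
  "reflect (Fin z) = (if z = 0 then Infty else Fin (1 / cnj z))"
| "reflect Infty = Fin 0"

lemma reflect_reflect [simp]: "reflect (reflect p) = p"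
  by (cases p) auto

text \<open>A neighbourhood of infinity contains all points of modulus above some \<open>M\<close>,
  which come from a punctured disc about \<open>0\<close>. Conversely the preimage of a
  neighbourhood of \<open>0\<close> has bounded complement.\<close>

lemma continuous_on_reflect: "continuous_on S reflect"
proof -
  have "open (reflect -` S)" if S: "open S" for S
  proof -
    define V where "V = Fin -` S"
    define P where "P = (- {0}) \<inter> (\<lambda>z. 1 / cnj z) -` V"
    have oV: "open V"
      using S by (simp add: V_def open_riemann_sphere_def)
    have oP: "open P"
      unfolding P_def by (intro continuous_open_preimage continuous_intros oV) auto
    have eq: "Fin -` (reflect -` S) = P \<union> (if Infty \<in> S then {0} else {})"
      by (auto simp: P_def V_def split: if_splits)
    have o: "open (P \<union> (if Infty \<in> S then {0} else {}))"
    proof (cases "Infty \<in> S")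
      case True
      then have "bounded (- V)"
        using S by (simp add: V_def open_riemann_sphere_def compact_imp_bounded)
      then obtain M where M: "M > 0" "\<And>z. z \<notin> V \<Longrightarrow> cmod z \<le> M"
        unfolding bounded_pos by auto
      have near: "z \<in> P" if "z \<noteq> 0" "cmod z < 1 / M" for z
      proof -
        have "cmod (1 / cnj z) > M"
          using that M(1) by (simp add: norm_divide field_simps)
        then show ?thesis
          using M(2) [of "1 / cnj z"] that(1) by (auto simp: P_def)
      qed
      have "P \<union> {0} = P \<union> ball 0 (1 / M)"
      proof -
        have "z \<in> P \<union> {0} \<longleftrightarrow> z \<in> P \<union> ball 0 (1 / M)" for z
          using near [of z] M(1) by (cases "z = 0") auto
        then show ?thesis
          by blast
      qed
      then show ?thesis
        using True oP by (metis open_Un open_ball)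
    qed (use oP in simp)
    moreover have "compact (- (P \<union> (if Infty \<in> S then {0} else {})))" if "Fin 0 \<in> S"
    proof -
      have "0 \<in> V"
        using that by (simp add: V_def)
      then obtain e where e: "e > 0" "ball 0 e \<subseteq> V"
        using oV open_contains_ball by blast
      have "cmod z \<le> 1 / e" if "z \<notin> P" for z
      proof (rule ccontr)
        assume z: "\<not> cmod z \<le> 1 / e"
        then have "z \<noteq> 0"
          using e(1) by auto
        moreover from z have "1 / cnj z \<in> ball 0 e"
          using e(1) \<open>z \<noteq> 0\<close> by (simp add: norm_divide field_simps)
        ultimately show False
          using that e(2) by (auto simp: P_def)
      qed
      then have "bounded (- (P \<union> (if Infty \<in> S then {0} else {})))"
        unfolding bounded_iff by auto
      then show ?thesis
        using o by (simp add: compact_eq_bounded_closed closed_def)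
    qed
    ultimately show ?thesis
      unfolding open_riemann_sphere_def eq by simp
  qed
  then have "continuous_on UNIV reflect"
    by (simp add: continuous_on_open_vimage)
  then show ?thesis
    using continuous_on_subset by blast
qed

lemma reflect_image_iff: "p \<in> reflect ` X \<longleftrightarrow> reflect p \<in> X"
  by (metis image_iff reflect_reflect)

lemma closure_reflect: "closure (reflect ` X) = reflect ` closure X"
proof -
  have sub: "reflect ` closure X \<subseteq> closure (reflect ` X)" for X
    using closure_subset [of "reflect ` X"] by (intro image_closure_subset continuous_on_reflect) auto
  have "reflect ` reflect ` X = X" for X
    by (simp add: image_image)
  then have "closure (reflect ` X) \<subseteq> reflect ` closure X"
    using image_mono [OF sub [of "reflect ` X"], of reflect] by simp
  then show ?thesis
    using sub by blast
qed

lemma frontier_reflect: "frontier (reflect ` X) = reflect ` frontier X"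
proof -
  have Compl: "- reflect ` X = reflect ` (- X)"
    unfolding set_eq_iff Compl_iff reflect_image_iff by blast
  then show ?thesis
    unfolding frontier_def interior_closure Compl closure_reflect set_eq_iff Diff_iff Compl_iff reflect_image_iff
    by blast
qed

lemma immediate_basin_reflect_subset:
  assumes comm: "\<And>p. f (reflect p) = reflect (f p)"
  shows "reflect ` immediate_basin f p \<subseteq> immediate_basin f (reflect p)"
proof (cases "p \<in> basin f p")
  case True
  have iter: "(f ^^ n) (reflect q) = reflect ((f ^^ n) q)" for n q
    by (induction n) (simp_all add: comm)
  have "reflect q \<in> basin f (reflect p)" if "q \<in> basin f p" for q
    using that unfolding basin_def mem_Collect_eq iter
    by (rule tendsto_continuous_on_UNIV [OF continuous_on_reflect])
  moreover have "immediate_basin f p \<subseteq> basin f p" "connected (immediate_basin f p)" "p \<in> immediate_basin f p"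
    using True by (simp_all add: immediate_basin_def connected_component_subset)
  ultimately show ?thesis
    unfolding immediate_basin_def [of f "reflect p"]
    using connected_continuous_image [OF continuous_on_reflect]
    by (intro connected_component_maximal) auto
next
  case False
  \<comment> \<open>A general \<open>p\<close> need not lie in its own basin; the connected
    component of a point outside the set is empty by definition.\<close>
  then have "immediate_basin f p = {}"
    unfolding immediate_basin_def using connected_component_in by fastforce
  then show ?thesis
    by simp
qed

lemma immediate_basin_reflect:
  assumes comm: "\<And>p. f (reflect p) = reflect (f p)"
  shows "immediate_basin f (reflect p) = reflect ` immediate_basin f p"
proof
  show "immediate_basin f (reflect p) \<subseteq> reflect ` immediate_basin f p"
    using image_mono [OF immediate_basin_reflect_subset [where f = f and p = "reflect p", OF comm], of reflect]
    by (simp add: image_image)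
qed (rule immediate_basin_reflect_subset [where f = f, OF comm])

lemma simply_connected_reflect:
  assumes "simply_connected S"
  shows "simply_connected (reflect ` S)"
proof (rule homeomorphic_simply_connected [OF _ assms])
  have "homeomorphism S (reflect ` S) reflect reflect"
    using continuous_on_reflect by (auto simp: homeomorphism_def image_image)
  then show "S homeomorphic (reflect ` S)"
    by (auto simp: homeomorphic_def)
qed

subsection \<open>Exhaustion of the immediate basin\<close>

locale bmap =
  fixes d :: nat and a :: complex
  assumes d_ge_1: "d \<ge> 1" and norm_a: "cmod a > 1"
begin

definition pole :: complex where
  "pole = 1 / cnj a"

definition g :: "complex \<Rightarrow> complex" where
  "g z = z * ((z - a) / (1 - cnj a * z))"

text \<open>The finite branch of \<open>Bmap\<close> as a plain complex function; it represents
  \<open>Bmap\<close> only off the pole.\<close>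

definition B :: "complex \<Rightarrow> complex" where
  "B z = z ^ (d + 1) * ((z - a) / (1 - cnj a * z)) ^ d"

lemma a_nz: "a \<noteq> 0"
  using norm_a by auto

lemma d_pos: "d > 0"
  using d_ge_1 by simp

lemma B_eq_g: "B z = z * g z ^ d"
  unfolding B_def g_def power_mult_distrib by simp

lemma denom_eq_0_iff: "1 - cnj a * z = 0 \<longleftrightarrow> z = pole"
  using a_nz by (auto simp: pole_def field_simps)

lemma denom_nz: "z \<noteq> pole \<Longrightarrow> 1 - cnj a * z \<noteq> 0"
  using denom_eq_0_iff by blast

lemma norm_pole: "cmod pole = 1 / cmod a"
  by (simp add: pole_def norm_divide)

lemma norm_pole_less_1: "cmod pole < 1"
  using norm_a by (simp add: norm_pole divide_less_eq)

lemma pole_nz: "pole \<noteq> 0"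
  using a_nz by (simp add: pole_def)

lemma Bmap_Fin: "z \<noteq> pole \<Longrightarrow> Bmap d a (Fin z) = Fin (B z)"
  using denom_nz by (simp add: B_def)

lemma Bmap_pole: "Bmap d a (Fin pole) = Infty"
  using denom_eq_0_iff [of pole] by simp

lemma g_holomorphic: "g holomorphic_on - {pole}"
  unfolding g_def using denom_nz by (intro holomorphic_intros) auto

lemma B_holomorphic: "B holomorphic_on - {pole}"
  unfolding B_def using denom_nz by (intro holomorphic_intros) auto

lemma B_holomorphic_on: "pole \<notin> S \<Longrightarrow> B holomorphic_on S"
  by (rule holomorphic_on_subset [OF B_holomorphic]) auto

lemma B_continuous_on: "pole \<notin> S \<Longrightarrow> continuous_on S B"
  by (intro holomorphic_on_imp_continuous_on B_holomorphic_on)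

lemma isCont_B: "z \<noteq> pole \<Longrightarrow> isCont B z"
  using B_continuous_on [of "- {pole}"] by (simp add: continuous_on_eq_continuous_at open_Compl)

lemma isCont_g: "z \<noteq> pole \<Longrightarrow> isCont g z"
  using holomorphic_on_imp_continuous_on [OF g_holomorphic]
  by (simp add: continuous_on_eq_continuous_at open_Compl)

lemma B_0 [simp]: "B 0 = 0"
  by (simp add: B_def)

text \<open>On the circle \<open>z * cnj z = 1\<close>, so the denominator equals
  \<open>z * cnj (z - a)\<close>. This is why \<open>g\<close> and \<open>B\<close> preserve the
  circle.\<close>

lemma norm_denom_circle:
  assumes "cmod z = 1"
  shows "cmod (1 - cnj a * z) = cmod (z - a)"
proof -
  have "z * cnj z = 1"
    using assms by (simp add: complex_norm_square [symmetric])
  then have "1 - cnj a * z = z * cnj (z - a)"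
    by (simp add: algebra_simps)
  then show ?thesis
    using assms by (simp add: norm_mult del: complex_cnj_diff)
qed

lemma circle_not_a: "cmod z = 1 \<Longrightarrow> z \<noteq> a"
  using norm_a by auto

lemma circle_not_pole: "cmod z = 1 \<Longrightarrow> z \<noteq> pole"
  using norm_pole_less_1 by auto

lemma norm_g_circle:
  assumes "cmod z = 1"
  shows "cmod (g z) = 1"
  using norm_denom_circle [OF assms] circle_not_a [OF assms] assms
  by (simp add: g_def norm_mult norm_divide)

lemma norm_B_circle:
  assumes "cmod z = 1"
  shows "cmod (B z) = 1"
  using norm_g_circle [OF assms] assms by (simp add: B_eq_g norm_mult norm_power)

lemma B_eq_0_iff:
  assumes "cmod z < cmod a" "z \<noteq> pole"
  shows "B z = 0 \<longleftrightarrow> z = 0"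
  using assms denom_nz [OF assms(2)] by (auto simp: B_def)

text \<open>By the identity theorem \<open>B\<close> would be constant off the pole, but
  \<open>B 0 = 0\<close> while \<open>B 1\<close> has modulus one.\<close>

lemma B_not_constant:
  assumes "open X" "X \<subseteq> - {pole}" "X \<noteq> {}"
  shows "\<not> B constant_on X"
proof
  assume c: "B constant_on X"
  obtain x where x: "x \<in> X"
    using assms by blast
  have "B constant_on - {pole}"
  proof (rule analytic_continuation' [OF B_holomorphic])
    show "connected (- {pole})"
      by (rule connected_punctured_universe) simp
    show "x islimpt X"
      using x assms(1) interior_limit_point interior_open by metis
  qed (use assms x c in auto)
  then have "B 0 = B 1"
    using pole_nz circle_not_pole [of 1] unfolding constant_on_def by (metis ComplI norm_one singletonD)
  then show False
    using norm_B_circle [of 1] by simp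
qed

lemma B_open_image:
  assumes "open X" "X \<subseteq> - {pole}"
  shows "open (B ` X)"
  by (rule open_mapping_thm2 [OF B_holomorphic _ assms]) (use B_not_constant in auto)

text \<open>The identity covers \<open>z = a\<close> too, where both sides are \<open>0\<close> by
  the convention on division by zero.\<close>

lemma B_reflect:
  assumes "z \<noteq> 0" "z \<noteq> pole"
  shows "B (1 / cnj z) = 1 / cnj (B z)"
proof -
  have "(1 / cnj z - a) / (1 - cnj a * (1 / cnj z)) = (1 - a * cnj z) / (cnj z - cnj a)"
  proof -
    have "1 / cnj z - a = (1 - a * cnj z) / cnj z" "1 - cnj a * (1 / cnj z) = (cnj z - cnj a) / cnj z"
      using assms by (simp_all add: diff_divide_distrib)
    then show ?thesis
      using assms by simp
  qed
  then show ?thesis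
    by (simp add: B_def power_divide field_simps)
qed

lemma B_norm_le_iff:
  assumes "z \<noteq> pole"
  shows "cmod (B z) \<le> c \<longleftrightarrow> cmod z ^ (d + 1) * cmod (z - a) ^ d \<le> c * cmod (1 - cnj a * z) ^ d"
  using denom_nz [OF assms]
  by (simp add: B_def norm_mult norm_power norm_divide power_divide pos_divide_le_eq)

text \<open>A compact set off the pole that contains every \<open>U n\<close>; limits of sequences
  in \<open>A\<close> are extracted from it.\<close>

definition sublevel :: "complex set" where
  "sublevel = {z. cmod z \<le> 1 \<and> z \<noteq> pole \<and> cmod (B z) \<le> 1}"

lemma pole_not_a: "pole \<noteq> a"
  using norm_pole_less_1 norm_a by auto

text \<open>Once denominators are cleared, the inequality fails at the pole by itself, being
  positive against zero. Excluding the pole therefore does not spoil closedness.\<close>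

lemma compact_sublevel: "compact sublevel"
proof -
  have "sublevel = {z. cmod z ^ (d + 1) * cmod (z - a) ^ d \<le> cmod (1 - cnj a * z) ^ d} \<inter> cball 0 1"
    (is "_ = ?R")
  proof -
    have "\<not> cmod pole ^ (d + 1) * cmod (pole - a) ^ d \<le> cmod (1 - cnj a * pole) ^ d"
    proof -
      have "cmod (1 - cnj a * pole) ^ d = 0"
        using denom_eq_0_iff [of pole] d_pos by simp
      moreover have "cmod pole ^ (d + 1) * cmod (pole - a) ^ d > 0"
        using pole_nz pole_not_a by (intro mult_pos_pos zero_less_power) auto
      ultimately show ?thesis
        by linarith
    qed
    then have "cmod x ^ (d + 1) * cmod (x - a) ^ d \<le> cmod (1 - cnj a * x) ^ d
        \<longleftrightarrow> x \<noteq> pole \<and> cmod (B x) \<le> 1" for x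
      using B_norm_le_iff [of x 1] unfolding mult_1 by blast
    then show ?thesis
      unfolding sublevel_def set_eq_iff Int_iff mem_Collect_eq mem_cball_0 by blast
  qed
  moreover have "closed {z. cmod z ^ (d + 1) * cmod (z - a) ^ d \<le> cmod (1 - cnj a * z) ^ d}"
    by (intro closed_Collect_le continuous_intros)
  ultimately show ?thesis
    by (simp add: closed_Int_compact)
qed

lemma continuous_on_sublevel: "continuous_on sublevel B"
  by (rule B_continuous_on) (simp add: sublevel_def)

text \<open>\<open>g\<close> vanishes at \<open>0\<close>, so its modulus is below one half nearby,
  and taking the \<open>d\<close>-th power only decreases it.\<close>

lemma trap_radius_exists:
  "\<exists>r>0. r < cmod pole \<and> (\<forall>z. cmod z \<le> r \<longrightarrow> cmod (B z) \<le> cmod z / 2)"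
proof -
  have "isCont g 0"
    using isCont_g pole_nz by metis
  then obtain e where e: "e > 0" "\<And>z. cmod z < e \<Longrightarrow> cmod (g z) < 1 / 2"
    unfolding continuous_at_eps_delta by (metis (no_types, lifting) dist_0_norm dist_commute g_def half_gt_zero mult_zero_left zero_less_one)
  define r where "r = min (e / 2) (cmod pole / 2)"
  have "cmod (B z) \<le> cmod z / 2" if "cmod z \<le> r" for z
  proof -
    have "cmod (g z) < 1 / 2"
      using that e by (intro e) (auto simp: r_def)
    then have "cmod (g z) ^ d \<le> cmod (g z) ^ 1"
      using d_ge_1 by (intro power_decreasing) auto
    then have "cmod (g z) ^ d \<le> 1 / 2"
      using \<open>cmod (g z) < 1 / 2\<close> by simp
    then show ?thesis
      using mult_left_mono [of "cmod (g z) ^ d" "1/2" "cmod z"] by (simp add: B_eq_g norm_mult norm_power)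
  qed
  moreover have "r > 0" "r < cmod pole"
    using e pole_nz by (auto simp: r_def min_def)
  ultimately show ?thesis
    by blast
qed

definition r :: real where
  "r = (SOME r. r > 0 \<and> r < cmod pole \<and> (\<forall>z. cmod z \<le> r \<longrightarrow> cmod (B z) \<le> cmod z / 2))"

lemma r_pos: "r > 0" and r_less_pole: "r < cmod pole"
  and B_contracts: "cmod z \<le> r \<Longrightarrow> cmod (B z) \<le> cmod z / 2"
  using someI_ex [OF trap_radius_exists] unfolding r_def by blast+

lemma r_less_1: "r < 1"
  using r_less_pole norm_pole_less_1 by simp

text \<open>The pole is excluded explicitly because \<open>B pole = 0\<close> by the convention \<open>x / 0 = 0\<close>.\<close>

primrec U :: "nat \<Rightarrow> complex set" where
  "U 0 = ball 0 r"
| "U (Suc n) = {z \<in> ball 0 1 - {pole}. B z \<in> U n}"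

lemma U_subset_disc: "U n \<subseteq> ball 0 1 - {pole}"
  using r_less_1 r_less_pole by (cases n) auto

lemma U_subset_ball: "U n \<subseteq> ball 0 1"
  using U_subset_disc by blast

lemma zero_in_U: "0 \<in> U n"
  by (induction n) (use r_pos pole_nz in auto)

lemma U_Suc_subset_sublevel: "U (Suc n) \<subseteq> sublevel"
  using U_subset_ball [of n] by (force simp: sublevel_def)

lemma open_U: "open (U n)"
proof (induction n)
  case (Suc n)
  have "open ((ball 0 1 - {pole}) \<inter> B -` U n)"
    using B_continuous_on [of "ball 0 1 - {pole}"] Suc
    by (intro continuous_open_preimage) auto
  moreover have "(ball 0 1 - {pole}) \<inter> B -` U n = U (Suc n)"
    by auto
  ultimately show ?case
    by simp
qed auto

text \<open>In the inductive step the compact \<open>sublevel\<close> keeps limits off the pole.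
  Since \<open>B\<close> preserves the circle, a limit whose image lies in the open disc lies there
  itself.\<close>

lemma closure_U_subset: "closure (U n) \<subseteq> U (Suc n)"
proof (induction n)
  case 0
  show ?case
  proof
    fix z assume "z \<in> closure (U 0)"
    then have z: "cmod z \<le> r"
      using r_pos by simp
    then have "cmod (B z) < r"
      using B_contracts [OF z] r_pos by simp
    then show "z \<in> U (Suc 0)"
      using z r_less_pole r_less_1 by auto
  qed
next
  case (Suc n)
  show ?case
  proof
    fix z assume z: "z \<in> closure (U (Suc n))"
    have zs: "z \<in> sublevel" and sub: "closure (U (Suc n)) \<subseteq> sublevel"
      using z compact_imp_closed [OF compact_sublevel] closure_minimal U_Suc_subset_sublevel by blast+
    have "B ` closure (U (Suc n)) \<subseteq> closure (U n)"
    proof (rule image_closure_subset)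
      show "continuous_on (closure (U (Suc n))) B"
        using continuous_on_subset [OF continuous_on_sublevel sub] .
      show "B ` U (Suc n) \<subseteq> closure (U n)"
        using closure_subset by auto
    qed auto
    then have Bz: "B z \<in> U (Suc n)"
      using z Suc by blast
    then have "cmod (B z) < 1"
      using U_subset_ball by force
    then have "cmod z < 1"
      using zs norm_B_circle [of z] by (force simp: sublevel_def)
    then show "z \<in> U (Suc (Suc n))"
      using zs Bz by (simp add: sublevel_def)
  qed
qed

lemma U_subset_Suc: "U n \<subseteq> U (Suc n)"
  using closure_U_subset closure_subset by blast

lemma U_mono: "m \<le> n \<Longrightarrow> U m \<subseteq> U n"
  using lift_Suc_mono_le [of U, OF U_subset_Suc] by blast

text \<open>\<open>B\<close> maps \<open>U (Suc n)\<close> properly to \<open>U n\<close>, so each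
  part of a separation is mapped onto \<open>U n\<close> and contains a zero of \<open>B\<close>.
  The only zero available is \<open>0\<close>, which cannot lie in both parts.\<close>

lemma connected_U: "connected (U n)"
proof (induction n)
  case (Suc n)
  show ?case
  proof (rule ccontr)
    assume "\<not> connected (U (Suc n))"
    then obtain P' Q' where PQ': "open P'" "open Q'" "U (Suc n) \<subseteq> P' \<union> Q'"
      "P' \<inter> Q' \<inter> U (Suc n) = {}" "P' \<inter> U (Suc n) \<noteq> {}" "Q' \<inter> U (Suc n) \<noteq> {}"
      unfolding connected_def by blast
    define P Q where "P = P' \<inter> U (Suc n)" and "Q = Q' \<inter> U (Suc n)"
    have PQ: "open P" "open Q" "P \<noteq> {}" "Q \<noteq> {}" "P \<union> Q = U (Suc n)" "P \<inter> Q = {}"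
      unfolding P_def Q_def using PQ' open_U [of "Suc n"] by (blast intro: open_Int)+
    have aux: "0 \<in> V" if V: "open V" "open W" "V \<noteq> {}" "V \<union> W = U (Suc n)" "V \<inter> W = {}" for V W
    proof -
      have "V \<subseteq> - {pole}"
        using V(4) U_subset_disc [of "Suc n"] by blast
      then have "open (B ` V)"
        using V(1) B_open_image by blast
      moreover have "B ` V \<subseteq> U n"
        using V by auto
      \<comment> \<open>This is properness: preimages in \<open>V\<close> of a convergent sequence
        accumulate in \<open>sublevel\<close>. The limit point lies in \<open>U (Suc n)\<close> but
        not in the open set \<open>W\<close>, hence in \<open>V\<close>.\<close>
      moreover have "U n \<inter> closure (B ` V) \<subseteq> B ` V"
      proof
        fix w assume w: "w \<in> U n \<inter> closure (B ` V)"
        then have "w \<in> closure (B ` V)"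
          by simp
        then obtain x where x: "\<And>k. x k \<in> B ` V" "x \<longlonglongrightarrow> w"
          unfolding closure_sequential by metis
        have "\<exists>z. z \<in> V \<and> x k = B z" for k
          using x(1) [of k] by (auto elim: imageE)
        then obtain z where z: "\<And>k. z k \<in> V" "\<And>k. x k = B (z k)"
          by metis
        have Vs: "V \<subseteq> sublevel"
          using V(4) U_Suc_subset_sublevel by blast
        obtain l s where l: "l \<in> sublevel" "strict_mono (s :: nat \<Rightarrow> nat)" "(z \<circ> s) \<longlonglongrightarrow> l"
        proof (rule seq_compactE)
          show "seq_compact sublevel"
            using compact_sublevel compact_imp_seq_compact by blast
          show "\<forall>n. z n \<in> sublevel"
            using z(1) Vs by blast
        qed
        have "(\<lambda>k. B (z (s k))) \<longlonglongrightarrow> B l"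
          using isCont_tendsto_compose [OF isCont_B l(3)] l(1) by (simp add: sublevel_def o_def)
        moreover have "(\<lambda>k. B (z (s k))) \<longlonglongrightarrow> w"
          using LIMSEQ_subseq_LIMSEQ [OF x(2) l(2)] z(2) by (simp add: o_def)
        ultimately have Bl: "B l = w"
          using LIMSEQ_unique by blast
        then have "cmod (B l) < 1"
          using w U_subset_ball by force
        then have "cmod l < 1"
          using l norm_B_circle [of l] by (force simp: sublevel_def)
        then have "l \<in> U (Suc n)"
          using l Bl w by (simp add: sublevel_def)
        moreover have "l \<notin> W"
        proof
          assume "l \<in> W"
          then have "eventually (\<lambda>k. z (s k) \<in> W) sequentially"
            using topological_tendstoD [OF l(3) V(2)] by (simp add: o_def)
          then obtain k where "z (s k) \<in> W"
            using eventually_happens' sequentially_bot by blast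
          then show False
            using z(1) [of "s k"] V(5) by blast
        qed
        ultimately have "l \<in> V"
          using V(4) by blast
        then show "w \<in> B ` V"
          using Bl by blast
      qed
      ultimately have "openin (top_of_set (U n)) (B ` V)" "B ` V = U n \<inter> closure (B ` V)"
        using open_U closure_subset [of "B ` V"] openin_open_eq by blast+
      then have "closedin (top_of_set (U n)) (B ` V)" "openin (top_of_set (U n)) (B ` V)"
        using closedin_closed by blast+
      then have "B ` V = U n"
        using Suc V(3) unfolding connected_clopen by blast
      then obtain v where v: "v \<in> V" "B v = 0"
        using zero_in_U [of n] by (metis imageE)
      then have "cmod v < 1" "v \<noteq> pole"
        using V(4) U_subset_disc [of "Suc n"] mem_ball_0 by blast+
      then have "v = 0"
        using v(2) norm_a B_eq_0_iff [of v] by simp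
      then show ?thesis
        using v by simp
    qed
    show False
      using aux [of P Q] aux [of Q P] PQ by blast
  qed
qed auto

subsection \<open>Connectedness of the complement\<close>

text \<open>Everything is expressed through \<open>1 - z / a\<close>, which stays in the right
  half-plane for \<open>z\<close> on the circle and so has a continuous argument.\<close>

lemma B_circle:
  assumes "cmod z = 1"
  shows "B z = (a / cnj a) ^ d * z * ((1 - z / a) / cnj (1 - z / a)) ^ d"
proof -
  define v where "v = 1 - z / a"
  have zz: "z * cnj z = 1"
    using assms by (simp add: complex_norm_square [symmetric])
  then have z0: "z \<noteq> 0"
    by auto
  have "z \<noteq> a"
    using assms by (rule circle_not_a)
  then have v0: "v \<noteq> 0"
    using a_nz by (simp add: v_def)
  have 1: "z - a = - (a * v)"
    using a_nz by (simp add: v_def algebra_simps)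
  have 2: "1 - cnj a * z = - (cnj a * z * cnj v)"
    using a_nz zz by (simp add: v_def field_simps)
  have "(z - a) / (1 - cnj a * z) = (a / cnj a) * (v / cnj v) / z"
    unfolding 1 2 using a_nz z0 v0 by (simp add: field_simps)
  then show ?thesis
    unfolding B_def v_def [symmetric] using z0
    by (simp add: power_divide power_mult_distrib)
qed

text \<open>\<open>F\<close> adds up the arguments in \<open>B_circle\<close>. The logarithmic
  derivative of \<open>v\<close> has modulus \<open>1 / cmod (a - cis t)\<close>, which is below
  \<open>1 / (2 * d)\<close> for such \<open>a\<close>; hence \<open>F'\<close> is positive.\<close>

lemma circle_lift:
  assumes big: "cmod a > 2 * d + 1"
  obtains F F' where
    "\<And>t. (F has_real_derivative F' t) (at t)" "\<And>t. F' t > 0"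
    "\<And>t. B (cis t) = cis (F t)" "\<And>t. F (t + 2 * pi) = F t + 2 * pi"
    "\<And>t. cmod (deriv B (cis t)) = F' t"
proof -
  define v where "v = (\<lambda>t::real. 1 - cis t / a)"
  define F where "F = (\<lambda>t. 2 * d * Arg a + t + 2 * d * Im (Ln (v t)))"
  define F' where "F' = (\<lambda>t. 1 + 2 * d * Im (- (\<i> * cis t / a) / v t))"
  have small: "cmod (cis t / a) < 1" for t
    using norm_a by (simp add: norm_divide divide_less_eq)
  have Rev: "Re (v t) > 0" for t
    using small [of t] complex_Re_le_cmod [of "cis t / a"] by (simp add: v_def)
  then have v0: "v t \<noteq> 0" "v t \<notin> \<real>\<^sub>\<le>\<^sub>0" for t
  proof -
    show "v t \<noteq> 0" "v t \<notin> \<real>\<^sub>\<le>\<^sub>0"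
      using Rev [of t] by (auto simp: complex_nonpos_Reals_iff)
  qed
  have dF: "(F has_real_derivative F' t) (at t)" for t
  proof -
    have "((\<lambda>z. Ln (1 - exp (\<i> * z) / a)) has_field_derivative (- (\<i> * cis t / a) / v t)) (at (of_real t))"
      using v0 [of t] a_nz unfolding v_def cis_conv_exp
      by (auto intro!: derivative_eq_intros simp: field_simps)
    from has_vector_derivative_real_field [OF this]
    have "((\<lambda>s. Ln (v s)) has_vector_derivative (- (\<i> * cis t / a) / v t)) (at t)"
      by (simp add: v_def cis_conv_exp)
    then have "((\<lambda>s. Im (Ln (v s))) has_real_derivative Im (- (\<i> * cis t / a) / v t)) (at t)"
      unfolding has_real_derivative_iff_has_vector_derivative
      by (rule bounded_linear.has_vector_derivative [OF bounded_linear_Im])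
    from DERIV_add [OF DERIV_add [OF DERIV_const DERIV_ident] DERIV_cmult [OF this, of "2 * d"]]
    show ?thesis
      unfolding F_def F'_def by simp
  qed
  have F'_pos: "F' t > 0" for t
  proof -
    have "- (\<i> * cis t / a) / v t = - \<i> * cis t / (a - cis t)"
      using a_nz v0(1) [of t] by (simp add: v_def field_simps)
    then have "cmod (- (\<i> * cis t / a) / v t) = 1 / cmod (a - cis t)"
      by (simp add: norm_divide norm_mult)
    moreover have "cmod (a - cis t) \<ge> cmod a - 1"
      using norm_triangle_ineq2 [of a "cis t"] by simp
    then have "cmod (a - cis t) > 2 * d"
      using big by simp
    then have "2 * d * (1 / cmod (a - cis t)) < 1"
      using d_pos by (simp add: divide_less_eq)
    ultimately have "2 * d * cmod (- (\<i> * cis t / a) / v t) < 1"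
      by simp
    moreover have "\<bar>2 * d * Im (- (\<i> * cis t / a) / v t)\<bar> \<le> 2 * d * cmod (- (\<i> * cis t / a) / v t)"
      using abs_Im_le_cmod [of "- (\<i> * cis t / a) / v t"] by (simp add: abs_mult mult_left_mono del: minus_divide_left)
    ultimately show ?thesis
      unfolding F'_def by linarith
  qed
  have BF: "B (cis t) = cis (F t)" for t
  proof -
    have 1: "w / cnj w = cis (2 * Arg w)" if "w \<noteq> 0" for w
    proof -
      have "w = cmod w * cis (Arg w)" "cnj w = cmod w * cis (- Arg w)"
        using that by (metis Arg_eq cis_conv_exp, metis Arg_eq cis_conv_exp cis_cnj complex_cnj_complex_of_real complex_cnj_mult)
      then have "w / cnj w = cis (Arg w) / cis (- Arg w)"
        using that by (metis mult_divide_mult_cancel_left norm_eq_zero of_real_eq_0_iff)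
      then show ?thesis
        by (simp add: cis_divide)
    qed
    have "B (cis t) = (a / cnj a) ^ d * cis t * (v t / cnj (v t)) ^ d"
      using B_circle [of "cis t"] by (simp add: v_def)
    also have "\<dots> = cis (d * (2 * Arg a)) * cis t * cis (d * (2 * Arg (v t)))"
      unfolding 1 [OF a_nz] 1 [OF v0(1)] Complex.DeMoivre by simp
    also have "\<dots> = cis (F t)"
      unfolding F_def using Arg_eq_Im_Ln [OF v0(1) [of t]] by (simp add: cis_mult algebra_simps)
    finally show ?thesis .
  qed
  \<comment> \<open>\<open>v\<close> is periodic, so only the summand \<open>t\<close>
    grows.\<close>
  have "F (t + 2 * pi) = F t + 2 * pi" for t
    by (simp add: F_def v_def cis_mult [symmetric])
  moreover have "cmod (deriv B (cis t)) = F' t" for t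
  proof -
    have "cis t \<noteq> pole"
      by (rule circle_not_pole) simp
    then have dB: "(B has_field_derivative deriv B (exp (\<i> * of_real t))) (at (exp (\<i> * of_real t)))"
      using holomorphic_derivI [OF B_holomorphic, of "cis t"] by (simp add: open_Compl cis_conv_exp)
    have "((\<lambda>z. B (exp (\<i> * z))) has_field_derivative deriv B (cis t) * (cis t * \<i>)) (at (of_real t))"
      unfolding cis_conv_exp
      by (rule DERIV_chain2 [where f = B and g = "\<lambda>z. exp (\<i> * z)", OF dB]) (auto intro!: derivative_eq_intros)
    from has_vector_derivative_real_field [OF this]
    have "((\<lambda>s. B (cis s)) has_vector_derivative deriv B (cis t) * (cis t * \<i>)) (at t)"
      by (simp add: cis_conv_exp)
    moreover have "((\<lambda>s. cis (F s)) has_vector_derivative F' t *\<^sub>R (\<i> * cis (F t))) (at t)"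
    proof -
      have "((\<lambda>z. exp (\<i> * z)) has_field_derivative \<i> * exp (\<i> * of_real (F t))) (at (of_real (F t)))"
        by (auto intro!: derivative_eq_intros)
      from has_vector_derivative_real_field [OF this]
      have "(cis has_vector_derivative (\<i> * cis (F t))) (at (F t))"
        by (simp add: cis_conv_exp [abs_def])
      then show ?thesis
        using vector_diff_chain_at [of F "F' t" t cis "\<i> * cis (F t)"] dF [of t]
        by (simp add: has_real_derivative_iff_has_vector_derivative o_def)
    qed
    ultimately have "deriv B (cis t) * (cis t * \<i>) = F' t *\<^sub>R (\<i> * cis (F t))"
      unfolding BF by (rule vector_derivative_unique_at)
    then have "cmod (deriv B (cis t)) = \<bar>F' t\<bar>"
      by (metis norm_mult norm_cis norm_ii mult.right_neutral mult_1 norm_scaleR real_norm_def)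
    then show ?thesis
      using F'_pos [of t] by simp
  qed
  ultimately show ?thesis
    using that dF F'_pos BF by blast
qed

text \<open>The lift is strictly increasing and gains only \<open>2 * pi\<close> over a full period,
  so no value is taken twice on the circle.\<close>

lemma circle_inj:
  assumes big: "cmod a > 2 * d + 1" and z: "cmod z = 1" "B z = B 1"
  shows "z = 1"
proof -
  obtain F F' where F: "\<And>t. (F has_real_derivative F' t) (at t)" "\<And>t. F' t > 0"
    "\<And>t. B (cis t) = cis (F t)" "\<And>t. F (t + 2 * pi) = F t + 2 * pi"
    using circle_lift [OF big] by metis
  have mono: "F s < F t" if "s < t" for s t
    using that F(1,2) by (metis DERIV_pos_imp_increasing)
  obtain t where t: "0 \<le> t" "t < 2 * pi" "z = cis t"
    using z(1) Arg2pi_eq [of z] Arg2pi_ge_0 [of z] Arg2pi_lt_2pi [of z] by (auto simp: cis_conv_exp)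
  have "cis (F t - F 0) = 1"
    using z(2) F(3) [of t] F(3) [of 0] t(3) by (simp add: cis_divide [symmetric])
  moreover have "F t < F 0 + 2 * pi" "F 0 \<le> F t"
    using mono [of t "2 * pi"] mono [of 0 t] t F(4) [of 0] by (auto simp: le_less)
  moreover from calculation obtain n :: int where n: "F t - F 0 = n * 2 * pi"
    using cos_one_2pi_int [of "F t - F 0"] by (auto simp: complex_eq_iff)
  moreover have "n = 0"
  proof -
    have "F t - F 0 = real_of_int n * (2 * pi)"
      using n by simp
    then have "real_of_int n * (2 * pi) < 1 * (2 * pi)" "(- 1) * (2 * pi) < real_of_int n * (2 * pi)"
      using \<open>F t < F 0 + 2 * pi\<close> \<open>F 0 \<le> F t\<close> pi_gt_zero by linarith+
    then have "real_of_int n < 1" "- 1 < real_of_int n"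
      using mult_less_cancel_right_pos [of "2 * pi"] pi_gt_zero by (metis mult_pos_pos zero_less_numeral)+
    then show ?thesis
      by linarith
  qed
  ultimately have "F t - F 0 = 0"
    by simp
  then have "\<not> 0 < t"
    using mono [of 0 t] by auto
  then show ?thesis
    using t by simp
qed

section \<open>Possible separations of the complement of \<open>U n\<close>\<close>

lemma compl_ball_connected: "connected (- ball (0::complex) 1)"
  using connected_complement_bounded_convex [of "ball (0::complex) 1"] by simp

lemma closed_Compl_U: "closed (- U n)"
  using open_U by (simp add: closed_def)

lemma not_in_U: "1 \<le> cmod z \<Longrightarrow> z \<notin> U n"
  using U_subset_ball [of n] by force

lemma reflect_not_in_U: "z \<noteq> 0 \<Longrightarrow> cmod z \<le> 1 \<Longrightarrow> 1 / cnj z \<notin> U n"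
  by (rule not_in_U) (simp add: norm_divide divide_simps)

text \<open>If \<open>L\<close> missed the pole, it would be compact and
  \<open>clopen_image_eq\<close> would make its image all of \<open>- U n\<close>, which is
  unbounded.\<close>

lemma bounded_component_contains_pole:
  assumes conn: "connected (- U n)"
    and M: "closed M" "- ball 0 1 \<subseteq> M" and L: "closed L" "L \<noteq> {}"
    and part: "M \<union> L = - U (Suc n)" "M \<inter> L = {}"
  shows "pole \<in> L"
proof (rule ccontr)
  assume p: "pole \<notin> L"
  have Lb: "L \<subseteq> ball 0 1"
    using M(2) part(2) by auto
  define N where "N = ball 0 1 - {pole} - M"
  have LN: "L = N \<inter> B -` (- U n)"
  proof (intro set_eqI iffI)
    fix z assume z: "z \<in> L"
    then have "z \<notin> U (Suc n)" "z \<notin> M"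
      using part by auto
    moreover have "z \<in> ball 0 1 - {pole}"
      using z p Lb by auto
    ultimately show "z \<in> N \<inter> B -` (- U n)"
      by (auto simp: N_def)
  next
    fix z assume z: "z \<in> N \<inter> B -` (- U n)"
    then have "z \<notin> U (Suc n)" "z \<notin> M"
      by (auto simp: N_def)
    then show "z \<in> L"
      using part by auto
  qed
  have "compact L"
    using L(1) bounded_subset [OF bounded_ball Lb] compact_eq_bounded_closed by blast
  moreover have "open (B ` N)"
    unfolding N_def using M(1) by (intro B_open_image open_Diff) auto
  ultimately have "B ` L = - U n"
    using clopen_image_eq [OF B_continuous_on [OF p], of N "- U n"] LN L(2) conn by simp
  moreover have "compact (B ` L)"
    using compact_continuous_image [OF B_continuous_on [OF p]] \<open>compact L\<close> .
  ultimately have "bounded (- U n)"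
    using compact_imp_bounded [of "B ` L"] by simp
  moreover have "bounded (U n)"
    by (rule bounded_subset [OF bounded_ball U_subset_ball])
  ultimately have "bounded (U n \<union> - U n)"
    by (simp only: bounded_Un)
  then show False
    using not_bounded_UNIV [where 'a = complex] by (simp only: Compl_partition)
qed

text \<open>For \<open>A = cmod a\<close> the quotient of the right side by the left is the modulus
  of \<open>B\<close> at \<open>x * sgn a\<close>. Its logarithm \<open>\<phi>\<close> vanishes at
  \<open>1\<close> and is nonincreasing before.\<close>

lemma segment_ineq:
  fixes A :: real
  assumes A: "1 < A" "A \<le> 2 * d + 1" and x: "1 / A < x" "x \<le> 1"
  shows "(A * x - 1) ^ d \<le> x ^ (d + 1) * (A - x) ^ d"
proof -
  define \<phi> where "\<phi> = (\<lambda>x. (d + 1) * ln x + d * ln (A - x) - d * ln (A * x - 1))"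
  define \<phi>' where "\<phi>' = (\<lambda>x. (d + 1) / x - d / (A - x) - d * A / (A * x - 1))"
  have pos: "y > 0" "A * y - 1 > 0" "A - y > 0" if "x \<le> y" "y \<le> 1" for y
  proof -
    have "1 / A < y"
      using that x by simp
    moreover have "1 / A > 0"
      using A by simp
    ultimately show "y > 0"
      by linarith
    show "A * y - 1 > 0" "A - y > 0"
      using A that \<open>1 / A < y\<close> by (simp_all add: divide_less_eq mult.commute)
  qed
  have "\<phi> 1 \<le> \<phi> x"
  proof (rule DERIV_nonpos_imp_nonincreasing [OF x(2)])
    fix y assume y: "x \<le> y" "y \<le> 1"
    note p = pos [OF y]
    have "(\<phi> has_real_derivative \<phi>' y) (at y)"
      unfolding \<phi>_def \<phi>'_def using p
      by (auto intro!: derivative_eq_intros)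
    moreover have "\<phi>' y \<le> 0"
    proof -
      have "\<phi>' y = - (A * (d + 1) * (y\<^sup>2 + 1) - (2 * d + 1 + A\<^sup>2) * y) / (y * (A - y) * (A * y - 1))"
      proof -
        define s t where "s = A - y" and "t = A * y - 1"
        have "\<phi>' y = ((d + 1) * s * t - d * y * t - d * A * y * s) / (y * s * t)"
          using p unfolding \<phi>'_def s_def [symmetric] t_def [symmetric] by (simp add: field_simps)
        also have "(d + 1) * s * t - d * y * t - d * A * y * s
            = - (A * (d + 1) * (y\<^sup>2 + 1) - (2 * d + 1 + A\<^sup>2) * y)"
          by (simp add: s_def t_def power2_eq_square algebra_simps)
        finally show ?thesis
          by (simp only: s_def t_def)
      qed
      moreover have "A * (d + 1) * (y\<^sup>2 + 1) - (2 * d + 1 + A\<^sup>2) * y \<ge> 0"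
      proof -
        have "(A - 1) * (2 * d + 1 - A) * y \<ge> 0"
          using A p by (intro mult_nonneg_nonneg) auto
        moreover have "A * (d + 1) * (y - 1)\<^sup>2 \<ge> 0"
          using A by simp
        \<comment> \<open>Both summands are nonnegative; for the second this is where
          \<open>A \<le> 2 * d + 1\<close> enters.\<close>
        moreover have "A * (d + 1) * (y\<^sup>2 + 1) - (2 * d + 1 + A\<^sup>2) * y
            = A * (d + 1) * (y - 1)\<^sup>2 + (A - 1) * (2 * d + 1 - A) * y"
          by (simp add: power2_eq_square algebra_simps)
        ultimately show ?thesis
          by linarith
      qed
      ultimately show ?thesis
        using p by (simp add: divide_nonpos_pos)
    qed
    ultimately show "\<exists>D. (\<phi> has_real_derivative D) (at y) \<and> D \<le> 0"
      by blast
  qed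
  then have "ln ((A * x - 1) ^ d) \<le> ln (x ^ (d + 1) * (A - x) ^ d)"
    using pos [of x] x by (simp add: \<phi>_def ln_mult ln_realpow del: power_Suc)
  then show ?thesis
    using pos [of x] x by (subst (asm) ln_le_cancel_iff) auto
qed

text \<open>The pole is \<open>sgn a\<close> divided by \<open>cmod a\<close>, so the segment is
  radial and consists of points \<open>x * sgn a\<close>. There \<open>segment_ineq\<close> makes
  the modulus of \<open>B\<close> at least one, except at the pole, which is excluded from
  \<open>U (Suc n)\<close> by definition.\<close>

lemma segment_avoids_U:
  assumes "cmod a \<le> 2 * d + 1"
  shows "closed_segment pole (sgn a) \<inter> U (Suc n) = {}"
proof -
  have "z \<notin> U (Suc n)" if z: "z \<in> closed_segment pole (sgn a)" for z
  proof (cases "z = pole")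
    case False
    obtain u where u: "0 \<le> u" "u \<le> 1" "z = (1 - u) *\<^sub>R pole + u *\<^sub>R sgn a"
      using z by (auto simp: in_segment)
    define A where "A = cmod a"
    define x where "x = (1 - u) / A + u"
    have A: "A > 1"
      using norm_a by (simp add: A_def)
    have asgn: "a = A * sgn a"
      using a_nz by (simp add: A_def sgn_div_norm scaleR_conv_of_real field_simps)
    have sgn1: "sgn a * cnj (sgn a) = 1"
      using a_nz by (simp add: complex_norm_square [symmetric] norm_sgn)
    have "pole = sgn a / A"
    proof -
      have "pole = 1 / (A * cnj (sgn a))"
        unfolding pole_def by (subst asgn) simp
      also have "\<dots> = sgn a / A"
        using sgn1 A a_nz by (simp add: divide_simps)
      finally show ?thesis .
    qed
    then have zx: "z = x * sgn a"
      using u by (simp add: x_def scaleR_conv_of_real algebra_simps)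
    have "u \<noteq> 0"
      using False u by auto
    have "x - 1 / A = u * (1 - 1 / A)"
      by (simp add: x_def algebra_simps diff_divide_distrib)
    then have x1: "x > 1 / A"
      using \<open>u \<noteq> 0\<close> u A by (smt (verit) divide_less_eq_1 mult_pos_pos)
    have "1 - x = (1 - u) * (1 - 1 / A)"
      by (simp add: x_def algebra_simps diff_divide_distrib)
    then have x2: "x \<le> 1"
      using u A by (smt (verit) divide_less_eq_1 mult_nonneg_nonneg)
    have x0: "x > 0"
      using x1 A by (meson less_trans zero_less_divide_1_iff zero_less_one)
    have "1 - cnj a * z = of_real (1 - A * x)"
    proof -
      have "cnj a * z = (A * x) * (sgn a * cnj (sgn a))"
        unfolding zx by (subst asgn) (simp add: mult_ac)
      then show ?thesis
        using sgn1 by simp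
    qed
    then have n1: "cmod (1 - cnj a * z) = A * x - 1"
      using x1 A by (simp only: norm_of_real) (simp add: field_simps)
    have "z - a = of_real (x - A) * sgn a"
      unfolding zx by (subst (2) asgn) (simp add: algebra_simps)
    then have n2: "cmod (z - a) = A - x"
      using x2 A a_nz by (simp only: norm_mult norm_of_real) (simp add: norm_sgn)
    have n3: "cmod z = x"
      unfolding zx using x0 a_nz by (simp add: norm_mult norm_sgn)
    have "(A * x - 1) ^ d \<le> x ^ (d + 1) * (A - x) ^ d"
      using segment_ineq [OF A _ x1 x2] assms A_def by blast
    moreover have "(A * x - 1) ^ d > 0"
      using x1 A by (simp add: field_simps)
    ultimately have "cmod (B z) \<ge> 1"
      by (simp add: B_def norm_mult norm_divide norm_power power_divide n1 n2 n3 del: power_Suc)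
    then show ?thesis
      using not_in_U by auto
  qed simp
  then show ?thesis
    by blast
qed

text \<open>The set \<open>O'\<close> of disc points off \<open>L\<close> that leave the closed disc
  lies in \<open>M\<close>, so its closure misses the pole. On its frontier \<open>B\<close> has
  modulus at most one, so the maximum principle shows that it is empty. Openness of \<open>B\<close>
  then excludes modulus one.\<close>

lemma B_maps_outer_component_into_disc:
  assumes M: "closed M" "- ball 0 1 \<subseteq> M" and L: "closed L" "pole \<in> L"
    and part: "M \<union> L = - U (Suc n)" "M \<inter> L = {}"
    and z: "z \<in> M" "cmod z < 1"
  shows "cmod (B z) < 1"
proof -
  define O' where "O' = (ball 0 1 - L) \<inter> B -` (- cball 0 1)"
  have memO: "x \<in> O' \<longleftrightarrow> cmod x < 1 \<and> x \<notin> L \<and> cmod (B x) > 1" for x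
    by (auto simp: O'_def)
  have "open O'"
    unfolding O'_def using L
    by (intro continuous_open_preimage B_continuous_on) auto
  have "O' \<subseteq> M"
  proof
    fix x assume x: "x \<in> O'"
    then have "x \<notin> U (Suc n)"
      using not_in_U [of "B x" n] by (auto simp: memO)
    then show "x \<in> M"
      using x part(1) memO by blast
  qed
  then have clM: "closure O' \<subseteq> M"
    using M(1) by (rule closure_minimal)
  have clb: "closure O' \<subseteq> cball 0 1"
    by (rule closure_minimal) (auto simp: memO)
  have pole: "pole \<notin> closure O'"
    using clM L(2) part(2) by blast
  have le: "cmod (B x) \<le> 1" if "x \<in> O'" for x
  proof (rule maximum_modulus_frontier [of B O'])
    show "B holomorphic_on interior O'" "continuous_on (closure O') B"
      using pole interior_subset closure_subset by (intro B_holomorphic_on B_continuous_on; blast)+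
    show "bounded O'"
      by (rule bounded_subset [OF bounded_cball subset_trans [OF closure_subset clb]])
    show "cmod (B y) \<le> 1" if y: "y \<in> frontier O'" for y
    proof -
      have ycl: "y \<in> closure O'" "y \<notin> O'"
        using y \<open>open O'\<close> by (auto simp: frontier_def interior_open)
      then have yM: "y \<in> M" "cmod y \<le> 1"
        using clM clb by auto
      then have "y \<notin> L"
        using part(2) by blast
      then show ?thesis
        using ycl(2) yM norm_B_circle [of y] memO [of y] by force
    qed
  qed (use that in auto)
  then have empty: "O' = {}"
    using memO by force
  have zL: "z \<notin> L"
    using z part(2) by blast
  then have "\<not> cmod (B z) > 1"
    using empty memO z by blast
  moreover have "cmod (B z) \<noteq> 1"
  proof
    assume B1: "cmod (B z) = 1"
    have "open (B ` (ball 0 1 - L))"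
      using L by (intro B_open_image) auto
    moreover have "B z \<in> B ` (ball 0 1 - L)"
      using z zL by simp
    ultimately obtain e where e: "e > 0" "ball (B z) e \<subseteq> B ` (ball 0 1 - L)"
      unfolding open_contains_ball by metis
    define w where "w = (1 + e / 2) *\<^sub>R B z"
    have w1: "cmod w > 1"
      using B1 e by (simp add: w_def)
    have "w - B z = (e / 2) *\<^sub>R B z"
      by (simp add: w_def algebra_simps)
    then have "w \<in> ball (B z) e"
      using B1 e by (simp add: dist_norm norm_minus_commute [of "B z"])
    then obtain x where "x \<in> ball 0 1 - L" "w = B x"
      using e by blast
    then show False
      using w1 empty memO by auto
  qed
  ultimately show ?thesis
    by simp
qed

text \<open>A ring symmetric in the unit circle, between \<open>U n\<close> and its mirror
  image.\<close>

definition W :: "nat \<Rightarrow> complex set" where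
  "W n = {w. w \<notin> U n \<and> 1 / cnj w \<notin> U n}"

lemma zero_not_in_W: "0 \<notin> W n"
  using zero_in_U by (simp add: W_def)

lemma W_reflect: "1 / cnj w \<in> W n \<longleftrightarrow> w \<in> W n"
  by (auto simp: W_def)

lemma W_disc: "cmod w \<le> 1 \<Longrightarrow> w \<in> W n \<longleftrightarrow> w \<notin> U n"
  using zero_in_U [of n] reflect_not_in_U [of w n] by (cases "w = 0") (simp_all add: W_def)

lemma reflect_image: "(\<lambda>z. 1 / cnj z) ` S = {z. 1 / cnj z \<in> S}"
  by (auto simp: image_iff) (metis complex_cnj_cnj complex_cnj_divide complex_cnj_one divide_divide_eq_right mult_1 div_by_1)

lemma W_bounded: "bounded (W n)"
proof -
  have "cmod w \<le> 1 / r" if "w \<in> W n" for w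
  proof -
    have "1 / cnj w \<notin> ball 0 r"
      using that U_mono [of 0 n] by (auto simp: W_def)
    then show ?thesis
      using that zero_not_in_W r_pos by (cases "w = 0") (auto simp: norm_divide field_simps)
  qed
  then show ?thesis
    unfolding bounded_iff by blast
qed

text \<open>The radial retraction onto the closed disc maps \<open>- U n\<close> onto this set:
  outer points land on the circle, which \<open>U n\<close> avoids.\<close>

lemma connected_Compl_U_Int_cball:
  assumes "connected (- U n)"
  shows "connected (- U n \<inter> cball 0 1)"
proof -
  define K where "K = - U n \<inter> cball 0 1"
  have "(\<lambda>z. z /\<^sub>R max 1 (cmod z)) ` (- U n) = K"
  proof (intro subset_antisym subsetI)
    fix w assume "w \<in> (\<lambda>z. z /\<^sub>R max 1 (cmod z)) ` (- U n)"
    then obtain z where z: "z \<notin> U n" "w = z /\<^sub>R max 1 (cmod z)"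
      by auto
    show "w \<in> K"
    proof (cases "cmod z \<le> 1")
      case True
      then show ?thesis
        using z by (simp add: K_def max_def)
    next
      case False
      then have "cmod z \<noteq> 0"
        by auto
      then have "cmod w = 1"
        using z(2) False by (simp add: max_def)
      then show ?thesis
        using not_in_U by (simp add: K_def)
    qed
  next
    fix w assume w: "w \<in> K"
    then show "w \<in> (\<lambda>z. z /\<^sub>R max 1 (cmod z)) ` (- U n)"
      by (intro image_eqI [of _ _ w]) (auto simp: K_def max_def)
  qed
  moreover have "continuous_on (- U n) (\<lambda>z. z /\<^sub>R max 1 (cmod z))"
    by (intro continuous_intros) auto
  ultimately show ?thesis
    unfolding K_def [symmetric] using connected_continuous_image assms by metis
qed

text \<open>The part in the closed disc and its mirror image are both connected and share the point
  \<open>1\<close>.\<close>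

lemma W_connected:
  assumes "connected (- U n)"
  shows "connected (W n)"
proof -
  define K where "K = - U n \<inter> cball 0 1"
  have K: "connected K"
    unfolding K_def using assms by (rule connected_Compl_U_Int_cball)
  have "continuous_on K (\<lambda>z. 1 / cnj z)"
    using zero_in_U [of n] by (intro continuous_intros) (auto simp: K_def)
  then have "connected ((\<lambda>z. 1 / cnj z) ` K)"
    using K connected_continuous_image by blast
  moreover have "1 \<in> K" "1 \<in> (\<lambda>z. 1 / cnj z) ` K"
    using not_in_U [of 1 n] by (auto simp: K_def intro!: image_eqI [of _ _ 1])
  ultimately have "connected (K \<union> (\<lambda>z. 1 / cnj z) ` K)"
    using K connected_Un by blast
  also have "K \<union> (\<lambda>z. 1 / cnj z) ` K = W n"
  proof -
    have "1 / cnj z \<in> K \<longleftrightarrow> z \<in> W n" if "cmod z > 1" for z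
    proof -
      have "cmod (1 / cnj z) \<le> 1"
        using that by (simp add: norm_divide divide_le_eq)
      then show ?thesis
        using W_disc W_reflect [of z n] by (auto simp: K_def)
    qed
    moreover have "z \<in> K \<longleftrightarrow> z \<in> W n" if "cmod z \<le> 1" for z
      using that W_disc [OF that] by (simp add: K_def)
    moreover have "z \<notin> K" if "cmod z > 1" for z
      using that by (simp add: K_def)
    moreover have "1 / cnj z \<in> K \<Longrightarrow> z \<in> W n" if "cmod z \<le> 1" for z
      using that W_disc [of "1 / cnj z" n] W_reflect [of z n] by (simp add: K_def)
    ultimately show ?thesis
      unfolding reflect_image set_eq_iff Un_iff mem_Collect_eq by (meson not_le)
  qed
  finally show ?thesis .
qed

text \<open>
  If the outer component of the complement of \<open>U (n + 1)\<close> does not contain the pole, then \<open>B\<close>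
  maps its double \<open>K\<close> bijectively onto the strictly larger ring \<open>W n\<close>. The inverse contracts
  \<open>W n\<close> strictly, which is impossible for a map of the unit circle onto itself.
\<close>

lemma no_separation:
  assumes big: "cmod a > 2 * d + 1" and conn: "connected (- U n)"
    and M: "closed M" "- ball 0 1 \<subseteq> M" and L: "closed L" "pole \<in> L"
    and part: "M \<union> L = - U (Suc n)" "M \<inter> L = {}"
  shows False
proof -
  \<comment> \<open>\<open>E\<close> is the outer part inside the closed disc and \<open>K\<close>
    its double across the circle. \<open>N\<close> is an open set around \<open>K\<close> that
    misses the pole, because the pole lies in \<open>L\<close>.\<close>
  define E where "E = M \<inter> cball 0 1"
  define K where "K = E \<union> (\<lambda>z. 1 / cnj z) ` E"
  define N where "N = {z. z \<noteq> 0 \<and> z \<notin> L \<and> 1 / cnj z \<notin> L}"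
  have Lb: "L \<subseteq> ball 0 1"
    using M(2) part(2) by auto
  have L1: "cmod z < 1" if "z \<in> L" for z
    using that Lb by auto
  have cM: "z \<in> M" if "cmod z \<ge> 1" for z
    using that M(2) by auto
  have notML: "z \<notin> L" if "z \<in> M" for z
    using that part(2) by blast
  have M0: "z \<noteq> 0" if "z \<in> M" for z
    using that part(1) zero_in_U [of "Suc n"] by blast
  have KI: "z \<in> K \<longleftrightarrow> z \<in> E \<or> 1 / cnj z \<in> E" for z
    unfolding K_def reflect_image by simp
  have EN: "z \<in> N" if "z \<in> E" for z
  proof -
    have "cmod (1 / cnj z) \<ge> 1"
      using that M0 [of z] by (simp add: E_def norm_divide divide_simps)
    then show ?thesis
      using that M0 notML L1 [of "1 / cnj z"] by (auto simp: N_def E_def)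
  qed
  have NI: "1 / cnj z \<in> N \<longleftrightarrow> z \<in> N" for z
    by (auto simp: N_def)
  have poleN: "pole \<notin> N" and aN: "a \<notin> N"
    using L(2) by (auto simp: N_def pole_def)
  have Bdisc: "cmod (B z) < 1" if "z \<in> M" "cmod z < 1" for z
    using B_maps_outer_component_into_disc [OF M L part that] .
  have EW: "z \<in> E \<longleftrightarrow> z \<in> N \<and> B z \<in> W n" if z1: "cmod z \<le> 1" for z
  proof
    assume z: "z \<in> E"
    have "cmod (B z) \<le> 1"
      using Bdisc [of z] norm_B_circle [of z] z by (force simp: E_def)
    moreover have "B z \<notin> U n"
    proof (cases "cmod z = 1")
      case True
      then show ?thesis
        using norm_B_circle not_in_U by simp
    next
      case False
      have "z \<noteq> pole" "z \<notin> U (Suc n)" "cmod z < 1"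
        using z z1 False part(1) notML L(2) unfolding E_def by (blast, blast, simp)
      then show ?thesis
        by simp
    qed
    ultimately show "z \<in> N \<and> B z \<in> W n"
      using EN [OF z] W_disc by blast
  next
    assume z: "z \<in> N \<and> B z \<in> W n"
    then have "z \<notin> U (Suc n)"
      by (auto simp: W_def)
    then have "z \<in> M"
      using z part(1) by (auto simp: N_def)
    then show "z \<in> E"
      using z1 by (simp add: E_def)
  qed
  have KN: "K = N \<inter> B -` W n"
  proof (intro set_eqI)
    fix z
    show "z \<in> K \<longleftrightarrow> z \<in> N \<inter> B -` W n"
    proof (cases "cmod z \<le> 1")
      case True
      have "z \<in> E" if "1 / cnj z \<in> E"
      proof -
        have "z \<noteq> 0"
          using that M0 by (force simp: E_def)
        moreover have "cmod (1 / cnj z) \<le> 1"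
          using that by (simp add: E_def)
        ultimately have "cmod z = 1"
          using True by (simp add: norm_divide divide_le_eq)
        then show ?thesis
          using cM by (simp add: E_def)
      qed
      then show ?thesis
        using KI EW [OF True] by auto
    next
      case False
      then have "cmod (1 / cnj z) \<le> 1" "z \<noteq> 0" "z \<noteq> pole"
        using norm_pole_less_1 by (auto simp: norm_divide divide_le_eq)
      then have "1 / cnj z \<in> E \<longleftrightarrow> z \<in> N \<and> B z \<in> W n"
        using EW [of "1 / cnj z"] NI [of z] B_reflect [of z] W_reflect [of "B z" n] by simp
      moreover have "z \<notin> E"
        using False by (simp add: E_def)
      ultimately show ?thesis
        using KI by auto
    qed
  qed
  have oN: "open N"
  proof -
    have "open ((- {0} \<inter> - L) \<inter> (\<lambda>z. 1 / cnj z) -` (- L))"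
      using L by (intro continuous_open_preimage continuous_intros) auto
    also have "(- {0} \<inter> - L) \<inter> (\<lambda>z. 1 / cnj z) -` (- L) = N"
      by (auto simp: N_def)
    finally show ?thesis .
  qed
  have cK: "compact K"
  proof -
    have "compact E"
      unfolding E_def using M(1) by (intro closed_Int_compact) auto
    moreover from this have "compact ((\<lambda>z. 1 / cnj z) ` E)"
      using M0 by (intro compact_continuous_image continuous_intros) (auto simp: E_def)
    ultimately show ?thesis
      unfolding K_def by (rule compact_Un)
  qed
  have KsubN: "K \<subseteq> N"
    using KN by blast
  have hol: "B holomorphic_on N"
    using poleN by (rule B_holomorphic_on)
  have nonconst: "\<not> B constant_on X" if "open X" "X \<subseteq> N" "X \<noteq> {}" for X
    using that poleN by (intro B_not_constant) auto
  obtain F F' where F: "\<And>t. (F has_real_derivative F' t) (at t)" "\<And>t. F' t > 0"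
    "\<And>t. B (cis t) = cis (F t)" "\<And>t. F (t + 2 * pi) = F t + 2 * pi"
    "\<And>t. cmod (deriv B (cis t)) = F' t"
    using circle_lift [OF big] by metis
  have circK: "z \<in> K" if "cmod z = 1" for z
    using that cM by (simp add: KI E_def)
  \<comment> \<open>The value \<open>B 1\<close> has a single preimage in \<open>K\<close>: points
    of \<open>K\<close> off the circle are mapped off the circle, and on it
    \<open>circle_inj\<close> applies.\<close>
  have inj: "inj_on B K"
  proof (rule unique_preimage_imp_inj_on [OF hol oN nonconst cK KN W_connected [OF conn]])
    show "1 \<in> K"
      by (rule circK) simp
    show "deriv B 1 \<noteq> 0"
      using F(5) [of 0] F(2) [of 0] by auto
    fix x assume x: "x \<in> K" "B x = B 1"
    then have B1: "cmod (B x) = 1"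
      using norm_B_circle [of 1] by simp
    have "cmod x = 1"
    proof (cases "x \<in> E")
      case True
      then show ?thesis
        using Bdisc [of x] B1 by (force simp: E_def)
    next
      case False
      then have xE: "1 / cnj x \<in> E"
        using x KI by blast
      then have x0: "x \<noteq> 0"
        using M0 by (force simp: E_def)
      have "x \<noteq> pole"
        using x(1) KsubN poleN by blast
      then have "cmod (B (1 / cnj x)) = 1"
        using B_reflect [OF x0] B1 by (simp add: norm_divide)
      then have "cmod (1 / cnj x) = 1"
        using Bdisc [of "1 / cnj x"] xE by (force simp: E_def)
      then show ?thesis
        by (simp add: norm_divide)
    qed
    then show "x = 1"
      using circle_inj [OF big _ x(2)] by blast
  qed auto
  have surj: "B ` K = W n"
  proof (rule clopen_image_eq [OF _ _ cK _ KN W_connected [OF conn]])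
    show "continuous_on K B"
      using poleN KsubN by (intro B_continuous_on) auto
    show "open (B ` N)"
      using oN poleN by (intro B_open_image) auto
    show "K \<noteq> {}"
      using circK [of 1] by auto
  qed
  define Wi where "Wi = interior (W n)"
  \<comment> \<open>\<open>K\<close> avoids even the closure of \<open>U n\<close>, which lies in
    \<open>U (Suc n)\<close>. This is the room needed for strict contraction.\<close>
  have KWi: "K \<subseteq> Wi"
  proof -
    define P where "P = {w. w \<noteq> 0 \<and> w \<notin> closure (U n) \<and> 1 / cnj w \<notin> closure (U n)}"
    have "open ((- {0} \<inter> - closure (U n)) \<inter> (\<lambda>z. 1 / cnj z) -` (- closure (U n)))"
      by (intro continuous_open_preimage continuous_intros) auto
    also have "(- {0} \<inter> - closure (U n)) \<inter> (\<lambda>z. 1 / cnj z) -` (- closure (U n)) = P"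
      by (auto simp: P_def)
    finally have "open P" .
    moreover have "P \<subseteq> W n"
      using closure_subset [of "U n"] by (auto simp: P_def W_def)
    ultimately have "P \<subseteq> Wi"
      unfolding Wi_def by (rule interior_maximal [rotated])
    moreover have "z \<in> P" if z: "z \<in> E" for z
    proof -
      have "z \<notin> U (Suc n)" "1 / cnj z \<notin> U (Suc n)"
        using z part(1) reflect_not_in_U [of z] M0 [of z] by (auto simp: E_def simp del: U.simps)
      then show ?thesis
        using z M0 closure_U_subset [of n] by (auto simp: P_def E_def simp del: U.simps)
    qed
    moreover have "1 / cnj z \<in> P \<longleftrightarrow> z \<in> P" for z
      by (auto simp: P_def)
    ultimately show ?thesis
      using KI by blast
  qed
  define Ni where "Ni = N \<inter> B -` Wi"
  have oNi: "open Ni"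
    unfolding Ni_def Wi_def using oN B_continuous_on [OF poleN] by (intro continuous_open_preimage) auto
  have NiK: "Ni \<subseteq> K"
    unfolding Ni_def KN Wi_def using interior_subset by blast
  have BNi: "B ` Ni = Wi"
  proof
    show "Wi \<subseteq> B ` Ni"
    proof
      fix w assume w: "w \<in> Wi"
      then have "w \<in> B ` K"
        using surj interior_subset unfolding Wi_def by blast
      then show "w \<in> B ` Ni"
        using w KsubN by (auto simp: Ni_def)
    qed
  qed (auto simp: Ni_def)
  obtain \<phi> where \<phi>: "\<phi> holomorphic_on Wi" "\<And>z. z \<in> Ni \<Longrightarrow> deriv B z * deriv \<phi> (B z) = 1"
    "\<And>z. z \<in> Ni \<Longrightarrow> \<phi> (B z) = z"
    using holomorphic_has_inverse [OF holomorphic_on_subset [OF hol] oNi inj_on_subset [OF inj NiK]]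
      BNi Ni_def by (metis Int_lower1)
  have im: "\<phi> ` Wi \<subseteq> K"
    using BNi \<phi>(3) NiK by force
  have circNi: "cis t \<in> Ni" for t
  proof -
    have "cis t \<in> K" "B (cis t) \<in> K"
      using circK F(3) by auto
    then show ?thesis
      unfolding Ni_def using KsubN KWi by blast
  qed
  have "open Wi" "bounded Wi"
    unfolding Wi_def using W_bounded bounded_subset interior_subset by blast+
  then obtain C q where q: "q > 1"
    and C: "\<And>x n. x 0 \<in> K \<Longrightarrow> (\<And>k. x (Suc k) = \<phi> (x k)) \<Longrightarrow> (\<Prod>k<n. cmod (deriv \<phi> (x k))) * q ^ n \<le> C"
    using inverse_iterates_contract [OF \<phi>(1) _ _ cK KWi im] by metis
  have qC: "q ^ m \<le> C" for m
  proof -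
    obtain t where t: "(\<Prod>k<m. F' ((F ^^ k) t)) = 1"
      using mean_derivative_one [OF F(1,4)] by blast
    \<comment> \<open>The inverse orbit \<open>x\<close> retraces the orbit of \<open>cis t\<close>
      backwards from its \<open>m\<close>-th point. The derivatives of \<open>\<phi>\<close> along
      it multiply, in modulus, to the reciprocal of the derivative of \<open>F ^^ m\<close> at
      \<open>t\<close>, which is one.\<close>
    define x where "x = (\<lambda>k. (\<phi> ^^ k) (cis ((F ^^ m) t)))"
    have xk: "x k = cis ((F ^^ (m - k)) t)" if "k \<le> m" for k
      using that
    proof (induction k)
      case (Suc k)
      then have "m - k = Suc (m - Suc k)"
        by simp
      then have "x k = B (cis ((F ^^ (m - Suc k)) t))"
        using Suc F(3) by simp
      then show ?case
        using \<phi>(3) [OF circNi] by (simp add: x_def)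
    qed (simp add: x_def)
    have "(\<Prod>k<m. cmod (deriv \<phi> (x k))) * q ^ m \<le> C"
      by (rule C) (auto simp: x_def intro: circK)
    moreover have "(\<Prod>k<m. cmod (deriv \<phi> (x k))) = (\<Prod>k<m. inverse (F' ((F ^^ (m - Suc k)) t)))"
    proof (rule prod.cong [OF refl])
      fix k assume "k \<in> {..<m}"
      then have "x k = B (cis ((F ^^ (m - Suc k)) t))"
        using xk [of k] F(3) by (simp add: Suc_diff_Suc [symmetric])
      then have "deriv B (cis ((F ^^ (m - Suc k)) t)) * deriv \<phi> (x k) = 1"
        using \<phi>(2) [OF circNi] by metis
      then have "F' ((F ^^ (m - Suc k)) t) * cmod (deriv \<phi> (x k)) = 1"
        using F(5) by (metis norm_mult norm_one)
      then show "cmod (deriv \<phi> (x k)) = inverse (F' ((F ^^ (m - Suc k)) t))"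
        by (metis inverse_unique)
    qed
    also have "(\<Prod>k<m. inverse (F' ((F ^^ (m - Suc k)) t))) = (\<Prod>k<m. inverse (F' ((F ^^ k) t)))"
      by (rule prod.nat_diff_reindex)
    also have "\<dots> = 1"
      using t by (simp add: inverse_eq_divide prod_dividef)
    ultimately show ?thesis
      by simp
  qed
  obtain m where "C < q ^ m"
    using real_arch_pow [OF q] by blast
  then show False
    using qC [of m] by simp
qed

lemma connected_Compl_U: "connected (- U n)"
proof (induction n)
  case 0
  show ?case
    using connected_complement_bounded_convex [of "ball (0::complex) r"] by simp
next
  case (Suc n)
  have aux: False if M: "closed M" "- ball 0 1 \<subseteq> M" and L: "closed L" "L \<noteq> {}"
    and part: "M \<union> L = - U (Suc n)" "M \<inter> L = {}" for M L
  proof -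
    have p: "pole \<in> L"
      by (rule bounded_component_contains_pole [OF Suc M L part])
    show False
    proof (cases "cmod a \<le> 2 * d + 1")
      case True
      define S where "S = closed_segment pole (sgn a)"
      have "S \<subseteq> M \<union> L"
        using segment_avoids_U [OF True, of n] part(1) unfolding S_def by blast
      moreover have "connected S"
        by (simp add: S_def)
      moreover have "pole \<in> S" "sgn a \<in> S"
        by (simp_all add: S_def)
      moreover have "sgn a \<in> M"
        using M(2) a_nz by (auto simp: norm_sgn)
      ultimately show False
        using connected_closedD [of S M L] M(1) L(1) p part(2) by blast
    next
      case False
      then show False
        using no_separation [OF _ Suc M L(1) p part] by simp
    qed
  qed
  show ?case
  proof (rule ccontr)
    assume "\<not> connected (- U (Suc n))"
    then obtain P Q where PQ: "closed P" "closed Q" "P \<noteq> {}" "Q \<noteq> {}" "P \<union> Q = - U (Suc n)" "P \<inter> Q = {}"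
      using connected_closed_set [OF closed_Compl_U] by metis
    \<comment> \<open>The exterior of the disc is connected, so it lies in one of the two parts;
      that part plays the role of \<open>M\<close>.\<close>
    have "- ball 0 1 \<subseteq> P \<union> Q"
      using U_subset_ball [of "Suc n"] PQ(5) by blast
    then have "- ball 0 1 \<subseteq> P \<or> - ball 0 1 \<subseteq> Q"
      using connected_closedD [OF compl_ball_connected, of P Q] PQ(1,2,6) by blast
    then show False
      using aux [of P Q] aux [of Q P] PQ by (metis Int_commute Un_commute)
  qed
qed

subsection \<open>The Boettcher coordinate\<close>

definition A :: "complex set" where
  "A = (\<Union>n. U n)"

lemma open_A: "open A"
  unfolding A_def using open_U by blast

lemma zero_in_A: "0 \<in> A"
  unfolding A_def using zero_in_U by blast

lemma A_subset: "A \<subseteq> ball 0 1 - {pole}"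
  unfolding A_def using U_subset_disc by blast

lemma A_norm_less_1: "z \<in> A \<Longrightarrow> cmod z < 1"
  using A_subset by auto

lemma A_not_pole: "z \<in> A \<Longrightarrow> z \<noteq> pole"
  using A_subset by auto

lemma connected_A: "connected A"
proof -
  have "0 \<in> \<Inter> (range U)"
    using zero_in_U by blast
  then show ?thesis
    unfolding A_def using connected_U by (intro connected_Union) auto
qed

lemma B_in_A_iff:
  assumes "cmod z < 1" "z \<noteq> pole"
  shows "B z \<in> A \<longleftrightarrow> z \<in> A"
proof
  assume "B z \<in> A"
  then obtain n where "B z \<in> U n"
    by (auto simp: A_def)
  then have "z \<in> U (Suc n)"
    using assms by simp
  then show "z \<in> A"
    unfolding A_def by blast
next
  assume "z \<in> A"
  then obtain n where "z \<in> U n"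
    by (auto simp: A_def)
  then have "z \<in> U (Suc n)"
    using U_subset_Suc by blast
  then show "B z \<in> A"
    unfolding A_def by auto
qed

lemma B_in_A: "z \<in> A \<Longrightarrow> B z \<in> A"
  using B_in_A_iff A_norm_less_1 A_not_pole by blast

lemma A_subset_sublevel: "A \<subseteq> sublevel"
  unfolding A_def using U_subset_Suc U_Suc_subset_sublevel by blast

lemma closure_A_subset_sublevel: "closure A \<subseteq> sublevel"
  by (rule closure_minimal [OF A_subset_sublevel compact_imp_closed [OF compact_sublevel]])

lemma sublevel_B_in_A:
  assumes "z \<in> sublevel" "B z \<in> A"
  shows "z \<in> A"
proof -
  have "cmod z \<noteq> 1"
    using A_norm_less_1 [OF assms(2)] norm_B_circle by force
  then show ?thesis
    using assms B_in_A_iff [of z] by (auto simp: sublevel_def)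
qed

text \<open>Inside the closed disc the complement is a decreasing intersection of compact connected
  sets; at \<open>1\<close> it meets the connected exterior.\<close>

lemma connected_Compl_A: "connected (- A)"
proof -
  define S where "S = (\<lambda>n. - U n \<inter> cball 0 1)"
  have "connected (\<Inter> (range S))"
  proof (rule connected_nest)
    show "compact (S n)" for n
      unfolding S_def using closed_Compl_U by (intro closed_Int_compact) auto
    show "connected (S n)" for n
      unfolding S_def by (rule connected_Compl_U_Int_cball [OF connected_Compl_U])
    show "S n \<subseteq> S m" if "m \<le> n" for m n
      using U_mono [OF that] by (auto simp: S_def)
  qed
  moreover have "1 \<in> \<Inter> (range S)"
    using not_in_U [of 1] by (auto simp: S_def)
  moreover have "1 \<in> - ball (0::complex) 1"
    by simp
  ultimately have "connected (\<Inter> (range S) \<union> - ball 0 1)"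
    using compl_ball_connected connected_Un by blast
  also have "\<Inter> (range S) \<union> - ball 0 1 = - A"
    using U_subset_ball by (force simp: S_def A_def)
  finally show ?thesis .
qed

lemma simply_connected_A: "simply_connected A"
  using simply_connected_iff_simple [OF open_A] connected_A connected_Compl_A
    bounded_subset [OF bounded_ball] A_subset by blast

lemma A_compact_subset_inverse_bound:
  assumes R: "R holomorphic_on A" "\<And>z. z \<in> A \<Longrightarrow> R z \<in> ball 0 1"
    and K: "compact K" "K \<subseteq> A"
  obtains \<rho> where "\<rho> < 1" "\<And>z. z \<in> K \<Longrightarrow> cmod (R z) \<le> \<rho>"
proof (cases "K = {}")
  case True
  then show ?thesis
    using that [of 0] by auto
next
  case False
  have "continuous_on K (\<lambda>z. cmod (R z))"
    using holomorphic_on_imp_continuous_on [OF holomorphic_on_subset [OF R(1) K(2)]]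
    by (intro continuous_intros)
  then obtain x where "x \<in> K" "\<And>y. y \<in> K \<Longrightarrow> cmod (R y) \<le> cmod (R x)"
    using continuous_attains_sup [OF K(1) False] by metis
  then show ?thesis
    using that [of "cmod (R x)"] R(2) [of x] K(2) by auto
qed

text \<open>The Riemann map turns \<open>B\<close> into a proper self-map of the disc whose only
  zero is \<open>0\<close>, of order \<open>d + 1\<close>. By
  \<open>proper_disc_map_eq_monomial\<close> this is a unimodular multiple of the power map, and a
  rotation removes the factor.\<close>

lemma Boettcher:
  obtains \<Psi> R where "\<Psi> holomorphic_on ball 0 1" "R holomorphic_on A" "\<Psi> 0 = 0"
    "\<And>z. z \<in> A \<Longrightarrow> R z \<in> ball 0 1" "\<And>z. z \<in> A \<Longrightarrow> \<Psi> (R z) = z"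
    "\<And>w. w \<in> ball 0 1 \<Longrightarrow> \<Psi> w \<in> A" "\<And>w. w \<in> ball 0 1 \<Longrightarrow> R (\<Psi> w) = w"
    "\<And>w. w \<in> ball 0 1 \<Longrightarrow> B (\<Psi> w) = \<Psi> (w ^ (d + 1))"
proof -
  have "A \<noteq> UNIV"
    using A_subset by auto
  then obtain R \<Psi> where R: "R holomorphic_on A" "\<Psi> holomorphic_on ball 0 1"
    "\<And>z. z \<in> A \<Longrightarrow> R z \<in> ball 0 1" "\<And>z. z \<in> A \<Longrightarrow> \<Psi> (R z) = z"
    "\<And>w. w \<in> ball 0 1 \<Longrightarrow> \<Psi> w \<in> A" "\<And>w. w \<in> ball 0 1 \<Longrightarrow> R (\<Psi> w) = w" "\<Psi> 0 = 0"
    using Riemann_map_centred [OF open_A simply_connected_A _ zero_in_A] by metis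
  have R0: "R 0 = 0"
    using R(6) [of 0] R(7) by simp
  have inj: "inj_on \<Psi> (ball 0 1)" "inj_on R A"
    using R(4,6) by (metis inj_onI)+
  obtain E where E: "E holomorphic_on ball 0 1" "\<And>w. w \<in> ball 0 1 \<Longrightarrow> \<Psi> w = w * E w"
    "\<And>w. w \<in> ball 0 1 \<Longrightarrow> E w \<noteq> 0"
    using holomorphic_divide_out_zero [OF R(2) open_ball _ R(7) inj(1)] by auto
  obtain S where S: "S holomorphic_on A" "\<And>z. z \<in> A \<Longrightarrow> R z = z * S z" "\<And>z. z \<in> A \<Longrightarrow> S z \<noteq> 0"
    using holomorphic_divide_out_zero [OF R(1) open_A zero_in_A R0 inj(2)] by metis
  \<comment> \<open>With \<open>\<Psi> w = w * E w\<close> and \<open>R z = z * S z\<close>, this is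
    what remains of \<open>R (B (\<Psi> w))\<close> after splitting off
    \<open>w ^ (d + 1)\<close>.\<close>
  define k where "k = (\<lambda>w. E w ^ (d + 1) * ((\<Psi> w - a) / (1 - cnj a * \<Psi> w)) ^ d * S (B (\<Psi> w)))"
  have \<Psi>A: "\<Psi> w \<noteq> pole" "cmod (\<Psi> w) < 1" "B (\<Psi> w) \<in> A" if "w \<in> ball 0 1" for w
    using R(5) [OF that] A_not_pole A_norm_less_1 B_in_A by auto
  have conj: "R (B (\<Psi> w)) = w ^ (d + 1) * k w" if w: "w \<in> ball 0 1" for w
  proof -
    have "B (\<Psi> w) = w ^ (d + 1) * (E w ^ (d + 1) * ((\<Psi> w - a) / (1 - cnj a * \<Psi> w)) ^ d)"
      unfolding B_def by (subst (1) E(2) [OF w]) (simp only: power_mult_distrib mult.assoc)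
    then show ?thesis
      unfolding S(2) [OF \<Psi>A(3) [OF w]] k_def by (simp only: mult.assoc)
  qed
  have "(\<lambda>w. B (\<Psi> w)) holomorphic_on ball 0 1"
  proof -
    have "B \<circ> \<Psi> holomorphic_on ball 0 1"
      by (rule holomorphic_on_compose_gen [OF R(2) B_holomorphic]) (use \<Psi>A(1) in \<open>metis (no_types, lifting) ComplI image_subsetI singletonD\<close>)
    then show ?thesis
      by (simp add: o_def)
  qed
  then have "S \<circ> (\<lambda>w. B (\<Psi> w)) holomorphic_on ball 0 1"
    by (rule holomorphic_on_compose_gen [OF _ S(1)]) (use \<Psi>A(3) in auto)
  then have "(\<lambda>w. S (B (\<Psi> w))) holomorphic_on ball 0 1"
    by (simp add: o_def)
  then have hk: "k holomorphic_on ball 0 1"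
    unfolding k_def using E(1) R(2) \<Psi>A(1) denom_nz by (intro holomorphic_intros) auto
  have k0: "k w \<noteq> 0" if "w \<in> ball 0 1" for w
  proof -
    have "\<Psi> w \<noteq> a"
      using \<Psi>A(2) [OF that] norm_a by auto
    then show ?thesis
      using E(3) [OF that] S(3) \<Psi>A [OF that] denom_nz by (simp add: k_def)
  qed
  have proper: "\<exists>\<rho><1. \<forall>w\<in>ball 0 1. \<rho> < cmod w \<longrightarrow> s < cmod (w ^ (d + 1) * k w)" if s: "s < 1" for s
  proof -
    \<comment> \<open>Points \<open>w\<close> with image of modulus at most \<open>s\<close> satisfy
      \<open>\<Psi> w \<in> K2\<close>, a compact subset of \<open>A\<close>, on which the modulus
      of \<open>R\<close> is bounded below \<open>1\<close>.\<close>
    define K1 where "K1 = \<Psi> ` cball 0 s"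
    define K2 where "K2 = {z \<in> sublevel. B z \<in> K1}"
    have sb: "cball 0 s \<subseteq> ball (0::complex) 1"
      using s by auto
    have "compact K1"
      unfolding K1_def
      by (intro compact_continuous_image holomorphic_on_imp_continuous_on holomorphic_on_subset [OF R(2) sb]) auto
    moreover have "K1 \<subseteq> A"
      using R(5) sb by (auto simp: K1_def)
    ultimately have "K2 \<subseteq> A" "compact K2"
      using sublevel_B_in_A continuous_closed_preimage [OF continuous_on_sublevel compact_imp_closed [OF compact_sublevel], of K1]
        compact_sublevel closed_Int_compact [of "sublevel \<inter> B -` K1" sublevel] compact_imp_closed [of K1]
      by (auto simp: K2_def vimage_def Collect_conj_eq inf.commute)
    then obtain \<rho> where \<rho>: "\<rho> < 1" "\<And>z. z \<in> K2 \<Longrightarrow> cmod (R z) \<le> \<rho>"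
      using A_compact_subset_inverse_bound [OF R(1,3)] by metis
    have "s < cmod (w ^ (d + 1) * k w)" if w: "w \<in> ball 0 1" "\<rho> < cmod w" for w
    proof (rule ccontr)
      assume "\<not> ?thesis"
      then have "R (B (\<Psi> w)) \<in> cball 0 s"
        using conj [OF w(1)] by simp
      then have "\<Psi> (R (B (\<Psi> w))) \<in> K1"
        unfolding K1_def by (rule imageI)
      then have "\<Psi> w \<in> K2"
        using R(4) \<Psi>A(3) [OF w(1)] R(5) [OF w(1)] A_subset_sublevel by (auto simp: K2_def)
      then show False
        using R(6) [OF w(1)] \<rho>(2) w(2) by force
    qed
    then show ?thesis
      using \<rho>(1) by blast
  qed
  have "cmod (w ^ (d + 1) * k w) < 1" if "w \<in> ball 0 1" for w
    using conj [OF that] R(3) [OF \<Psi>A(3) [OF that]] by simp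
  then obtain \<kappa> where \<kappa>: "cmod \<kappa> = 1" "\<And>w. w \<in> ball 0 1 \<Longrightarrow> k w = \<kappa>"
    using proper_disc_map_eq_monomial [OF hk k0 _ proper] by blast
  have "\<kappa> \<noteq> 0"
    using \<kappa>(1) by auto
  then have "card {z. z ^ d = 1 / \<kappa>} = d"
    using d_pos by (intro card_nth_roots) auto
  then have "{z. z ^ d = 1 / \<kappa>} \<noteq> {}"
    using d_pos by (metis card.empty less_irrefl)
  \<comment> \<open>With this choice
    \<open>(\<tau> * w) ^ (d + 1) * \<kappa> = \<tau> * w ^ (d + 1)\<close>, so
    \<open>\<tau> * w\<close> is the normalised coordinate.\<close>
  then obtain \<tau> where \<tau>: "\<tau> ^ d = 1 / \<kappa>"
    by blast
  then have "cmod \<tau> ^ d = 1"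
    using \<kappa>(1) by (simp add: norm_power [symmetric] norm_divide)
  then have n\<tau>: "cmod \<tau> = 1"
    using d_pos power_eq_1_iff [of "cmod \<tau>" d] by simp
  then have \<tau>0: "\<tau> \<noteq> 0"
    by auto
  have \<tau>b: "\<tau> * w \<in> ball 0 1 \<longleftrightarrow> w \<in> ball 0 1" "w / \<tau> \<in> ball 0 1 \<longleftrightarrow> w \<in> ball 0 1" for w
    using n\<tau> by (simp_all add: norm_mult norm_divide)
  show ?thesis
  proof
    show "(\<lambda>w. \<Psi> (\<tau> * w)) holomorphic_on ball 0 1"
    proof -
      have "\<Psi> \<circ> (\<lambda>w. \<tau> * w) holomorphic_on ball 0 1"
        by (rule holomorphic_on_compose_gen [OF _ R(2)])
          (use \<tau>b(1) in \<open>auto intro!: holomorphic_intros simp del: mem_ball_0\<close>)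
      then show ?thesis
        by (simp add: o_def)
    qed
    show "(\<lambda>z. R z / \<tau>) holomorphic_on A"
      using R(1) \<tau>0 by (intro holomorphic_intros) auto
    show "B (\<Psi> (\<tau> * w)) = \<Psi> (\<tau> * w ^ (d + 1))" if w: "w \<in> ball 0 1" for w
    proof -
      have "R (B (\<Psi> (\<tau> * w))) = (\<tau> * w) ^ (d + 1) * \<kappa>"
        using conj \<kappa>(2) \<tau>b(1) w by simp
      also have "\<dots> = \<tau> * w ^ (d + 1)"
        using \<tau> \<open>\<kappa> \<noteq> 0\<close> by (simp add: power_mult_distrib)
      finally show ?thesis
        using R(4) \<Psi>A(3) \<tau>b(1) w by metis
    qed
  qed (use R \<tau>b \<tau>0 in auto)
qed

text \<open>In the Boettcher coordinate \<open>B\<close> is the map \<open>w ^ (d + 1)\<close>,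
  whose derivative vanishes only at \<open>0\<close>.\<close>

lemma critical_point_in_A:
  assumes "c \<in> A" "deriv B c = 0"
  shows "c = 0"
proof -
  obtain \<Psi> R where R: "\<Psi> holomorphic_on ball 0 1" "R holomorphic_on A" "\<Psi> 0 = 0"
    "\<And>z. z \<in> A \<Longrightarrow> R z \<in> ball 0 1" "\<And>z. z \<in> A \<Longrightarrow> \<Psi> (R z) = z"
    "\<And>w. w \<in> ball 0 1 \<Longrightarrow> \<Psi> w \<in> A" "\<And>w. w \<in> ball 0 1 \<Longrightarrow> R (\<Psi> w) = w"
    "\<And>w. w \<in> ball 0 1 \<Longrightarrow> B (\<Psi> w) = \<Psi> (w ^ (d + 1))"
    by (rule Boettcher, rule that) blast+
  define w where "w = R c"
  have w: "w \<in> ball 0 1" "\<Psi> w = c"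
    using R(4,5) assms(1) by (auto simp: w_def)
  have d1: "(\<Psi> has_field_derivative deriv \<Psi> w) (at w)"
    using holomorphic_derivI [OF R(1) open_ball w(1)] .
  have d2: "(B has_field_derivative 0) (at (\<Psi> w))"
    using holomorphic_derivI [OF B_holomorphic, of c] A_not_pole [OF assms(1)] assms(2) w(2) by (simp add: open_Compl)
  have d3: "(R has_field_derivative deriv R (B c)) (at (B (\<Psi> w)))"
    using holomorphic_derivI [OF R(2) open_A] B_in_A [OF assms(1)] w(2) by simp
  have d4: "((\<lambda>w. B (\<Psi> w)) has_field_derivative 0) (at w)"
    using DERIV_chain2 [where f = B and g = \<Psi>, OF d2 d1] by simp
  have "((\<lambda>w. R (B (\<Psi> w))) has_field_derivative 0) (at w)"
    using DERIV_chain2 [where f = R and g = "\<lambda>w. B (\<Psi> w)", OF d3 d4] by simp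
  then have "((\<lambda>w. w ^ (d + 1)) has_field_derivative 0) (at w)"
  proof (rule has_field_derivative_transform_within_open [OF _ open_ball w(1)])
    fix x :: complex assume x: "x \<in> ball 0 1"
    then have "x ^ (d + 1) \<in> ball 0 1"
      using power_less_one_iff [of "cmod x" "d + 1"] by (simp add: norm_power del: power_Suc)
    then show "R (B (\<Psi> x)) = x ^ (d + 1)"
      using R(7,8) x by simp
  qed
  moreover have "((\<lambda>w. w ^ (d + 1)) has_field_derivative of_nat (d + 1) * w ^ d) (at w)"
    using DERIV_power [OF DERIV_ident [of "at w"], of "d + 1"] by simp
  ultimately have "of_nat (d + 1) * w ^ d = 0"
    using DERIV_unique by blast
  then have "w = 0"
    by (simp del: of_nat_Suc of_nat_add)
  then show ?thesis
    using w(2) R(3) by simp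
qed

subsection \<open>Fixed points on the frontier\<close>

text \<open>
  By Bloch's theorem the image of the disc of radius \<open>(1 - |w|)/2\<close> around \<open>w\<close> contains a disc of
  radius \<open>(1 - |w|)|\<Psi>'(w)|/24\<close>, whereas discs in \<open>A\<close> near the frontier are small.
\<close>

lemma little_Bloch:
  assumes \<Psi>: "\<Psi> holomorphic_on ball 0 1" "\<And>w. w \<in> ball 0 1 \<Longrightarrow> \<Psi> w \<in> A"
    "\<And>w. w \<in> ball 0 1 \<Longrightarrow> R (\<Psi> w) = w"
    and R: "R holomorphic_on A" "\<And>z. z \<in> A \<Longrightarrow> R z \<in> ball 0 1"
    and e: "e > 0"
  obtains \<rho> where "\<rho> < 1" "\<And>w. cmod w < 1 \<Longrightarrow> \<rho> < cmod w \<Longrightarrow> (1 - cmod w) * cmod (deriv \<Psi> w) \<le> e"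
proof -
  \<comment> \<open>The factor 24 combines Bloch's constant 1/12 with the radius
    \<open>(1 - cmod w) / 2\<close>. \<open>K\<close> consists of the points at distance at least
    \<open>c\<close> from the complement of \<open>A\<close>.\<close>
  define c where "c = e / 24"
  define K where "K = {z. c \<le> infdist z (- A)}"
  have ne: "- A \<noteq> {}"
    using A_subset by auto
  have KA: "K \<subseteq> A"
  proof
    fix z assume "z \<in> K"
    then have "infdist z (- A) \<noteq> 0"
      using e by (simp add: K_def c_def)
    then show "z \<in> A"
      using infdist_zero [of z "- A"] by blast
  qed
  have "closed K"
    unfolding K_def by (intro closed_Collect_le continuous_intros)
  moreover have "bounded K"
    using bounded_subset [OF bounded_ball, of K] KA A_subset by blast
  ultimately have "compact K"
    by (simp add: compact_eq_bounded_closed)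
  then obtain \<rho>0 where \<rho>0: "\<rho>0 < 1" "\<And>z. z \<in> K \<Longrightarrow> cmod (R z) \<le> \<rho>0"
    using A_compact_subset_inverse_bound [OF R _ KA] by metis
  show ?thesis
  proof
    \<comment> \<open>The bound is chosen so that a point \<open>x\<close> with
      \<open>cmod x \<le> \<rho>0\<close> cannot be closer to \<open>w\<close> than
      \<open>(1 - cmod w) / 2\<close>.\<close>
    show "(2 * \<rho>0 + 1) / 3 < 1"
      using \<rho>0 by simp
    fix w assume w: "cmod w < 1" "(2 * \<rho>0 + 1) / 3 < cmod w"
    show "(1 - cmod w) * cmod (deriv \<Psi> w) \<le> e"
    proof (rule ccontr)
      assume "\<not> ?thesis"
      then have big: "(1 - cmod w) * cmod (deriv \<Psi> w) > e"
        by simp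
      define s where "s = (1 - cmod w) / 2"
      have s: "s > 0"
        using w by (simp add: s_def)
      have sub: "ball w s \<subseteq> ball 0 1"
      proof
        fix x assume "x \<in> ball w s"
        then have "cmod (x - w) < s"
          by (simp add: dist_norm norm_minus_commute)
        then show "x \<in> ball 0 1"
          using norm_triangle_ineq [of w "x - w"] w by (simp add: s_def)
      qed
      have "c \<le> s * cmod (deriv \<Psi> w) / 12"
        using big by (simp add: c_def s_def)
      then obtain b where b: "ball b c \<subseteq> \<Psi> ` ball w s"
        using Bloch [OF holomorphic_on_subset [OF \<Psi>(1) sub] s] by metis
      have c0: "c > 0"
        using e by (simp add: c_def)
      then have "b \<in> \<Psi> ` ball w s"
        using b by auto
      then obtain x where x: "x \<in> ball w s" "b = \<Psi> x"
        by blast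
      have "ball b c \<subseteq> A"
        using b \<Psi>(2) sub by blast
      then have "c \<le> dist b y" if "y \<in> - A" for y
        using that by (meson ComplD mem_ball not_less subsetD)
      then have "b \<in> K"
        unfolding K_def using ne by (auto simp: infdist_def intro!: cINF_greatest)
      then have "cmod x \<le> \<rho>0"
        using \<rho>0(2) \<Psi>(3) x sub by (metis subsetD)
      moreover have "cmod w \<le> cmod x + cmod (w - x)"
        using norm_triangle_ineq [of x "w - x"] by simp
      moreover have "cmod (w - x) < s"
        using x(1) by (simp add: dist_norm)
      ultimately show False
        using w unfolding s_def by argo
    qed
  qed
qed

text \<open>
  With \<open>\<Psi> w = w exp (v w)\<close>, the functional equation gives
  \<open>g (\<Psi> w) = \<eta> w exp ((v (w\<^sup>d\<^sup>+\<^sup>1) - v w) / d)\<close> for a \<open>d\<close>-th root of unity \<open>\<eta>\<close>. Along the fixed ray of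
  direction \<open>\<zeta>\<close> the exponent tends to \<open>0\<close>, so the ray accumulates only at points with \<open>g = \<eta> \<zeta>\<close>.
\<close>

lemma frontier_point_of_ray:
  assumes \<omega>: "\<omega> ^ d = 1"
  obtains z where "z \<in> frontier A" "g z = \<omega>"
proof -
  obtain \<Psi> R where R: "\<Psi> holomorphic_on ball 0 1" "R holomorphic_on A" "\<Psi> 0 = 0"
    "\<And>z. z \<in> A \<Longrightarrow> R z \<in> ball 0 1" "\<And>z. z \<in> A \<Longrightarrow> \<Psi> (R z) = z"
    "\<And>w. w \<in> ball 0 1 \<Longrightarrow> \<Psi> w \<in> A" "\<And>w. w \<in> ball 0 1 \<Longrightarrow> R (\<Psi> w) = w"
    "\<And>w. w \<in> ball 0 1 \<Longrightarrow> B (\<Psi> w) = \<Psi> (w ^ (d + 1))"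
    by (rule Boettcher, rule that) blast+
  have "inj_on \<Psi> (ball 0 1)"
    using R(7) by (rule inj_on_inverseI)
  then obtain E where E: "E holomorphic_on ball 0 1" "\<And>w. w \<in> ball 0 1 \<Longrightarrow> \<Psi> w = w * E w"
    "\<And>w. w \<in> ball 0 1 \<Longrightarrow> E w \<noteq> 0"
    using holomorphic_divide_out_zero [OF R(1) open_ball _ R(3)] by auto
  obtain v where v: "v holomorphic_on ball 0 1" "\<And>w. w \<in> ball 0 1 \<Longrightarrow> E w = exp (v w)"
    using contractible_imp_holomorphic_log [OF E(1) convex_imp_contractible [OF convex_ball] E(3)] by metis
  have pw: "w ^ (d + 1) \<in> ball 0 1" if "w \<in> ball 0 1" for w :: complex
    using that power_less_one_iff [of "cmod w" "d + 1"] by (simp add: norm_power del: power_Suc)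
  define x where "x = (\<lambda>w. exp ((v (w ^ (d + 1)) - v w) / d))"
  \<comment> \<open>Off \<open>0\<close> this is \<open>g (\<Psi> w) / (w * x w)\<close>, with
    \<open>w\<close> cancelled so that it is holomorphic at \<open>0\<close>. The functional
    equation makes it a root of unity there, hence it is constant.\<close>
  define Q where "Q = (\<lambda>w. E w * ((\<Psi> w - a) / (1 - cnj a * \<Psi> w)) / x w)"
  have \<Psi>p: "\<Psi> w \<noteq> pole" if "w \<in> ball 0 1" for w
    using R(6) [OF that] A_not_pole by blast
  have hx: "(\<lambda>w. v (w ^ (d + 1))) holomorphic_on ball 0 1"
  proof -
    have "v \<circ> (\<lambda>w. w ^ (d + 1)) holomorphic_on ball 0 1"
      by (rule holomorphic_on_compose_gen [OF _ v(1)]) (use pw in \<open>auto intro!: holomorphic_intros simp del: mem_ball_0 power_Suc\<close>)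
    then show ?thesis
      by (simp add: o_def)
  qed
  have "Q holomorphic_on ball 0 1"
    unfolding Q_def x_def using E(1) R(1) v(1) hx \<Psi>p denom_nz d_pos by (intro holomorphic_intros) auto
  then have "continuous_on (ball 0 1) Q"
    by (rule holomorphic_on_imp_continuous_on)
  moreover have Qd: "Q w ^ d = 1" if w: "w \<in> ball 0 1" "w \<noteq> 0" for w
  proof -
    define m where "m = (\<Psi> w - a) / (1 - cnj a * \<Psi> w)"
    have "\<Psi> w * (\<Psi> w * m) ^ d = w ^ (d + 1) * E (w ^ (d + 1))"
      using R(8) [OF w(1)] E(2) [OF pw [OF w(1)]] unfolding B_eq_g g_def m_def by simp
    then have "(w * E w) * (w * E w * m) ^ d = w ^ (d + 1) * E (w ^ (d + 1))"
      unfolding E(2) [OF w(1)] .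
    then have "w ^ (d + 1) * (E w * (E w * m) ^ d) = w ^ (d + 1) * E (w ^ (d + 1))"
      by (simp add: power_mult_distrib mult_ac)
    then have "E w * (E w * m) ^ d = E (w ^ (d + 1))"
      using w(2) by (metis mult_cancel_left power_not_zero)
    then have "exp (v w) * (E w * m) ^ d = exp (v (w ^ (d + 1)))"
      using v(2) pw w(1) by simp
    then have "(E w * m) ^ d = exp (v (w ^ (d + 1)) - v w)"
      by (simp add: exp_diff field_simps)
    also have "\<dots> = x w ^ d"
      unfolding x_def using d_pos by (simp add: exp_of_nat_mult [symmetric])
    finally have "(E w * m) ^ d = x w ^ d" .
    moreover have "x w \<noteq> 0"
      by (simp add: x_def)
    moreover have "Q w = E w * m / x w"
      by (simp only: Q_def m_def)
    ultimately show ?thesis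
      by (simp add: power_divide)
  qed
  moreover have "finite (Q ` ball 0 1)"
  proof (rule finite_subset)
    show "Q ` ball 0 1 \<subseteq> insert (Q 0) {z. z ^ d = 1}"
    proof (rule image_subsetI)
      fix y :: complex assume "y \<in> ball 0 1"
      then show "Q y \<in> insert (Q 0) {z. z ^ d = 1}"
        using Qd [of y] by (cases "y = 0") auto
    qed
    show "finite (insert (Q 0) {z. z ^ d = 1})"
      using finite_roots_unity [of d] d_ge_1 by simp
  qed
  ultimately have "Q constant_on ball 0 1"
    by (intro continuous_finite_range_constant) auto
  then obtain \<eta> where \<eta>: "\<And>w. w \<in> ball 0 1 \<Longrightarrow> Q w = \<eta>"
    unfolding constant_on_def by metis
  have \<eta>d: "\<eta> ^ d = 1"
    using Qd [of "1 / 2"] \<eta> [of "1 / 2"] by (simp add: norm_divide)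
  then have "\<eta> \<noteq> 0"
    using d_pos by (metis power_0_left not_less_zero zero_neq_one less_numeral_extra(3))
  \<comment> \<open>The direction of the ray is chosen so that the limit
    \<open>\<eta> * \<zeta>\<close> of \<open>g\<close> along it is the prescribed
    \<open>\<omega>\<close>.\<close>
  define \<zeta> where "\<zeta> = \<omega> / \<eta>"
  have \<zeta>: "\<zeta> ^ d = 1" "\<eta> * \<zeta> = \<omega>"
    using \<omega> \<eta>d \<open>\<eta> \<noteq> 0\<close> by (simp_all add: \<zeta>_def power_divide)
  then have "cmod \<zeta> ^ d = 1"
    by (simp add: norm_power [symmetric])
  then have n\<zeta>: "cmod \<zeta> = 1"
    using d_pos power_eq_1_iff [of "cmod \<zeta>" d] by simp
  have g\<Psi>: "g (\<Psi> w) = \<eta> * w * x w" if w: "w \<in> ball 0 1" for w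
  proof -
    have "E w * ((\<Psi> w - a) / (1 - cnj a * \<Psi> w)) = \<eta> * x w"
    proof -
      define m where "m = E w * ((\<Psi> w - a) / (1 - cnj a * \<Psi> w))"
      have "m / x w = \<eta>" "x w \<noteq> 0"
        using \<eta> [OF w] by (simp_all only: Q_def m_def) (simp add: x_def)
      then show ?thesis
        unfolding m_def [symmetric] by (simp add: divide_eq_eq)
    qed
    then have "w * E w * ((\<Psi> w - a) / (1 - cnj a * \<Psi> w)) = w * (\<eta> * x w)"
      by (simp only: mult.assoc)
    then show ?thesis
      unfolding g_def E(2) [OF w, symmetric] by (simp only: mult_ac)
  qed
  have dv: "deriv v w = deriv \<Psi> w / \<Psi> w - 1 / w" if w: "w \<in> ball 0 1" "w \<noteq> 0" for w
  proof -
    have "(v has_field_derivative deriv v w) (at w)"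
      using holomorphic_derivI [OF v(1) open_ball w(1)] .
    then have "((\<lambda>w. w * exp (v w)) has_field_derivative exp (v w) + w * (exp (v w) * deriv v w)) (at w)"
      by (auto intro!: derivative_eq_intros)
    then have "(\<Psi> has_field_derivative exp (v w) + w * (exp (v w) * deriv v w)) (at w)"
      by (rule has_field_derivative_transform_within_open [OF _ open_ball w(1)]) (use E(2) v(2) in auto)
    then have "deriv \<Psi> w = exp (v w) + w * (exp (v w) * deriv v w)"
      by (rule DERIV_imp_deriv)
    moreover have "\<Psi> w = w * exp (v w)"
      using E(2) v(2) w by simp
    ultimately show ?thesis
      using w(2) by (simp add: field_simps)
  qed
  \<comment> \<open>Between \<open>s ^ (d + 1)\<close> and \<open>s\<close> the ray has length at
    most \<open>d * (1 - s)\<close>, and there \<open>deriv v\<close> is at most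
    \<open>2 * e1 / (1 - s)\<close>. The product is \<open>2 * d * e1 = e\<close>.\<close>
  have small: "\<exists>\<rho>::real. \<rho> < 1 \<and>
      (\<forall>s::real. \<rho> < s \<longrightarrow> s < 1 \<longrightarrow>
        cmod (v ((of_real s * \<zeta>) ^ (d + 1)) - v (of_real s * \<zeta>)) \<le> e)" if e: "e > 0" for e
  proof -
    define e1 where "e1 = e / (2 * d)"
    have e1: "e1 > 0"
      using e d_pos by (simp add: e1_def)
    \<comment> \<open>Near the circle \<open>\<Psi>\<close> stays outside this disc, so dividing by
      \<open>\<Psi> w\<close> in \<open>dv\<close> costs only a constant.\<close>
    have "cball 0 (r / 2) \<subseteq> A"
      using r_pos unfolding A_def by (intro subset_trans [OF _ UN_upper [of 0]]) auto
    then obtain \<rho>1 where \<rho>1: "\<rho>1 < 1" "\<And>z. z \<in> cball 0 (r / 2) \<Longrightarrow> cmod (R z) \<le> \<rho>1"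
      using A_compact_subset_inverse_bound [OF R(2,4) compact_cball] by metis
    obtain \<rho>2 where \<rho>2: "\<rho>2 < 1"
      "\<And>w. cmod w < 1 \<Longrightarrow> \<rho>2 < cmod w \<Longrightarrow> (1 - cmod w) * cmod (deriv \<Psi> w) \<le> e1 * (r / 2)"
      using little_Bloch [OF R(1,6,7,2,4), of "e1 * (r / 2)"] e1 r_pos by auto
    define \<rho>3 where "\<rho>3 = max (max \<rho>1 \<rho>2) (max (1 / 2) (1 - e1 / 2))"
    have "\<rho>3 < 1"
      using \<rho>1 \<rho>2 e1 by (simp add: \<rho>3_def)
    have dvb: "(1 - cmod w) * cmod (deriv v w) \<le> 2 * e1" if w: "cmod w < 1" "\<rho>3 < cmod w" for w
    proof -
      have ww: "w \<in> ball 0 1" "w \<noteq> 0" "cmod w > 1 / 2" "\<rho>1 < cmod w" "\<rho>2 < cmod w" "1 - cmod w < e1 / 2"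
        using w by (auto simp: \<rho>3_def)
      have "\<Psi> w \<notin> cball 0 (r / 2)"
        using \<rho>1(2) [of "\<Psi> w"] R(7) [OF ww(1)] ww(4) by force
      then have \<Psi>r: "cmod (\<Psi> w) > r / 2"
        by simp
      have "(1 - cmod w) * cmod (deriv \<Psi> w / \<Psi> w) = ((1 - cmod w) * cmod (deriv \<Psi> w)) / cmod (\<Psi> w)"
        by (simp add: norm_divide)
      also have "\<dots> \<le> (e1 * (r / 2)) / (r / 2)"
        using \<rho>2(2) [OF w(1) ww(5)] \<Psi>r r_pos e1 by (intro frac_le) auto
      finally have 1: "(1 - cmod w) * cmod (deriv \<Psi> w / \<Psi> w) \<le> e1"
        using r_pos by simp
      have "(1 - cmod w) * cmod (1 / w) \<le> (e1 / 2) * 2"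
        using ww w(1) e1 by (intro mult_mono) (auto simp: norm_divide divide_simps)
      then have 2: "(1 - cmod w) * cmod (1 / w) \<le> e1"
        by simp
      have "(1 - cmod w) * cmod (deriv v w)
          \<le> (1 - cmod w) * (cmod (deriv \<Psi> w / \<Psi> w) + cmod (1 / w))"
        unfolding dv [OF ww(1,2)] using w(1) by (intro mult_left_mono norm_triangle_ineq4) auto
      then show ?thesis
        using 1 2 by (simp add: distrib_left)
    qed
    have "((\<lambda>s. s ^ (d + 1)) \<longlongrightarrow> 1 ^ (d + 1)) (at_left (1::real))"
      by (intro tendsto_intros)
    then have "eventually (\<lambda>s. \<rho>3 < s ^ (d + 1)) (at_left (1::real))"
      using \<open>\<rho>3 < 1\<close> by (intro order_tendstoD(1)) auto
    then obtain b where b: "b < 1" "\<And>s. b < s \<Longrightarrow> s < 1 \<Longrightarrow> \<rho>3 < s ^ (d + 1)"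
      unfolding eventually_at_left_field by blast
    have "cmod (v ((s * \<zeta>) ^ (d + 1)) - v (s * \<zeta>)) \<le> e" if s: "max b 0 < s" "s < 1" for s :: real
    proof -
      have s': "0 < s" "b < s"
        using s by auto
      define t where "t = s ^ (d + 1)"
      have ts: "\<rho>3 < t" "t \<le> s" "0 < t"
        using b(2) [OF s'(2) s(2)] s' s(2) power_decreasing [of 1 "d + 1" s] by (auto simp: t_def)
      \<comment> \<open>The ray is invariant because \<open>\<zeta> ^ d = 1\<close>.\<close>
      have s\<zeta>: "(s * \<zeta>) ^ (d + 1) = t * \<zeta>"
        using \<zeta>(1) by (simp add: t_def power_mult_distrib)
      have "cmod (v (t * \<zeta>) - v (s * \<zeta>)) \<le> (2 * e1 / (1 - s)) * cmod (t * \<zeta> - s * \<zeta>)"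
      proof (rule field_differentiable_bound [of "closed_segment (t * \<zeta>) (s * \<zeta>)" v "deriv v"])
        fix y assume "y \<in> closed_segment (t * \<zeta>) (s * \<zeta>)"
        then obtain u where u: "0 \<le> u" "u \<le> 1" "y = (1 - u) *\<^sub>R (t * \<zeta>) + u *\<^sub>R (s * \<zeta>)"
          by (auto simp: in_segment)
        define p where "p = (1 - u) * t + u * s"
        have y: "y = p * \<zeta>"
          by (simp add: u p_def scaleR_conv_of_real algebra_simps)
        have p: "t \<le> p" "p \<le> s"
        proof -
          have "0 \<le> u * (s - t)" "0 \<le> (1 - u) * (s - t)"
            using u ts by simp_all
          then show "t \<le> p" "p \<le> s"
            by (simp_all add: p_def algebra_simps)
        qed
        have ny: "cmod y = p"
          using p ts by (simp add: y norm_mult n\<zeta>)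
        have "y \<in> ball 0 1"
          using ny p s(2) by simp
        then show "(v has_field_derivative deriv v y) (at y within closed_segment (t * \<zeta>) (s * \<zeta>))"
          by (rule has_field_derivative_at_within [OF holomorphic_derivI [OF v(1) open_ball]])
        have "(1 - s) * cmod (deriv v y) \<le> (1 - cmod y) * cmod (deriv v y)"
          using p by (intro mult_right_mono) (auto simp: ny)
        also have "\<dots> \<le> 2 * e1"
          using p ts s(2) ny by (intro dvb) linarith+
        finally show "cmod (deriv v y) \<le> 2 * e1 / (1 - s)"
          using s(2) by (simp add: field_simps)
      qed auto
      also have "\<dots> \<le> 2 * e1 / (1 - s) * (d * (1 - s))"
      proof (rule mult_left_mono)
        have "t * \<zeta> - s * \<zeta> = of_real (t - s) * \<zeta>"
          by (simp add: algebra_simps)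
        then have "cmod (t * \<zeta> - s * \<zeta>) = s - t"
          using ts n\<zeta> by (simp only: norm_mult norm_of_real) simp
        also have "\<dots> = s * (1 - s ^ d)"
          by (simp add: t_def algebra_simps)
        also have "\<dots> \<le> 1 * (1 - s ^ d)"
          using s' s(2) power_le_one [of s d] by (intro mult_right_mono) auto
        also have "\<dots> \<le> d * (1 - s)"
          using Bernoulli_inequality [of "s - 1" d] s' by (simp add: algebra_simps)
        finally show "cmod (t * \<zeta> - s * \<zeta>) \<le> d * (1 - s)" .
      qed (use e1 s(2) in simp)
      also have "\<dots> = e"
        using s(2) d_pos by (simp add: e1_def)
      finally show ?thesis
        unfolding s\<zeta> .
    qed
    then show ?thesis
      using b(1) by (intro exI [of _ "max b 0"]) auto
  qed
  define s :: "nat \<Rightarrow> real" where "s = (\<lambda>n. 1 - 1 / real (n + 2))"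
  have s01: "0 < s n" "s n < 1" for n
    by (simp_all add: s_def divide_simps)
  have s1: "s \<longlonglongrightarrow> 1"
  proof -
    have "(\<lambda>n. 1 - 1 / real (n + 2)) \<longlonglongrightarrow> 1 - 0"
      by (intro tendsto_diff tendsto_const LIMSEQ_ignore_initial_segment [OF lim_1_over_n])
    then show ?thesis
      by (simp add: s_def)
  qed
  have sball: "s n * \<zeta> \<in> ball 0 1" for n
    using s01 [of n] n\<zeta> by (simp add: norm_mult)
  have "(\<lambda>n. v ((s n * \<zeta>) ^ (d + 1)) - v (s n * \<zeta>)) \<longlonglongrightarrow> 0"
  proof (rule metric_LIMSEQ_I)
    fix e :: real assume "e > 0"
    then obtain \<rho> :: real where \<rho>: "\<rho> < 1"
      "\<And>s. \<rho> < s \<Longrightarrow> s < 1 \<Longrightarrow> cmod (v ((of_real s * \<zeta>) ^ (d + 1)) - v (of_real s * \<zeta>)) \<le> e / 2"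
      using small [of "e / 2"] by auto
    have "eventually (\<lambda>n. \<rho> < s n) sequentially"
      using s1 \<rho>(1) by (rule order_tendstoD(1))
    then obtain N where N: "\<And>n. n \<ge> N \<Longrightarrow> \<rho> < s n"
      unfolding eventually_sequentially by blast
    show "\<exists>N. \<forall>n\<ge>N. dist (v ((s n * \<zeta>) ^ (d + 1)) - v (s n * \<zeta>)) 0 < e"
    proof (intro exI allI impI)
      fix n assume "n \<ge> N"
      then have "cmod (v ((s n * \<zeta>) ^ (d + 1)) - v (s n * \<zeta>)) \<le> e / 2"
        using N s01(2) by (intro \<rho>(2)) auto
      then show "dist (v ((s n * \<zeta>) ^ (d + 1)) - v (s n * \<zeta>)) 0 < e"
        unfolding dist_norm diff_0_right using \<open>e > 0\<close> by linarith
    qed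
  qed
  then have "(\<lambda>n. x (s n * \<zeta>)) \<longlonglongrightarrow> exp (0 / of_nat d)"
    unfolding x_def using d_pos by (intro tendsto_intros) auto
  then have "(\<lambda>n. \<eta> * (of_real (s n) * \<zeta>) * x (s n * \<zeta>)) \<longlonglongrightarrow> \<eta> * (of_real 1 * \<zeta>) * exp (0 / of_nat d)"
    using s1 by (intro tendsto_intros)
  then have lim: "(\<lambda>n. g (\<Psi> (s n * \<zeta>))) \<longlonglongrightarrow> \<omega>"
    using g\<Psi> [OF sball] \<zeta>(2) by simp
  have sA: "\<Psi> (s n * \<zeta>) \<in> A" for n
    using R(6) [OF sball] .
  obtain z \<sigma> where z: "z \<in> sublevel" "strict_mono (\<sigma> :: nat \<Rightarrow> nat)" "((\<lambda>n. \<Psi> (s n * \<zeta>)) \<circ> \<sigma>) \<longlonglongrightarrow> z"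
  proof (rule seq_compactE)
    show "seq_compact sublevel"
      using compact_sublevel compact_imp_seq_compact by blast
    show "\<forall>n. \<Psi> (s n * \<zeta>) \<in> sublevel"
      using sA A_subset_sublevel by blast
  qed
  have "z \<in> closure A"
    using z(3) sA unfolding closure_sequential by (intro exI [of _ "(\<lambda>n. \<Psi> (s n * \<zeta>)) \<circ> \<sigma>"]) simp
  \<comment> \<open>Otherwise continuity of \<open>R\<close> would give
    \<open>R z = \<zeta>\<close>, a point of the circle.\<close>
  moreover have "z \<notin> A"
  proof
    assume zA: "z \<in> A"
    have "isCont R z"
      using holomorphic_on_imp_continuous_on [OF R(2)] open_A zA by (simp add: continuous_on_eq_continuous_at)
    from isCont_tendsto_compose [OF this z(3)]
    have "(\<lambda>n. s (\<sigma> n) * \<zeta>) \<longlonglongrightarrow> R z"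
      using R(7) [OF sball] by (simp add: o_def)
    moreover have "(\<lambda>n. s (\<sigma> n) * \<zeta>) \<longlonglongrightarrow> of_real 1 * \<zeta>"
      using LIMSEQ_subseq_LIMSEQ [OF s1 z(2)] by (intro tendsto_intros) (simp add: o_def)
    ultimately have "R z = \<zeta>"
      using LIMSEQ_unique by fastforce
    then show False
      using R(4) [OF zA] n\<zeta> by simp
  qed
  ultimately have "z \<in> frontier A"
    using open_A by (simp add: frontier_def interior_open)
  moreover have "g z = \<omega>"
  proof -
    have "isCont g z"
      using z(1) by (intro isCont_g) (simp add: sublevel_def)
    from isCont_tendsto_compose [OF this z(3)] show ?thesis
      using LIMSEQ_unique [OF _ LIMSEQ_subseq_LIMSEQ [OF lim z(2)]] by (simp add: o_def)
  qed
  ultimately show ?thesis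
    using that by blast
qed

text \<open>The relation \<open>eq\<close> is Vieta's for the two solutions of
  \<open>g z = \<omega>\<close>. It yields
  \<open>2 * ((X1 - 1) * (X2 - 1)) = (1 - C) * (1 - (cmod a)\<^sup>2)\<close>, which is negative, so
  one factor is positive.\<close>

lemma Re_circle_pair:
  assumes z: "cmod z1 = 1" "cmod z2 = 1" "z1 \<noteq> z2" and eq: "z1 + z2 = a + z1 * z2 * cnj a"
  shows "Re (cnj a * z1) > 1 \<or> Re (cnj a * z2) > 1"
proof -
  define X1 X2 C where "X1 = Re (cnj a * z1)" and "X2 = Re (cnj a * z2)" and "C = Re (z1 * cnj z2)"
  have zz: "z1 * cnj z1 = 1" "z2 * cnj z2 = 1"
    using z by (simp_all add: complex_norm_square [symmetric])
  have aa: "a * cnj a = of_real ((cmod a)\<^sup>2)"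
    by (rule complex_norm_square [symmetric])
  have sum: "X1 + X2 = 1 + C"
  proof -
    have "cnj z1 * (z1 + z2) = cnj z1 * (a + z1 * z2 * cnj a)"
      by (simp only: eq)
    then have "1 + z2 * cnj z1 = a * cnj z1 + cnj a * z2"
      using zz(1) by (simp add: algebra_simps)
    then have "Re (1 + z2 * cnj z1) = Re (a * cnj z1 + cnj a * z2)"
      by simp
    then show ?thesis
      by (simp add: X1_def X2_def C_def mult.commute)
  qed
  have prod: "2 * (X1 * X2) = X1 + X2 - (cmod a)\<^sup>2 + (cmod a)\<^sup>2 * C"
  proof -
    have "2 * (X1 * X2) = Re ((cnj a * z1) * (cnj a * z2)) + Re ((cnj a * z1) * cnj (cnj a * z2))"
      by (simp add: X1_def X2_def algebra_simps)
    also have "(cnj a * z1) * (cnj a * z2) = cnj a * (z1 + z2 - a)"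
      unfolding eq by (simp add: algebra_simps)
    also have "Re (cnj a * (z1 + z2 - a)) = X1 + X2 - (cmod a)\<^sup>2"
      using arg_cong [OF aa, of Re] by (simp add: X1_def X2_def algebra_simps)
    also have "(cnj a * z1) * cnj (cnj a * z2) = (a * cnj a) * (z1 * cnj z2)"
      by (simp add: mult_ac)
    also have "Re \<dots> = (cmod a)\<^sup>2 * C"
      unfolding aa C_def by (simp add: Re_divide)
    finally show ?thesis .
  qed
  have "C < 1"
  proof -
    have "(cmod (z1 - z2))\<^sup>2 = 2 - 2 * C"
      using z unfolding C_def cmod_power2 by (simp add: cmod_def power2_eq_square algebra_simps)
    moreover have "(cmod (z1 - z2))\<^sup>2 > 0"
      using z(3) by simp
    ultimately show ?thesis
      by linarith
  qed
  have "2 * ((X1 - 1) * (X2 - 1)) = (1 - C) * (1 - (cmod a)\<^sup>2)"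
    using sum prod by (simp add: algebra_simps)
  moreover have "1 < (cmod a)\<^sup>2"
    using norm_a by (simp add: power2_eq_square less_1_mult)
  ultimately have "(X1 - 1) * (X2 - 1) < 0"
    using \<open>C < 1\<close> mult_pos_neg [of "1 - C" "1 - (cmod a)\<^sup>2"] by simp
  then have "X1 - 1 > 0 \<or> X2 - 1 > 0"
    by (simp add: mult_less_0_iff) linarith
  then show ?thesis
    by (simp add: X1_def X2_def)
qed

lemma B_has_derivative:
  assumes "z \<noteq> pole" "z \<noteq> 0" "z \<noteq> a"
  shows "deriv B z = - B z * (cnj a * (of_nat d + 1) * z\<^sup>2 - (2 * of_nat d + 1 + a * cnj a) * z
      + a * (of_nat d + 1)) / (z * (z - a) * (1 - cnj a * z))"
proof -
  obtain e where e: "d = Suc e"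
    using d_pos gr0_implies_Suc by blast
  define u v where "u = 1 - cnj a * z" and "v = z - a"
  have nz: "u \<noteq> 0" "v \<noteq> 0"
    using denom_nz assms by (simp_all add: u_def v_def)
  define h where "h = cnj a * (of_nat d + 1) * z\<^sup>2 - (2 * of_nat d + 1 + a * cnj a) * z + a * (of_nat d + 1)"
  have "deriv B z = - (z ^ d * v ^ (d - 1) / u ^ (d + 1) * h)"
    unfolding u_def v_def h_def
    by (rule DERIV_imp_deriv) (use Bmap_deriv [OF d_ge_1 denom_nz [OF assms(1)]] in \<open>simp only: B_def [abs_def]\<close>)
  also have "\<dots> = - B z * h / (z * v * u)"
    unfolding B_def u_def [symmetric] v_def [symmetric] using nz assms(2)
    by (simp add: e power_divide field_simps)
  finally show ?thesis
    unfolding u_def v_def h_def .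
qed

text \<open>At a fixed point this logarithmic derivative is the multiplier; on the circle it is real.\<close>

lemma circle_multiplier:
  assumes "cmod z = 1"
  shows "z * deriv B z / B z = of_real ((2 * d + 1 + (cmod a)\<^sup>2 - 2 * (d + 1) * Re (cnj a * z)) / (cmod (z - a))\<^sup>2)"
proof -
  have zz: "z * cnj z = 1"
    using assms by (simp add: complex_norm_square [symmetric])
  then have z0: "z \<noteq> 0"
    by auto
  have B0: "B z \<noteq> 0"
    using norm_B_circle [OF assms] by auto
  have za: "z \<noteq> a" "z \<noteq> pole"
    using circle_not_a circle_not_pole assms by auto
  have u: "1 - cnj a * z = z * cnj (z - a)"
    using zz by (simp add: algebra_simps)
  have h: "cnj a * (of_nat d + 1) * z\<^sup>2 - (2 * of_nat d + 1 + a * cnj a) * z + a * (of_nat d + 1)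
     = - z * of_real (2 * d + 1 + (cmod a)\<^sup>2 - 2 * (d + 1) * Re (cnj a * z))"
  proof -
    define X where "X = Re (cnj a * z)"
    have X: "2 * of_real X = cnj a * z + a * cnj z"
      using complex_add_cnj [of "cnj a * z"] by (simp add: X_def)
    have "complex_of_real (2 * d + 1 + (cmod a)\<^sup>2 - 2 * (d + 1) * X)
        = 2 * of_nat d + 1 + of_real ((cmod a)\<^sup>2) - (of_nat d + 1) * (2 * of_real X)"
      by (simp add: algebra_simps)
    then have "complex_of_real (2 * d + 1 + (cmod a)\<^sup>2 - 2 * (d + 1) * Re (cnj a * z))
        = 2 * of_nat d + 1 + a * cnj a - (of_nat d + 1) * (cnj a * z + a * cnj z)"
      unfolding X complex_norm_square unfolding X_def .
    then have "- z * of_real (2 * d + 1 + (cmod a)\<^sup>2 - 2 * (d + 1) * Re (cnj a * z))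
        = - z * (2 * of_nat d + 1 + a * cnj a - (of_nat d + 1) * (cnj a * z + a * cnj z))"
      by (simp only:)
    also have "\<dots> = - z * (2 * of_nat d + 1 + a * cnj a) + (of_nat d + 1) * (cnj a * z\<^sup>2 + a * (z * cnj z))"
      by (simp add: algebra_simps power2_eq_square)
    finally have E: "- z * of_real (2 * d + 1 + (cmod a)\<^sup>2 - 2 * (d + 1) * Re (cnj a * z))
        = - z * (2 * of_nat d + 1 + a * cnj a) + (of_nat d + 1) * (cnj a * z\<^sup>2 + a * (z * cnj z))" .
    show ?thesis
      unfolding E zz by (simp add: algebra_simps)
  qed
  have "z * deriv B z / B z = of_real (2 * d + 1 + (cmod a)\<^sup>2 - 2 * (d + 1) * Re (cnj a * z)) / ((z - a) * cnj (z - a))"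
    unfolding B_has_derivative [OF za(2) z0 za(1)] h u using B0 z0 za(1)
    by (simp add: divide_simps del: complex_cnj_diff)
  then show ?thesis
    unfolding complex_norm_square [symmetric] by simp
qed

section \<open>Points of the circle away from the closure of \<open>A\<close>\<close>

lemma U_iterate: "z \<in> U n \<Longrightarrow> cmod ((B ^^ n) z) < r"
proof (induction n arbitrary: z)
  case (Suc n)
  then have "cmod ((B ^^ n) (B z)) < r"
    by simp
  then show ?case
    by (simp add: funpow_Suc_right del: funpow.simps)
qed simp

text \<open>A small disc about \<open>z\<close> is mapped into itself and, having radius at most
  \<open>1 - r\<close>, misses the disc of radius \<open>r\<close> that every orbit in
  \<open>A\<close> enters.\<close>

lemma attracting_not_in_closure_A:
  assumes z: "cmod z = 1" "B z = z" "cmod (deriv B z) < 1"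
  shows "z \<notin> closure A"
proof
  assume zc: "z \<in> closure A"
  obtain q where q: "cmod (deriv B z) < q" "q < 1"
    using dense z(3) by blast
  have zp: "z \<noteq> pole"
    using circle_not_pole z(1) by blast
  have "(B has_field_derivative deriv B z) (at z)"
    using holomorphic_derivI [OF B_holomorphic, of z] zp by (simp add: open_Compl)
  then have "((\<lambda>y. (B y - B z) / (y - z)) \<longlongrightarrow> deriv B z) (at z)"
    by (simp add: has_field_derivative_iff)
  then have "eventually (\<lambda>y. cmod ((B y - B z) / (y - z)) < q) (at z)"
    using tendsto_norm order_tendstoD(2) q(1) by blast
  then obtain \<delta>0 where \<delta>0: "\<delta>0 > 0" "\<And>y. y \<noteq> z \<Longrightarrow> dist y z < \<delta>0 \<Longrightarrow> cmod ((B y - B z) / (y - z)) < q"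
    unfolding eventually_at by blast
  define \<delta> where "\<delta> = min \<delta>0 (1 - r)"
  have \<delta>: "\<delta> > 0" "\<delta> \<le> 1 - r"
    using \<delta>0(1) r_less_1 by (auto simp: \<delta>_def)
  have step: "cmod (B y - z) < \<delta>" if "cmod (y - z) < \<delta>" for y
  proof (cases "y = z")
    case False
    have "cmod ((B y - B z) / (y - z)) < 1"
      using \<delta>0(2) [OF False] that q(2) by (auto simp: \<delta>_def dist_norm)
    then show ?thesis
      using False that z(2) by (simp add: norm_divide divide_less_eq)
  qed (use z(2) \<delta> in simp)
  have iter: "cmod ((B ^^ n) y - z) < \<delta>" if "cmod (y - z) < \<delta>" for n y
    by (induction n) (use that step in auto)
  obtain y where y: "y \<in> A" "dist y z < \<delta>"
    using zc \<delta>(1) by (auto simp: closure_approachable)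
  then obtain n where n: "y \<in> U n"
    by (auto simp: A_def)
  have "cmod z \<le> cmod ((B ^^ n) y) + cmod ((B ^^ n) y - z)"
    using norm_triangle_ineq4 [of "(B ^^ n) y" "(B ^^ n) y - z"] by simp
  then show False
    using U_iterate [OF n] iter [of y n] y(2) z(1) \<delta>(2) by (simp add: dist_norm)
qed

text \<open>The real part has the sign of the radial derivative of the modulus of \<open>B\<close>.
  If it is negative, that modulus rises above one just inside the circle, so nearby points leave the
  disc and are not in \<open>A\<close>.\<close>

lemma outward_not_in_closure_A:
  assumes z: "cmod z = 1" "Re (z * deriv B z / B z) < 0"
  shows "z \<notin> closure A"
proof
  assume zc: "z \<in> closure A"
  have zp: "z \<noteq> pole"
    using circle_not_pole z(1) by blast
  have B0: "B z \<noteq> 0"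
    using norm_B_circle [OF z(1)] by auto
  have "isCont (\<lambda>y. Re (y * deriv B y / B y)) z"
  proof -
    have "isCont (deriv B) z"
      using holomorphic_on_imp_continuous_on [OF holomorphic_deriv [OF B_holomorphic]] zp
      by (simp add: continuous_on_eq_continuous_at open_Compl)
    then show ?thesis
      using isCont_B [OF zp] B0 by (intro continuous_Re continuous_divide continuous_mult continuous_ident) auto
  qed
  then have "((\<lambda>y. Re (y * deriv B y / B y)) \<longlongrightarrow> Re (z * deriv B z / B z)) (nhds z)"
    unfolding isCont_def tendsto_nhds_iff by blast
  then have "eventually (\<lambda>y. Re (y * deriv B y / B y) < 0) (nhds z)"
    using z(2) by (rule order_tendstoD(2))
  moreover have "eventually (\<lambda>y. y \<noteq> pole) (nhds z)"
    using t1_space_nhds zp by blast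
  moreover have "eventually (\<lambda>y. B y \<noteq> 0) (nhds z)"
    using isCont_B [OF zp] B0 by (intro tendsto_imp_eventually_ne [of B "B z"]) (simp_all add: continuous_at tendsto_nhds_iff)
  ultimately have "eventually (\<lambda>y. Re (y * deriv B y / B y) < 0 \<and> y \<noteq> pole \<and> B y \<noteq> 0) (nhds z)"
    by eventually_elim auto
  then obtain \<delta> where \<delta>: "\<delta> > 0"
    "\<And>y. dist y z < \<delta> \<Longrightarrow> Re (y * deriv B y / B y) < 0 \<and> y \<noteq> pole \<and> B y \<noteq> 0"
    unfolding eventually_nhds_metric by blast
  have "min (\<delta> / 2) (1 / 2) > 0"
    using \<delta>(1) by simp
  then obtain y where y: "y \<in> A" "dist y z < min (\<delta> / 2) (1 / 2)"
    using zc unfolding closure_approachable by blast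
  have y1: "cmod y < 1"
    using y(1) by (rule A_norm_less_1)
  have yz: "1 - cmod y \<le> cmod (y - z)"
    using norm_triangle_ineq2 [of z y] z(1) by (simp add: norm_minus_commute)
  then have y0: "cmod y > 0"
    using y(2) by (auto simp: dist_norm)
  \<comment> \<open>\<open>e\<close> is the radial projection of \<open>y\<close> to the circle. The
    segment from \<open>y\<close> to \<open>e\<close> has length at most
    \<open>cmod (y - z)\<close>, hence stays within \<open>\<delta>\<close> of
    \<open>z\<close>.\<close>
  define e where "e = y / cmod y"
  have e1: "cmod e = 1"
    using y0 by (simp add: e_def norm_divide)
  have ye: "y = cmod y * e"
    using y0 by (simp add: e_def)
  define \<psi> where "\<psi> = (\<lambda>s::real. (cmod (B (s * e)))\<^sup>2)"
  have "\<psi> 1 < \<psi> (cmod y)"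
  proof (rule DERIV_neg_imp_decreasing [OF y1])
    fix s assume s: "cmod y \<le> s" "s \<le> 1"
    have "cmod (s * e - z) \<le> cmod (s * e - y) + cmod (y - z)"
      using norm_triangle_ineq [of "s * e - y" "y - z"] by simp
    also have "s * e - y = of_real (s - cmod y) * e"
      by (subst ye) (simp add: algebra_simps)
    also have "cmod (of_real (s - cmod y) * e) = s - cmod y"
      using s e1 by (simp only: norm_mult norm_of_real) simp
    finally have "dist (s * e) z < \<delta>"
      using s yz y(2) by (simp add: dist_norm)
    note D = \<delta>(2) [OF this]
    have s0: "s > 0"
      using y0 s(1) by (rule less_le_trans)
    have "(B has_field_derivative deriv B (s * e)) (at (s * e))"
      using holomorphic_derivI [OF B_holomorphic, of "s * e"] D by (simp add: open_Compl)
    then have "((\<lambda>w. B (w * e)) has_field_derivative deriv B (s * e) * e) (at (of_real s))"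
      by (rule DERIV_chain2 [where f = B and g = "\<lambda>w. w * e"]) (auto intro!: derivative_eq_intros)
    from has_vector_derivative_real_field [OF this]
    have V: "((\<lambda>s. B (of_real s * e)) has_vector_derivative deriv B (s * e) * e) (at s)" .
    have dRe: "((\<lambda>s. Re (B (of_real s * e))) has_real_derivative Re (deriv B (s * e) * e)) (at s)"
      unfolding has_real_derivative_iff_has_vector_derivative
      by (rule bounded_linear.has_vector_derivative [OF bounded_linear_Re V])
    have dIm: "((\<lambda>s. Im (B (of_real s * e))) has_real_derivative Im (deriv B (s * e) * e)) (at s)"
      unfolding has_real_derivative_iff_has_vector_derivative
      by (rule bounded_linear.has_vector_derivative [OF bounded_linear_Im V])
    have "(\<psi> has_real_derivative 2 * Re (B (s * e)) * Re (deriv B (s * e) * e)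
        + 2 * Im (B (s * e)) * Im (deriv B (s * e) * e)) (at s)"
      unfolding \<psi>_def cmod_power2
      using DERIV_add [OF DERIV_power [OF dRe, of 2] DERIV_power [OF dIm, of 2]] by (simp add: mult_ac)
    moreover have "2 * Re (B (s * e)) * Re (deriv B (s * e) * e) + 2 * Im (B (s * e)) * Im (deriv B (s * e) * e) < 0"
    proof -
      define b where "b = B (s * e)"
      define D' where "D' = deriv B (s * e) * e"
      have "of_real s * e * deriv B (s * e) / b = of_real (s / (cmod b)\<^sup>2) * (cnj b * D')"
      proof -
        have "complex_of_real (s / (cmod b)\<^sup>2) = of_real s / (b * cnj b)"
          by (simp only: of_real_divide complex_norm_square)
        moreover have "b \<noteq> 0"
          using D by (simp add: b_def)
        ultimately show ?thesis
          unfolding D'_def by (simp only: mult_ac) (simp add: field_simps)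
      qed
      then have "Re (of_real (s / (cmod b)\<^sup>2) * (cnj b * D')) < 0"
        using D by (simp add: b_def)
      then have "s / (cmod b)\<^sup>2 * Re (cnj b * D') < 0"
        unfolding Re_complex_of_real Im_complex_of_real times_complex.simps by linarith
      then have "Re (cnj b * D') < 0"
        using s0 D by (simp add: mult_less_0_iff zero_less_divide_iff divide_less_0_iff b_def)
      then show ?thesis
        unfolding b_def [symmetric] D'_def [symmetric] by simp
    qed
    ultimately show "\<exists>l. (\<psi> has_real_derivative l) (at s) \<and> l < 0"
      by blast
  qed
  then have "1 < (cmod (B y))\<^sup>2"
    using norm_B_circle [OF e1] ye by (simp add: \<psi>_def)
  then have "\<not> cmod (B y) < 1"
    by (metis abs_norm_cancel abs_square_less_1 less_asym)
  then show False
    using B_in_A [OF y(1)] A_norm_less_1 by blast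
qed

text \<open>Expanding \<open>(cmod (z - a))\<^sup>2\<close> shows that the real multiplier
  \<open>l\<close> is below one when \<open>X > 1\<close>. Then \<open>z\<close> is attracting if
  \<open>l\<close> is nonnegative, and the outward case applies otherwise.\<close>

lemma fixed_not_in_closure_A:
  assumes z: "cmod z = 1" "B z = z" "Re (cnj a * z) > 1"
  shows "z \<notin> closure A"
proof -
  define X where "X = Re (cnj a * z)"
  have n: "(cmod (z - a))\<^sup>2 = 1 + (cmod a)\<^sup>2 - 2 * X"
    using z(1) unfolding X_def cmod_power2 by (simp add: cmod_def power2_eq_square algebra_simps)
  have n0: "(cmod (z - a))\<^sup>2 > 0"
    using circle_not_a [OF z(1)] by simp
  define l where "l = (2 * d + 1 + (cmod a)\<^sup>2 - 2 * (d + 1) * X) / (cmod (z - a))\<^sup>2"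
  have l: "z * deriv B z / B z = of_real l"
    using circle_multiplier [OF z(1)] by (simp add: l_def X_def)
  have "real d * 1 < real d * X"
    using z(3) d_pos unfolding X_def by (intro mult_strict_left_mono) auto
  then have "l < 1"
    using n n0 by (simp add: l_def divide_less_eq algebra_simps)
  show ?thesis
  proof (cases "l < 0")
    case True
    then show ?thesis
      using outward_not_in_closure_A [OF z(1)] l by simp
  next
    case False
    have "z \<noteq> 0"
      using z(1) by auto
    then have "deriv B z = of_real l"
      using l z(2) by simp
    then show ?thesis
      using attracting_not_in_closure_A [OF z(1,2)] \<open>l < 1\<close> False by simp
  qed
qed

lemma frontier_A_subset: "frontier A \<subseteq> sublevel - A"
  using closure_A_subset_sublevel open_A by (auto simp: frontier_def interior_open)

text \<open>Distinct points would be the two roots of the quadratic equation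
  \<open>g z = \<omega>\<close>. Their product \<open>- \<omega>\<close> has modulus one and both
  lie in the closed disc, so both lie on the circle, where \<open>Re_circle_pair\<close> excludes
  one of them.\<close>

lemma frontier_g_inj:
  assumes z: "z1 \<in> frontier A" "z2 \<in> frontier A" and g: "g z1 = g z2" "g z1 ^ d = 1"
  shows "z1 = z2"
proof (rule ccontr)
  assume ne: "z1 \<noteq> z2"
  define \<omega> where "\<omega> = g z1"
  have le: "cmod z1 \<le> 1" "cmod z2 \<le> 1" and np: "z1 \<noteq> pole" "z2 \<noteq> pole"
    using z frontier_A_subset by (auto simp: sublevel_def)
  have q: "z * (z - a) = \<omega> * (1 - cnj a * z)" if "z \<noteq> pole" "g z = \<omega>" for z
    using denom_nz [OF that(1)] that(2) by (auto simp: g_def field_simps)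
  note q1 = q [OF np(1) \<omega>_def [symmetric]] and q2 = q [OF np(2) g(1) [symmetric, folded \<omega>_def]]
  have "(z1 - z2) * (z1 + z2 - (a - \<omega> * cnj a)) = 0"
    using q1 q2 by (simp add: algebra_simps)
  then have sum: "z1 + z2 = a - \<omega> * cnj a"
    using ne by simp
  have prod: "z1 * z2 = - \<omega>"
  proof -
    have z2: "z2 = a - \<omega> * cnj a - z1"
      using sum by (simp add: algebra_simps)
    have "z1 * z2 = - (z1 * (z1 - a)) - \<omega> * cnj a * z1"
      unfolding z2 by (simp add: algebra_simps)
    also have "\<dots> = - \<omega>"
      unfolding q1 by (simp add: algebra_simps)
    finally show ?thesis .
  qed
  have "cmod \<omega> ^ d = 1"
    using g(2) by (simp add: \<omega>_def norm_power [symmetric])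
  then have "cmod \<omega> = 1"
    using d_pos power_eq_1_iff [of "cmod \<omega>" d] by simp
  then have "cmod z1 * cmod z2 = 1"
    using prod by (metis norm_minus_cancel norm_mult)
  then have n: "cmod z1 = 1" "cmod z2 = 1"
    using le mult_left_le [of "cmod z2" "cmod z1"] mult_left_le [of "cmod z1" "cmod z2"]
    by (auto simp: mult.commute)
  have "z1 + z2 = a + z1 * z2 * cnj a"
    unfolding sum prod by simp
  then have "Re (cnj a * z1) > 1 \<or> Re (cnj a * z2) > 1"
    by (rule Re_circle_pair [OF n ne])
  moreover have "B z1 = z1" "B z2 = z2"
    using g by (simp_all add: B_eq_g)
  ultimately show False
    using fixed_not_in_closure_A n z by (auto simp: frontier_def)
qed

lemma card_frontier_fixed_points: "card {z \<in> frontier A. B z = z} = d"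
proof -
  \<comment> \<open>The factor \<open>z\<close> may be cancelled, since \<open>0\<close> is interior
    to \<open>A\<close>.\<close>
  have eq: "{z \<in> frontier A. B z = z} = {z \<in> frontier A. g z ^ d = 1}"
    using frontier_A_subset zero_in_A by (auto simp: B_eq_g)
  have "bij_betw g {z \<in> frontier A. g z ^ d = 1} {w. w ^ d = 1}"
    unfolding bij_betw_def
  proof
    show "inj_on g {z \<in> frontier A. g z ^ d = 1}"
      using frontier_g_inj by (auto simp: inj_on_def)
    show "g ` {z \<in> frontier A. g z ^ d = 1} = {w. w ^ d = 1}"
    proof (intro subset_antisym subsetI)
      fix w :: complex assume "w \<in> {w. w ^ d = 1}"
      then have w: "w ^ d = 1"
        by simp
      then obtain z where "z \<in> frontier A" "g z = w"
        by (rule frontier_point_of_ray)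
      then show "w \<in> g ` {z \<in> frontier A. g z ^ d = 1}"
        using w by blast
    qed auto
  qed
  then show ?thesis
    unfolding eq using bij_betw_same_card card_roots_unity_eq [OF d_pos] by fastforce
qed

lemma h_root_not_in_A:
  assumes "cnj a * (of_nat d + 1) * z\<^sup>2 - (2 * of_nat d + 1 + (of_real (cmod a))\<^sup>2) * z + a * (of_nat d + 1) = 0"
  shows "z \<notin> A"
proof
  assume z: "z \<in> A"
  have "z \<noteq> 0"
  proof
    assume "z = 0"
    then have "a * of_nat (Suc d) = 0"
      using assms by (simp add: add.commute)
    then show False
      using a_nz of_nat_neq_0 by (simp del: of_nat_Suc)
  qed
  moreover have "z \<noteq> pole" "z \<noteq> a"
    using A_not_pole [OF z] A_norm_less_1 [OF z] norm_a by auto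
  ultimately have "deriv B z = 0"
    using B_has_derivative [of z] assms complex_norm_square [of a] by simp
  then show False
    using critical_point_in_A [OF z] \<open>z \<noteq> 0\<close> by blast
qed

subsection \<open>The immediate basins on the sphere\<close>

text \<open>Generic points are covered by \<open>B_reflect\<close>. The exceptional ones are
  exchanged in pairs: \<open>0\<close> with infinity, and the zero \<open>a\<close> with the
  pole.\<close>

lemma Bmap_reflect: "Bmap d a (reflect p) = reflect (Bmap d a p)"
proof (cases p)
  case (Fin z)
  have "Bmap d a (Fin a) = Fin 0"
    using pole_not_a d_pos by (subst Bmap_Fin) (auto simp: B_def)
  moreover have "reflect (Fin pole) = Fin a"
    using pole_nz by (simp add: pole_def)
  moreover have "reflect (Fin a) = Fin pole"
    using a_nz by (simp add: pole_def)
  moreover have "Bmap d a (Fin (1 / cnj z)) = Fin (1 / cnj (B z))" "B z \<noteq> 0"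
    if "z \<noteq> 0" "z \<noteq> pole" "z \<noteq> a"
  proof -
    have "1 / cnj z \<noteq> pole"
      using that a_nz by (auto simp: pole_def)
    then show "Bmap d a (Fin (1 / cnj z)) = Fin (1 / cnj (B z))"
      using Bmap_Fin [of "1 / cnj z"] unfolding B_reflect [OF that(1,2)] by blast
    show "B z \<noteq> 0"
      using that denom_nz by (simp add: B_def)
  qed
  moreover have "Bmap d a (Fin 0) = Fin 0"
    using Bmap_Fin [of 0] pole_nz by simp
  ultimately show ?thesis
    unfolding Fin using Bmap_pole Bmap_Fin [of z]
    by (cases "z = 0 \<or> z = pole \<or> z = a") (auto simp del: Bmap.simps(1))
next
  case Infty
  then show ?thesis
    using Bmap_Fin [of 0] pole_nz by simp
qed

text \<open>After the orbit has entered the disc of radius \<open>r\<close>, each step at least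
  halves the modulus.\<close>

lemma B_iterates_tendsto_0:
  assumes "z \<in> A"
  shows "(\<lambda>n. (B ^^ n) z) \<longlonglongrightarrow> 0"
proof -
  obtain m where m: "z \<in> U m"
    using assms by (auto simp: A_def)
  have bound: "cmod ((B ^^ (n + m)) z) \<le> r * (1 / 2) ^ n" for n
  proof (induction n)
    case 0
    then show ?case
      using U_iterate [OF m] by simp
  next
    case (Suc n)
    have "r * (1 / 2) ^ n \<le> r * 1"
      using r_pos by (intro mult_left_mono power_le_one) auto
    then have "cmod (B ((B ^^ (n + m)) z)) \<le> cmod ((B ^^ (n + m)) z) / 2"
      using Suc by (intro B_contracts) simp
    then show ?case
      using Suc by simp
  qed
  have "(\<lambda>n. r * (1 / 2) ^ n) \<longlonglongrightarrow> r * 0"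
    by (intro tendsto_mult tendsto_const LIMSEQ_power_zero) simp
  then have lim: "(\<lambda>n. r * (1 / 2) ^ n) \<longlonglongrightarrow> 0"
    by simp
  have "(\<lambda>n. (B ^^ (n + m)) z) \<longlonglongrightarrow> 0"
    by (rule Lim_null_comparison [OF always_eventually [OF allI [OF bound]] lim])
  then show ?thesis
    by (rule LIMSEQ_offset)
qed

lemma Bmap_iterate:
  assumes "\<And>k. (B ^^ k) z \<noteq> pole"
  shows "(Bmap d a ^^ n) (Fin z) = Fin ((B ^^ n) z)"
proof (induction n)
  case (Suc n)
  then show ?case
    using Bmap_Fin [OF assms [of n]] by simp
qed simp

lemma iterate_in_A: "z \<in> A \<Longrightarrow> (B ^^ k) z \<in> A"
  by (induction k) (auto intro: B_in_A)

lemma Fin_A_subset_basin: "Fin ` A \<subseteq> basin (Bmap d a) (Fin 0)"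
proof
  fix p assume "p \<in> Fin ` A"
  then obtain z where z: "z \<in> A" "p = Fin z"
    by blast
  have "(\<lambda>n. Fin ((B ^^ n) z)) \<longlonglongrightarrow> Fin 0"
    by (rule tendsto_continuous_on_UNIV [OF continuous_on_Fin B_iterates_tendsto_0 [OF z(1)]])
  then show "p \<in> basin (Bmap d a) (Fin 0)"
    using Bmap_iterate [of z] iterate_in_A [OF z(1)] A_not_pole by (simp add: basin_def z(2))
qed

lemma basin_eventually:
  assumes "p \<in> basin (Bmap d a) (Fin 0)" "open V" "0 \<in> V"
  shows "eventually (\<lambda>n. (Bmap d a ^^ n) p \<in> Fin ` V) sequentially"
  using assms topological_tendstoD [OF _ open_Fin_image [OF assms(2)]] unfolding basin_def by blast

lemma circle_not_in_basin:
  assumes "cmod z = 1"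
  shows "Fin z \<notin> basin (Bmap d a) (Fin 0)"
proof
  assume b: "Fin z \<in> basin (Bmap d a) (Fin 0)"
  have n: "cmod ((B ^^ k) z) = 1" for k
    by (induction k) (use assms norm_B_circle in auto)
  obtain k where "(Bmap d a ^^ k) (Fin z) \<in> Fin ` ball 0 1"
    using eventually_happens' [OF sequentially_bot basin_eventually [OF b open_ball, of 0 1]] by auto
  moreover have "(Bmap d a ^^ k) (Fin z) = Fin ((B ^^ k) z)"
    using n circle_not_pole by (intro Bmap_iterate) blast
  ultimately show False
    using n [of k] by auto
qed

lemma pole_not_in_basin: "Fin pole \<notin> basin (Bmap d a) (Fin 0)"
proof
  assume b: "Fin pole \<in> basin (Bmap d a) (Fin 0)"
  have "(Bmap d a ^^ n) Infty = Infty" for n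
    by (induction n) auto
  then have "(Bmap d a ^^ Suc n) (Fin pole) = Infty" for n
    unfolding funpow_Suc_right o_def Bmap_pole .
  moreover obtain N where "\<And>n. n \<ge> N \<Longrightarrow> (Bmap d a ^^ n) (Fin pole) \<in> Fin ` ball 0 1"
    using basin_eventually [OF b open_ball, of 0 1] unfolding eventually_sequentially by auto
  ultimately show False
    by (metis imageE le_SucI order_refl riemann_sphere.distinct(1))
qed

lemma in_U_if_iterate:
  assumes "\<And>k. (B ^^ k) z \<in> ball 0 1 - {pole}" "cmod ((B ^^ n) z) < r"
  shows "z \<in> U n"
  using assms
proof (induction n arbitrary: z)
  case (Suc n)
  have "B z \<in> U n"
  proof (rule Suc.IH)
    show "(B ^^ k) (B z) \<in> ball 0 1 - {pole}" for k
      using Suc.prems(1) [of "Suc k"] by (simp add: funpow_swap1)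
    show "cmod ((B ^^ n) (B z)) < r"
      using Suc.prems(2) by (simp add: funpow_swap1)
  qed
  then show ?case
    using Suc.prems(1) [of 0] by simp
qed simp

text \<open>The immediate basin \<open>T\<close> is connected and cannot cross the invariant circle,
  so it lies in the disc. It is also forward invariant, so its orbits stay in the disc until they
  enter the disc of radius \<open>r\<close>, which puts their starting points in some
  \<open>U n\<close>.\<close>

lemma immediate_basin_0: "immediate_basin (Bmap d a) (Fin 0) = Fin ` A"
proof
  let ?b = "basin (Bmap d a) (Fin 0)"
  define T where "T = immediate_basin (Bmap d a) (Fin 0)"
  have cA: "connected (Fin ` A)"
    using connected_continuous_image [OF continuous_on_Fin connected_A] .
  then show "Fin ` A \<subseteq> immediate_basin (Bmap d a) (Fin 0)"
    unfolding immediate_basin_def using zero_in_A Fin_A_subset_basin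
    by (intro connected_component_maximal) auto
  then have T0: "Fin 0 \<in> T"
    using zero_in_A unfolding T_def by blast
  have Tb: "T \<subseteq> ?b" and cT: "connected T"
    by (simp_all add: T_def immediate_basin_def connected_component_subset)
  have disc: "T \<subseteq> Fin ` ball 0 1"
  proof (rule ccontr)
    assume "\<not> ?thesis"
    then obtain p where p: "p \<in> T" "p \<notin> Fin ` ball 0 1"
      by blast
    have op: "open (Fin ` ball 0 1)" "open (- Fin ` cball 0 1)"
      using open_Fin_image closed_Fin_image [OF compact_cball] by (auto simp: open_Compl)
    have cover: "T \<subseteq> Fin ` ball 0 1 \<union> - Fin ` cball 0 1"
    proof
      fix q assume "q \<in> T"
      then have "q \<noteq> Fin z" if "cmod z = 1" for z
        using circle_not_in_basin [OF that] Tb by blast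
      then show "q \<in> Fin ` ball 0 1 \<union> - Fin ` cball 0 1"
        by (cases q) (force simp: image_iff)+
    qed
    have "Fin ` ball 0 1 \<inter> T = {} \<or> - Fin ` cball 0 1 \<inter> T = {}"
      by (rule connectedD [OF cT op _ cover]) auto
    moreover have "Fin 0 \<in> Fin ` ball 0 1" "p \<in> - Fin ` cball 0 1"
      using p cover by auto
    ultimately show False
      using T0 p(1) by blast
  qed
  define T' where "T' = fin ` T"
  have TT': "T = Fin ` T'"
    using disc by (force simp: T'_def image_image)
  have T'D: "T' \<subseteq> ball 0 1 - {pole}"
    using disc TT' pole_not_in_basin Tb by auto
  have "connected T'"
    unfolding T'_def using cT disc
    by (intro connected_continuous_image continuous_on_subset [OF continuous_on_fin]) auto
  \<comment> \<open>Forward invariance: the image is connected, lies in the basin and contains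
    \<open>0\<close>, hence is part of the same component.\<close>
  then have "connected (Fin ` B ` T')"
    using T'D by (intro connected_continuous_image continuous_on_Fin B_continuous_on) auto
  moreover have "Fin ` B ` T' \<subseteq> ?b"
  proof
    fix q assume "q \<in> Fin ` B ` T'"
    then obtain z where z: "z \<in> T'" "q = Fin (B z)"
      by blast
    have "z \<noteq> pole"
      using T'D z(1) by auto
    then have q: "q = Bmap d a (Fin z)"
      unfolding z(2) by (rule Bmap_Fin [symmetric])
    have "Fin z \<in> ?b"
      using z(1) Tb TT' by auto
    then show "q \<in> ?b"
      unfolding q by (rule basin_forward)
  qed
  moreover have "Fin 0 \<in> Fin ` B ` T'"
    using T0 TT' by (auto intro!: image_eqI [of _ _ 0])
  ultimately have "Fin ` B ` T' \<subseteq> T"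
    unfolding T_def immediate_basin_def by (intro connected_component_maximal) auto
  then have BT': "B z \<in> T'" if "z \<in> T'" for z
    using that TT' by auto
  have "T' \<subseteq> A"
  proof
    fix z assume z: "z \<in> T'"
    have it: "(B ^^ k) z \<in> T'" for k
      by (induction k) (use z BT' in auto)
    then have itD: "(B ^^ k) z \<in> ball 0 1 - {pole}" for k
      using T'D by blast
    have "Fin z \<in> ?b"
      using z TT' Tb by blast
    then have "eventually (\<lambda>n. (Bmap d a ^^ n) (Fin z) \<in> Fin ` ball 0 r) sequentially"
      using r_pos by (intro basin_eventually) auto
    from eventually_happens' [OF sequentially_bot this]
    obtain n where "(Bmap d a ^^ n) (Fin z) \<in> Fin ` ball 0 r"
      by blast
    moreover have "(Bmap d a ^^ n) (Fin z) = Fin ((B ^^ n) z)"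
      using itD by (intro Bmap_iterate) blast
    ultimately have "cmod ((B ^^ n) z) < r"
      by auto
    then have "z \<in> U n"
      using in_U_if_iterate itD by blast
    then show "z \<in> A"
      by (auto simp: A_def)
  qed
  then show "immediate_basin (Bmap d a) (Fin 0) \<subseteq> Fin ` A"
    using TT' unfolding T_def by blast
qed

lemma immediate_basin_Infty: "immediate_basin (Bmap d a) Infty = reflect ` Fin ` A"
  using immediate_basin_reflect [where f = "Bmap d a" and p = "Fin 0", OF Bmap_reflect] immediate_basin_0 by simp

lemma frontier_fixed_points_0:
  "{p \<in> frontier (Fin ` A). Bmap d a p = p} = Fin ` {z \<in> frontier A. B z = z}"
proof -
  have "frontier (Fin ` A) = Fin ` frontier A"
    using bounded_subset [OF bounded_ball, of A 0 1] A_subset open_A by (intro frontier_Fin_image) auto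
  moreover have "z \<noteq> pole" if "z \<in> frontier A" for z
    using that frontier_A_subset by (auto simp: sublevel_def)
  ultimately show ?thesis
    using Bmap_Fin by auto
qed

text \<open>The quadratic \<open>h\<close> is self-reciprocal:
  \<open>(cnj z)\<^sup>2 * h (1 / cnj z) = cnj (h z)\<close>.\<close>

lemma reflect_free_critical_points:
  assumes "c \<in> free_critical_points d a"
  shows "reflect c \<in> free_critical_points d a"
proof -
  define h where "h = (\<lambda>z. cnj a * (of_nat d + 1) * z\<^sup>2 - (2 * of_nat d + 1 + (of_real (cmod a))\<^sup>2) * z
              + a * (of_nat d + 1))"
  obtain z where z: "c = Fin z" "h z = 0"
    using assms unfolding free_critical_points_eq_roots [OF d_ge_1 norm_a] h_def by blast
  have "z \<noteq> 0"
  proof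
    assume "z = 0"
    then have "a * of_nat (Suc d) = 0"
      using z(2) by (simp add: h_def add.commute)
    then show False
      using a_nz of_nat_neq_0 by (simp del: of_nat_Suc)
  qed
  have "(cnj z)\<^sup>2 * h (1 / cnj z) = cnj (h z)"
    using \<open>z \<noteq> 0\<close> by (simp add: h_def power2_eq_square field_simps)
  then have "h (1 / cnj z) = 0"
    using z(2) \<open>z \<noteq> 0\<close> by simp
  then show ?thesis
    unfolding free_critical_points_eq_roots [OF d_ge_1 norm_a] z(1)
    using \<open>z \<noteq> 0\<close> by (intro image_eqI [of _ _ "1 / cnj z"]) (simp, simp only: h_def mem_Collect_eq)
qed

lemma free_critical_points_not_in_A:
  assumes "c \<in> free_critical_points d a"
  shows "c \<notin> Fin ` A"
  using assms h_root_not_in_A unfolding free_critical_points_eq_roots [OF d_ge_1 norm_a] by blast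

end

theorem theorem11:
  fixes d :: nat and a :: complex
  assumes "d \<ge> 1" and "cmod a > 1"
  shows "free_critical_points d a \<inter>
           (immediate_basin (Bmap d a) (Fin 0) \<union> immediate_basin (Bmap d a) Infty) = {}
       \<and> simply_connected (immediate_basin (Bmap d a) (Fin 0))
       \<and> simply_connected (immediate_basin (Bmap d a) Infty)
       \<and> card {p \<in> frontier (immediate_basin (Bmap d a) Infty). Bmap d a p = p} = d
       \<and> card {p \<in> frontier (immediate_basin (Bmap d a) (Fin 0)). Bmap d a p = p} = d"
proof -
  interpret bmap d a
    using assms by unfold_locales
  define Z where "Z = {p \<in> frontier (Fin ` A). Bmap d a p = p}"
  have Z: "card Z = d"
    unfolding Z_def frontier_fixed_points_0 using card_frontier_fixed_points
    by (subst card_image) (auto simp: inj_on_def)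
  \<comment> \<open>As an involutive homeomorphism commuting with \<open>Bmap\<close>, the inversion
    matches the fixed points on the two frontiers.\<close>
  have "{p \<in> frontier (reflect ` Fin ` A). Bmap d a p = p} = reflect ` Z"
    unfolding frontier_reflect Z_def by (auto simp: Bmap_reflect image_iff) (metis reflect_reflect)
  moreover have "inj_on reflect Z"
    by (rule inj_on_inverseI [of _ reflect]) simp
  ultimately have "card {p \<in> frontier (reflect ` Fin ` A). Bmap d a p = p} = d"
    using Z by (simp add: card_image)
  moreover have "free_critical_points d a \<inter> (Fin ` A \<union> reflect ` Fin ` A) = {}"
    using free_critical_points_not_in_A reflect_free_critical_points reflect_image_iff by blast
  moreover have "simply_connected (Fin ` A)"
    using simply_connected_A by (rule simply_connected_Fin_image)
  moreover from this have "simply_connected (reflect ` Fin ` A)"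
    by (rule simply_connected_reflect)
  ultimately show ?thesis
    unfolding immediate_basin_0 immediate_basin_Infty using Z unfolding Z_def by blast
qed

end
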